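(* Let $(F,\mu)\in\{(\mathcal{E},\sigma),(\mathcal{E}_p,\sigma_p)\}$, where in the second case the fixed directions satisfy $\mathrm{Span}(\theta_1,\dots,\theta_p)=\mathbb{R}^d$. Let $0<\alpha_0<n/2$ and let $\nu$ be a probability measure on $\mathbb{R}^{n\times d}$, absolutely continuous with respect to the Lebesgue measure. For $\alpha\in(0,\alpha_0]$ let $(Y_\alpha^{(t)})_{t\in\mathbb{N}}$ be an SGD sequence of step $\alpha$, $$Y_\alpha^{(t+1)}=Y_\alpha^{(t)}-\alpha\,\varphi(Y_\alpha^{(t)},\theta^{(t+1)}),\qquad \big(Y_\alpha^{(0)},(\theta^{(t)})_{t\in\mathbb{N}}\big)\sim\nu\otimes\mu^{\otimes\mathbb{N}},$$ and let $Y_\alpha:\mathbb{R}_+\to\mathbb{R}^{n\times d}$ be its piecewise affine interpolation, $Y_\alpha(s)=Y_\alpha^{(t)}+(\frac s\alpha-t)(Y_\alpha^{(t+1)}-Y_\alpha^{(t)})$ for $s\in[t\alpha,(t+1)\alpha)$, $t\in\mathbb{N}$. Then for any compact $\mathcal{K}\subset\mathbb{R}^{n\times d}$ and any $\varepsilon>0$, $$\lim_{\alpha\to0,\ \alpha\in(0,\alpha_0]}\ \nu\otimes\mu^{\otimes\mathbb{N}}\big(d_c(Y_\alpha,S_{-\partial_CF}(\mathcal{K}))>\varepsilon\big)=0.$$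
   Context: Let $n,d\ge1$. A matrix $Y\in\mathbb{R}^{n\times d}$ is written $Y=(y_1,\dots,y_n)^T$ with rows $y_k\in\mathbb{R}^d$, $\gamma_Y:=\frac1n\sum_k\delta_{y_k}$, $\|Y\|_{\infty,2}:=\max_k\|y_k\|_2$. Fix $Z=(z_1,\dots,z_n)^T\in\mathbb{R}^{n\times d}$. $\sigma$ is the uniform probability measure on the unit sphere $\mathbb{S}^{d-1}$ of $\mathbb{R}^d$, and for fixed directions $\theta_1,\dots,\theta_p\in\mathbb{S}^{d-1}$, $\sigma_p:=\frac1p\sum_{i=1}^p\delta_{\theta_i}$. With $P_\theta(x)=\theta^Tx$, $\#$ the push-forward and $\mathrm{W}_2$ the 2-Wasserstein distance, set $w_\theta(Y):=\mathrm{W}_2^2(P_\theta\#\gamma_Y,P_\theta\#\gamma_Z)$, $\mathcal{E}(Y):=\int w_\theta(Y)\,d\sigma(\theta)$, $\mathcal{E}_p(Y):=\int w_\theta(Y)\,d\sigma_p(\theta)$; these are locally Lipschitz functions of $Y$. For $\theta\in\mathbb{S}^{d-1}$ and a matrix $X$ with $n$ rows, $\tau_X^\theta$ is a permutation of $\{1,\dots,n\}$ with $\theta^Tx_{\tau_X^\theta(1)}\le\dots\le\theta^Tx_{\tau_X^\theta(n)}$ (chosen arbitrarily when ambiguous). The almost-everywhere gradient of $w_\theta(Y)$ in $Y$ is $\varphi(Y,\theta)\in\mathbb{R}^{n\times d}$, whose $k$-th row is (the transpose of) $\frac2n\theta\theta^T\big(y_k-z_{\tau_Z^\theta\circ(\tau_Y^\theta)^{-1}(k)}\big)$.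 For $f:\mathbb{R}^D\to\mathbb{R}$ locally Lipschitz with differentiability set $\mathcal{D}_f$, the Clarke sub-differential is $\partial_Cf(x):=\mathrm{conv}\{v:\exists(x_i)\in\mathcal{D}_f^{\mathbb{N}},\ x_i\to x,\ \nabla f(x_i)\to v\}$. $\mathcal{C}_{\mathrm{abs}}(\mathbb{R}_+,\mathbb{R}^{n\times d})$ is the set of absolutely continuous curves, with the metric $d_c(Y,Y'):=\sum_{k\ge1}2^{-k}\min\big(1,\max_{s\in[0,k]}\|Y(s)-Y'(s)\|_{\infty,2}\big)$, and $d_c(Y,S):=\inf_{Y'\in S}d_c(Y,Y')$. Finally $S_{-\partial_CF}(\mathcal{K}):=\{Y\in\mathcal{C}_{\mathrm{abs}}(\mathbb{R}_+,\mathbb{R}^{n\times d}):\dot Y(s)\in-\partial_CF(Y(s))\text{ for almost every }s\in\mathbb{R}_+,\ Y(0)\in\mathcal{K}\}$.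
   Formalization: The probability is taken of the event that Y_α^{(0)} lies in K and d_c(Y_α, S(K)) > ε; without requiring the initial point to lie in K the claim fails (e.g. K = {0}, ν Gaussian, ε < 1). If ν(K) = 1 this is the stated claim. *)

theory Defs
  imports "HOL-Analysis.Analysis" "HOL-Probability.Probability"
begin

text \<open>
  A matrix with \<open>n\<close> rows in \<open>d\<close>-space is a term of type \<open>real ^ 'd ^ 'n\<close>; its \<open>k\<close>-th row is
  \<open>Y $ k\<close>, and its inner product is the Frobenius one. The row index type \<open>'n\<close> plays the
  role of \<open>{1..n}\<close>; it is linearly ordered so that sorting permutations make sense.
\<close>

section \<open>Sliced Wasserstein energies\<close>

definition empirical_measure :: "'i set \<Rightarrow> ('i \<Rightarrow> 'a::topological_space) \<Rightarrow> 'a measure" where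
  "empirical_measure I x = distr (uniform_count_measure I) borel x"

text \<open>The uniform probability on the sphere, as the law of \<open>x / \<parallel>x\<parallel>\<close> for \<open>x\<close> uniform in the unit
  ball. It is a measure on the whole space, concentrated on the sphere.\<close>

definition sphere_uniform :: "'a::euclidean_space measure" where
  "sphere_uniform = distr (uniform_measure lborel (ball 0 1)) borel (\<lambda>x. x /\<^sub>R norm x)"

definition couplings :: "'a::topological_space measure \<Rightarrow> 'a measure \<Rightarrow> ('a \<times> 'a) measure set" where
  "couplings M N = {\<pi>. sets \<pi> = sets (borel \<Otimes>\<^sub>M borel) \<and> distr \<pi> borel fst = M \<and> distr \<pi> borel snd = N}"

text \<open>Only meaningful for measures with finite second moment (\<open>enn2real\<close> maps \<open>\<infinity>\<close> to \<open>0\<close>); below it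
  is applied to finitely supported measures only.\<close>

definition W2 :: "'a::metric_space measure \<Rightarrow> 'a measure \<Rightarrow> real" where
  "W2 M N = sqrt (enn2real (INF \<pi>\<in>couplings M N. \<integral>\<^sup>+ (x, y). ennreal ((dist x y)\<^sup>2) \<partial>\<pi>))"

definition w_slice :: "real ^ 'd ^ 'n \<Rightarrow> real ^ 'd \<Rightarrow> real ^ 'd ^ 'n \<Rightarrow> real" where
  "w_slice Z \<theta> Y =
     (W2 (distr (empirical_measure UNIV (\<lambda>k. Y $ k)) borel (\<lambda>x. \<theta> \<bullet> x))
         (distr (empirical_measure UNIV (\<lambda>k. Z $ k)) borel (\<lambda>x. \<theta> \<bullet> x)))\<^sup>2"

definition sliced_energy :: "real ^ 'd ^ 'n \<Rightarrow> real ^ 'd ^ 'n \<Rightarrow> real" where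
  "sliced_energy Z Y = (\<integral>\<theta>. w_slice Z \<theta> Y \<partial>sphere_uniform)"

definition sliced_energy_p ::
    "nat \<Rightarrow> (nat \<Rightarrow> real ^ 'd) \<Rightarrow> real ^ 'd ^ 'n \<Rightarrow> real ^ 'd ^ 'n \<Rightarrow> real" where
  "sliced_energy_p p \<theta>s Z Y = (\<integral>\<theta>. w_slice Z \<theta> Y \<partial>empirical_measure {1..p} \<theta>s)"

section \<open>SGD and its interpolation\<close>

definition sorts_along :: "real ^ 'd \<Rightarrow> real ^ 'd ^ 'n::{finite,linorder} \<Rightarrow> ('n \<Rightarrow> 'n) \<Rightarrow> bool" where
  "sorts_along \<theta> X \<pi> \<longleftrightarrow> bij \<pi> \<and> mono (\<lambda>k. \<theta> \<bullet> X $ \<pi> k)"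

text \<open>The selection \<open>\<tau>\<close> of sorting permutations is a parameter; \<open>(\<theta> \<bullet> v) *\<^sub>R \<theta>\<close> is
  \<open>\<theta> \<theta>\<^sup>T v\<close>.\<close>

definition sgd_grad ::
    "(real ^ 'd \<Rightarrow> real ^ 'd ^ 'n::{finite,linorder} \<Rightarrow> 'n \<Rightarrow> 'n) \<Rightarrow> real ^ 'd ^ 'n::{finite,linorder} \<Rightarrow> real ^ 'd ^ 'n::{finite,linorder} \<Rightarrow> real ^ 'd
      \<Rightarrow> real ^ 'd ^ 'n::{finite,linorder}" where
  "sgd_grad \<tau> Z Y \<theta> =
     (\<chi> k. (2 / real CARD('n)) *\<^sub>R ((\<theta> \<bullet> (Y $ k - Z $ (\<tau> \<theta> Z \<circ> inv (\<tau> \<theta> Y)) k)) *\<^sub>R \<theta>))"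

text \<open>An outcome \<open>\<omega>\<close> consists of the initial point and the sequence of directions, of which the
  one of index \<open>0\<close> is never used.\<close>

primrec sgd ::
    "(real ^ 'd \<Rightarrow> real ^ 'd ^ 'n::{finite,linorder} \<Rightarrow> 'n \<Rightarrow> 'n) \<Rightarrow> real ^ 'd ^ 'n::{finite,linorder} \<Rightarrow> real
      \<Rightarrow> (real ^ 'd ^ 'n::{finite,linorder}) \<times> (nat \<Rightarrow> real ^ 'd) \<Rightarrow> nat \<Rightarrow> real ^ 'd ^ 'n::{finite,linorder}" where
  "sgd \<tau> Z \<alpha> \<omega> 0 = fst \<omega>"
| "sgd \<tau> Z \<alpha> \<omega> (Suc t) =
     sgd \<tau> Z \<alpha> \<omega> t - \<alpha> *\<^sub>R sgd_grad \<tau> Z (sgd \<tau> Z \<alpha> \<omega> t) (snd \<omega> (Suc t))"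

definition interpolate :: "real \<Rightarrow> (nat \<Rightarrow> 'a::real_vector) \<Rightarrow> real \<Rightarrow> 'a" where
  "interpolate \<alpha> y s = (let t = nat \<lfloor>s / \<alpha>\<rfloor> in y t + (s / \<alpha> - real t) *\<^sub>R (y (Suc t) - y t))"

section \<open>Clarke sub-differential flow\<close>

definition clarke_subdiff :: "('a::euclidean_space \<Rightarrow> real) \<Rightarrow> 'a \<Rightarrow> 'a set" where
  "clarke_subdiff f x =
     convex hull {v. \<exists>X G. (\<forall>i::nat. GDERIV f (X i) :> G i) \<and> X \<longlonglongrightarrow> x \<and> G \<longlonglongrightarrow> v}"

definition abs_continuous_on :: "real set \<Rightarrow> (real \<Rightarrow> 'a::metric_space) \<Rightarrow> bool" where
  "abs_continuous_on S f \<longleftrightarrow>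
     (\<forall>e>0. \<exists>\<delta>>0. \<forall>I :: (real \<times> real) set.
        finite I \<and> (\<forall>(a, b)\<in>I. a \<le> b \<and> {a..b} \<subseteq> S) \<and>
        disjoint_family_on (\<lambda>(a, b). {a<..<b}) I \<and> (\<Sum>(a, b)\<in>I. b - a) < \<delta> \<longrightarrow>
        (\<Sum>(a, b)\<in>I. dist (f a) (f b)) < e)"

text \<open>Curves are defined on \<open>[0, \<infinity>)\<close>: their values at negative times are irrelevant everywhere
  below. Absolute continuity on the half-line is meant on every compact interval.\<close>

definition C_abs :: "(real \<Rightarrow> 'a::metric_space) set" where
  "C_abs = {Y. \<forall>T\<ge>0. abs_continuous_on {0..T} Y}"

definition norm_inf2 :: "real ^ 'd ^ 'n \<Rightarrow> real" where
  "norm_inf2 Y = Max (range (\<lambda>k. norm (Y $ k)))"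

definition d_c :: "(real \<Rightarrow> real ^ 'd ^ 'n) \<Rightarrow> (real \<Rightarrow> real ^ 'd ^ 'n) \<Rightarrow> real" where
  "d_c Y Y' = (\<Sum>k. (1 / 2) ^ Suc k * min 1 (SUP s\<in>{0..real (Suc k)}. norm_inf2 (Y s - Y' s)))"

text \<open>Extended-real valued, so that the distance to the empty set is \<open>\<infinity>\<close>.\<close>

definition d_c_set :: "(real \<Rightarrow> real ^ 'd ^ 'n) \<Rightarrow> (real \<Rightarrow> real ^ 'd ^ 'n) set \<Rightarrow> ereal" where
  "d_c_set Y S = (INF Y'\<in>S. ereal (d_c Y Y'))"

definition clarke_flow :: "('a::euclidean_space \<Rightarrow> real) \<Rightarrow> 'a set \<Rightarrow> (real \<Rightarrow> 'a) set" where
  "clarke_flow F K =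
     {Y \<in> C_abs. (AE s in lborel. 0 \<le> s \<longrightarrow>
          (\<exists>v\<in>clarke_subdiff F (Y s). (Y has_vector_derivative - v) (at s within {0..}))) \<and>
        Y 0 \<in> K}"

section \<open>The probability space and the deviation event\<close>

text \<open>The completion is taken because the selection \<open>\<tau>\<close> is arbitrary, hence possibly not measurable;
  it only matters on a null set.\<close>

definition sgd_prob ::
    "(real ^ 'd ^ 'n) measure \<Rightarrow> (real ^ 'd) measure
      \<Rightarrow> ((real ^ 'd ^ 'n) \<times> (nat \<Rightarrow> real ^ 'd)) measure" where
  "sgd_prob \<nu> \<mu> = completion (\<nu> \<Otimes>\<^sub>M (\<Pi>\<^sub>M t\<in>(UNIV :: nat set). \<mu>))"

text \<open>The event is restricted to trajectories started in \<open>K\<close>: by \<open>d_c_set_clarke_flow_ge\<close> below, a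
  trajectory started away from \<open>K\<close> stays away from \<open>clarke_flow F K\<close>, whatever the step. If \<open>\<nu>\<close> is
  concentrated on \<open>K\<close>, the restriction holds almost surely.\<close>

definition deviation ::
    "(real ^ 'd \<Rightarrow> real ^ 'd ^ 'n::{finite,linorder} \<Rightarrow> 'n \<Rightarrow> 'n) \<Rightarrow> real ^ 'd ^ 'n::{finite,linorder}
      \<Rightarrow> (real ^ 'd ^ 'n::{finite,linorder} \<Rightarrow> real) \<Rightarrow> (real ^ 'd ^ 'n::{finite,linorder}) set \<Rightarrow> real \<Rightarrow> real
      \<Rightarrow> ((real ^ 'd ^ 'n::{finite,linorder}) \<times> (nat \<Rightarrow> real ^ 'd)) set" where
  "deviation \<tau> Z F K \<epsilon> \<alpha> =
     {\<omega>. fst \<omega> \<in> K \<and>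
         d_c_set (interpolate \<alpha> (sgd \<tau> Z \<alpha> \<omega>)) (clarke_flow F K) > ereal \<epsilon>}"

section \<open>Why the event is restricted to initial points in \<open>K\<close>\<close>

lemma abs_continuous_on_imp_continuous_on:
  fixes f :: "real \<Rightarrow> 'a::metric_space"
  assumes "abs_continuous_on {0..T} f"
  shows "continuous_on {0..T} f"
  unfolding continuous_on_iff
proof (intro ballI allI impI)
  fix x e :: real
  assume x: "x \<in> {0..T}" and "0 < e"
  then obtain \<delta> where "\<delta> > 0" and \<delta>: "\<And>I :: (real \<times> real) set.
      finite I \<and> (\<forall>(a, b)\<in>I. a \<le> b \<and> {a..b} \<subseteq> {0..T}) \<and>
      disjoint_family_on (\<lambda>(a, b). {a<..<b}) I \<and> (\<Sum>(a, b)\<in>I. b - a) < \<delta> \<Longrightarrow>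
      (\<Sum>(a, b)\<in>I. dist (f a) (f b)) < e"
    using assms unfolding abs_continuous_on_def by meson
  have "dist (f y) (f x) < e" if y: "y \<in> {0..T}" and "dist y x < \<delta>" for y
    using \<delta>[of "{(min x y, max x y)}"] that x
    by (cases "x \<le> y") (auto simp: disjoint_family_on_def dist_real_def dist_commute)
  with \<open>\<delta> > 0\<close> show "\<exists>d>0. \<forall>y\<in>{0..T}. dist y x < d \<longrightarrow> dist (f y) (f x) < e"
    by blast
qed

lemma norm_inf2_nonneg: "0 \<le> norm_inf2 Y"
  unfolding norm_inf2_def by (rule order_trans[OF norm_ge_zero Max_ge]) auto

lemma norm_inf2_le_norm: "norm_inf2 Y \<le> norm Y"
  unfolding norm_inf2_def by (subst Max_le_iff) (auto intro: Finite_Cartesian_Product.norm_nth_le)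

lemma d_c_ge_initial:
  fixes Y Y' :: "real \<Rightarrow> real ^ 'd ^ 'n"
  assumes Y: "\<And>T. continuous_on {0..T} Y" and Y': "\<And>T. continuous_on {0..T} Y'"
  shows "min 1 (norm_inf2 (Y 0 - Y' 0)) \<le> d_c Y Y'"
proof -
  let ?m = "min 1 (norm_inf2 (Y 0 - Y' 0))"
  let ?S = "\<lambda>k. SUP s\<in>{0..real (Suc k)}. norm_inf2 (Y s - Y' s)"
  have ge: "norm_inf2 (Y 0 - Y' 0) \<le> ?S k" for k
  proof (rule cSUP_upper)
    have "compact ((\<lambda>s. Y s - Y' s) ` {0..real (Suc k)})"
      by (intro compact_continuous_image continuous_on_diff Y Y' compact_Icc)
    then obtain B where "\<forall>x\<in>(\<lambda>s. Y s - Y' s) ` {0..real (Suc k)}. norm x \<le> B"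
      using compact_imp_bounded bounded_iff by metis
    then show "bdd_above ((\<lambda>s. norm_inf2 (Y s - Y' s)) ` {0..real (Suc k)})"
      by (intro bdd_aboveI2[of _ _ B]) (meson image_eqI norm_inf2_le_norm order_trans)
  qed auto
  have nonneg: "0 \<le> ?S k" for k
    using ge[of k] norm_inf2_nonneg order_trans by blast
  have half: "(\<lambda>k. (1 / 2 :: real) ^ Suc k) sums 1"
    by (rule power_half_series)
  have sums_m: "(\<lambda>k. (1 / 2) ^ Suc k * ?m) sums ?m"
    using sums_mult2[OF half, of ?m] by simp
  have summ: "summable (\<lambda>k. (1 / 2) ^ Suc k * min 1 (?S k))"
    by (rule summable_comparison_test'[OF sums_summable[OF half], where N = 0])
       (use nonneg in \<open>auto simp: abs_mult mult_left_le\<close>)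
  have "(\<Sum>k. (1 / 2) ^ Suc k * ?m) \<le> (\<Sum>k. (1 / 2) ^ Suc k * min 1 (?S k))"
    by (intro suminf_le sums_summable[OF sums_m] summ mult_left_mono min.mono ge) auto
  then show ?thesis
    using sums_unique[OF sums_m] by (simp add: d_c_def)
qed

lemma d_c_set_clarke_flow_ge:
  fixes Y :: "real \<Rightarrow> real ^ 'd ^ 'n"
  assumes "\<And>T. continuous_on {0..T} Y" and "\<And>y. y \<in> K \<Longrightarrow> r \<le> norm_inf2 (Y 0 - y)" and "r \<le> 1"
  shows "ereal r \<le> d_c_set Y (clarke_flow F K)"
  unfolding d_c_set_def
proof (rule INF_greatest)
  fix Y' assume "Y' \<in> clarke_flow F K"
  then have Y': "Y' \<in> C_abs" "Y' 0 \<in> K"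
    by (auto simp: clarke_flow_def)
  have "continuous_on {0..T} Y'" for T
  proof (cases "T \<ge> 0")
    case True
    with Y'(1) show ?thesis
      by (auto simp: C_abs_def intro: abs_continuous_on_imp_continuous_on)
  qed auto
  from d_c_ge_initial[OF assms(1) this] assms(2)[OF Y'(2)] assms(3)
  show "ereal r \<le> ereal (d_c Y Y')" by simp
qed

end

theory Submission
  imports Defs "HOL-Complex_Analysis.Great_Picard"
begin

text \<open>
  Sorting makes each slice energy a minimum, over permutations, of quadratic functions, hence
  semiconcave: the stochastic gradient \<open>\<phi>(Y, \<theta>)\<close> satisfies
  \<open>w\<^sub>\<theta>(X) \<le> w\<^sub>\<theta>(Y) + \<phi>(Y, \<theta>) \<bullet> (X - Y) + \<parallel>X - Y\<parallel>\<^sup>2 / n\<close> for all \<open>X\<close>, ties or not. Averaging over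
  \<open>\<theta>\<close>, the drift of the recursion is at every point a quadratic supergradient of \<open>F\<close>, and quadratic
  supergradients are Clarke subgradients. Since the defining inequality is affine in the
  supergradient, it survives averaging along a trajectory: a locally uniform limit of trajectories
  with vanishing noise satisfies it with \<open>- Y'(s)\<close> wherever \<open>Y\<close> is differentiable, that is almost
  everywhere. The noise is a martingale with bounded increments and vanishes in probability by
  Chebyshev's inequality on a fixed time grid. Finally \<open>2 \<alpha> / n < 1\<close> makes each step piecewise affine
  and invertible, so the law of the iterates charges no ties and the arbitrary choice of sorting
  permutations only matters on a null set.
\<close>

section \<open>Differentiability of Lipschitz functions of one variable\<close>

text \<open>The obstacle is that the drift jumps at ties: gradients along a convergent family of
  trajectories need not converge, so the recursion itself has no pointwise limit. Testing against
  all points \<open>X\<close> replaces the equation by inequalities that contain only displacements,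
  so neither a limit drift nor a measurable selection of subgradients has to be constructed.
  Probability enters in one place: \<open>clarke_flow_stability\<close> is deterministic, and a
  compactness argument makes its horizon, noise tolerance and step bound independent of the
  trajectory. The deviation event is then contained in an event about the noise on a bounded time
  interval, and no weak convergence of laws on path space is involved. Linear growth of the gradient
  confines all trajectories started in \<open>K\<close> on such intervals. Limit curves are only
  locally Lipschitz while \<open>clarke_flow\<close> asks for a derivative almost everywhere, whence
  the one-variable differentiability theorem below.\<close>

lemma negligible_upper_density_pos:
  fixes u :: "real \<Rightarrow> ennreal"
  assumes u[measurable]: "u \<in> borel_measurable borel"
    and fin: "(\<integral>\<^sup>+x. u x * indicator {a<..<b} x \<partial>lborel) < \<infinity>"
    and \<delta>: "\<delta> > 0"
    and E: "\<And>x. x \<in> E \<Longrightarrow> a < x \<and> x < b \<and> u x = 0"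
    and small: "\<And>x d. x \<in> E \<Longrightarrow> d > 0 \<Longrightarrow> \<exists>c r. 0 < r \<and> r < d \<and> x \<in> cball c r \<and>
        ennreal (\<delta> * (2 * r)) \<le> (\<integral>\<^sup>+x. u x * indicator (cball c r) x \<partial>lborel)"
  shows "negligible E"
  unfolding negligible_outer_le
proof (intro allI impI)
  fix e :: real assume e: "e > 0"
  \<comment> \<open>This finite measure gives no mass to the zero set of \<open>u\<close>, so outer
    regularity provides an open set around it of \<kappa>-mass below \<open>\<delta> * e\<close>.
    Disjoint Vitali balls inside that open set have \<kappa>-mass at least \<delta> times their
    length, hence total length below \<open>e\<close>, and they cover \<open>E\<close> up to a
    negligible set.\<close>
  define \<kappa> where "\<kappa> = density lborel (\<lambda>x. u x * indicator {a<..<b} x)"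
  have [simp]: "sets \<kappa> = sets borel" "space \<kappa> = UNIV"
    by (simp_all add: \<kappa>_def)
  have \<kappa>: "emeasure \<kappa> B = (\<integral>\<^sup>+x. u x * indicator (B \<inter> {a<..<b}) x \<partial>lborel)" if "B \<in> sets borel" for B
    using that by (auto simp: \<kappa>_def emeasure_density indicator_inter_arith ac_simps
        intro!: nn_integral_cong)
  define A where "A = {x \<in> {a<..<b}. u x = 0}"
  have A[measurable]: "A \<in> sets borel" unfolding A_def by measurable
  have "emeasure \<kappa> A = 0"
    by (subst \<kappa>) (auto simp: A_def indicator_def nn_integral_0_iff_AE)
  moreover have "emeasure \<kappa> (space \<kappa>) \<noteq> \<infinity>"
    using \<kappa>[of UNIV] fin by simp
  ultimately have "(INF U\<in>{U. A \<subseteq> U \<and> open U}. emeasure \<kappa> U) < ennreal (\<delta> * e)"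
    using outer_regular[of \<kappa> A] A \<delta> e by simp
  then obtain U0 where U0: "A \<subseteq> U0" "open U0" "emeasure \<kappa> U0 < ennreal (\<delta> * e)"
    by (auto simp: INF_less_iff)
  define U where "U = U0 \<inter> {a<..<b}"
  have U: "A \<subseteq> U" "open U" "U \<subseteq> {a<..<b}"
    using U0 by (auto simp: U_def A_def)
  have [measurable]: "U0 \<in> sets borel" "U \<in> sets borel" using U0 U by auto
  have \<kappa>U: "emeasure \<kappa> U < ennreal (\<delta> * e)"
    using U0 by (intro le_less_trans[OF emeasure_mono U0(3)]) (auto simp: U_def)
  define K where "K = {(c, r). 0 < r \<and> cball c r \<subseteq> U \<and>
     ennreal (\<delta> * (2 * r)) \<le> (\<integral>\<^sup>+x. u x * indicator (cball c r) x \<partial>lborel)}"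
  have Kpos: "0 < snd i" if "i \<in> K" for i
    using that by (auto simp: K_def)
  have cov: "\<exists>i. i \<in> K \<and> x \<in> cball (fst i) (snd i) \<and> snd i < d" if x: "x \<in> E" and d: "d > 0" for x d
  proof -
    have "x \<in> U" using E[OF x] U by (auto simp: A_def)
    then obtain s where s: "s > 0" "ball x s \<subseteq> U"
      using U(2) openE by blast
    \<comment> \<open>The balls need not be centred at \<open>x\<close>; a radius below
      \<open>s/2\<close> keeps all of the ball within distance \<open>s\<close> of
      \<open>x\<close>.\<close>
    have "min d (s/2) > 0" using d s by simp
    from small[OF x this] obtain c r where cr: "0 < r" "r < min d (s/2)" "x \<in> cball c r"
        "ennreal (\<delta> * (2 * r)) \<le> (\<integral>\<^sup>+x. u x * indicator (cball c r) x \<partial>lborel)" by blast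
    have "cball c r \<subseteq> ball x s"
    proof
      fix z assume z: "z \<in> cball c r"
      have "dist x z \<le> dist c x + dist c z" by (metis dist_commute dist_triangle)
      then show "z \<in> ball x s" using z cr by auto
    qed
    then show ?thesis using cr s by (intro exI[of _ "(c, r)"]) (auto simp: K_def)
  qed
  obtain C where C: "countable C" "C \<subseteq> K"
     "pairwise (\<lambda>i j. disjnt (cball (fst i) (snd i)) (cball (fst j) (snd j))) C"
     "negligible (E - (\<Union>i\<in>C. cball (fst i) (snd i)))"
    by (rule Vitali_covering_theorem_cballs[OF Kpos cov]) blast
  define V where "V = (\<Union>i\<in>C. cball (fst i) (snd i))"
  have disj: "disjoint_family_on (\<lambda>i. cball (fst i) (snd i)) C"
    using C(3) by (auto simp: disjoint_family_on_def pairwise_def disjnt_def)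
  have VU: "V \<subseteq> U" using C(2) unfolding V_def K_def by fastforce
  have [measurable]: "V \<in> sets borel"
    unfolding V_def by (intro sets.countable_UN' C(1)) auto
  have "ennreal \<delta> * emeasure lborel V = ennreal \<delta> * (\<integral>\<^sup>+i. emeasure lborel (cball (fst i) (snd i)) \<partial>count_space C)"
    unfolding V_def by (subst emeasure_UN_countable[OF _ C(1) disj]) auto
  also have "\<dots> = (\<integral>\<^sup>+i. ennreal \<delta> * emeasure lborel (cball (fst i) (snd i)) \<partial>count_space C)"
    by (simp add: nn_integral_cmult)
  also have "\<dots> \<le> (\<integral>\<^sup>+i. emeasure \<kappa> (cball (fst i) (snd i)) \<partial>count_space C)"
  proof (intro nn_integral_mono, clarsimp)
    fix c r assume "(c, r) \<in> C"
    then have cr: "r > 0" "cball c r \<subseteq> U"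
      "ennreal (\<delta> * (2 * r)) \<le> (\<integral>\<^sup>+x. u x * indicator (cball c r) x \<partial>lborel)"
      using C(2) by (auto simp: K_def)
    have "emeasure lborel (cball c r) = ennreal (2 * r)"
      using cr by (simp add: cball_eq_atLeastAtMost)
    moreover have "cball c r \<inter> {a<..<b} = cball c r" using cr U by auto
    then have "emeasure \<kappa> (cball c r) = (\<integral>\<^sup>+x. u x * indicator (cball c r) x \<partial>lborel)"
      by (subst \<kappa>) auto
    ultimately show "ennreal \<delta> * emeasure lborel (cball c r) \<le> emeasure \<kappa> (cball c r)"
      using cr \<delta> by (simp add: ennreal_mult)
  qed
  also have "\<dots> = emeasure \<kappa> V"
    unfolding V_def by (subst emeasure_UN_countable[OF _ C(1) disj]) auto
  also have "\<dots> \<le> emeasure \<kappa> U" by (intro emeasure_mono VU) auto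
  also have "\<dots> < ennreal \<delta> * ennreal e" using \<kappa>U \<delta> e by (simp add: ennreal_mult)
  finally have "ennreal \<delta> * emeasure lborel V < ennreal \<delta> * ennreal e" .
  then have Ve: "emeasure lborel V < ennreal e"
    by (meson leD le_less_linear mult_left_mono zero_le)
  show "\<exists>T. E \<subseteq> T \<and> T \<in> lmeasurable \<and> Sigma_Algebra.measure lebesgue T \<le> e"
  proof (intro exI conjI)
    let ?N = "E - V"
    have N: "negligible ?N" using C(4) by (simp add: V_def)
    show "E \<subseteq> V \<union> ?N" by auto
    have V: "V \<in> lmeasurable"
      using Ve by (auto simp: fmeasurable_def intro: less_trans)
    then show "V \<union> ?N \<in> lmeasurable"
      using N negligible_imp_measurable by blast
    have "Sigma_Algebra.measure lebesgue (V \<union> ?N) = Sigma_Algebra.measure lebesgue V"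
      using measure_negligible_finite_Union N V
      by (metis Diff_Diff_Int Un_Diff_cancel inf_commute measure_Un_null_set fmeasurableD negligible_iff_null_sets)
    also have "\<dots> \<le> e" using Ve e by (simp add: measure_def enn2real_leI less_imp_le)
    finally show "Sigma_Algebra.measure lebesgue (V \<union> ?N) \<le> e" .
  qed
qed

text \<open>Adding \<open>(L + 1) * x\<close> turns \<open>g\<close> into an increasing bi-Lipschitz
  bijection \<open>f\<close>. The image of Lebesgue measure under its inverse gives
  \<open>{a..b}\<close> the mass \<open>f b - f a\<close>, and it is absolutely continuous because
  Lipschitz maps preserve null sets. Its density \<open>v\<close> is the derivative of
  \<open>f\<close> wherever small intervals around \<open>x\<close> do not have slopes separated
  from \<open>v x\<close> by a pair of rationals; for each pair the exceptional points form a
  negligible set by \<open>negligible_upper_density_pos\<close>.\<close>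

proposition lipschitz_AE_differentiable:
  fixes g :: "real \<Rightarrow> real"
  assumes lip: "\<And>x y. \<bar>g x - g y\<bar> \<le> L * \<bar>x - y\<bar>"
  shows "AE x in lborel. g differentiable (at x)"
proof -
  have L0: "L \<ge> 0" using lip[of 1 0] by simp
  define f where "f x = g x + (L + 1) * x" for x
  have f_lo: "y - x \<le> f y - f x" and f_hi: "f y - f x \<le> (2 * L + 1) * (y - x)" if "x \<le> y" for x y
    using lip[of y x] that by (auto simp: f_def algebra_simps)
  have f_mono: "f x \<le> f y \<longleftrightarrow> x \<le> y" for x y
    using f_lo[of x y] f_lo[of y x] by (cases "x \<le> y") auto
  have f_inj: "inj f" by (metis f_mono injI order_antisym order_refl)
  have f_lip: "\<bar>f x - f y\<bar> \<le> (2 * L + 1) * \<bar>x - y\<bar>" for x y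
    using f_lo[of x y] f_hi[of x y] f_lo[of y x] f_hi[of y x] by (cases "x \<le> y") auto
  have f_cont: "continuous_on UNIV f"
    by (rule lipschitz_on_continuous_on[of "2 * L + 1"])
      (use L0 f_lip in \<open>auto simp: lipschitz_on_def dist_real_def\<close>)
  have "\<exists>x. f x = y" for y
  proof -
    let ?b = "\<bar>y - f 0\<bar>"
    have "f (- ?b) \<le> y" "y \<le> f ?b" using f_lo[of "- ?b" 0] f_lo[of 0 ?b] by auto
    then show ?thesis using IVT'[of f "- ?b" y ?b] continuous_on_subset[OF f_cont] by auto
  qed
  then have f_surj: "surj f" by (metis surjI)
  define h where "h = inv f"
  have fh[simp]: "f (h y) = y" and hf[simp]: "h (f x) = x" for x y
    using f_surj f_inj by (auto simp: h_def surj_f_inv_f)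
  have h_lip: "\<bar>h x - h y\<bar> \<le> 1 * \<bar>x - y\<bar>" for x y
    using f_lo[of "h x" "h y"] f_lo[of "h y" "h x"] by (cases "h x \<le> h y") auto
  have "continuous_on UNIV h"
    by (rule lipschitz_on_continuous_on[of 1]) (use h_lip in \<open>auto simp: lipschitz_on_def dist_real_def\<close>)
  then have h[measurable]: "h \<in> borel_measurable borel"
    by (rule borel_measurable_continuous_onI)
  define M where "M = distr lborel borel h"
  have M_Icc: "emeasure M {a..b} = ennreal (f b - f a)" if "a \<le> b" for a b
  proof -
    have "h -` {a..b} = {f a..f b}"
      using f_mono by (auto simp: vimage_def) (metis fh f_mono)+
    then show ?thesis using that f_mono by (simp add: M_def emeasure_distr)
  qed
  have "absolutely_continuous lborel M"
    unfolding absolutely_continuous_def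
  proof
    fix S assume S: "S \<in> null_sets (lborel :: real measure)"
    then have "negligible S" by (simp add: negligible_iff_null_sets null_sets_completionI)
    moreover have "h -` S = f ` S" by (auto simp: image_iff) (metis fh)
    ultimately have "negligible (h -` S)"
      using negligible_locally_Lipschitz_image[of S f] f_lip by auto (metis UNIV_I open_UNIV)
    moreover have "h -` S \<in> sets borel" using measurable_sets[OF h, of S] null_setsD2[OF S] by simp
    ultimately have "h -` S \<in> null_sets lborel"
      by (simp add: negligible_iff_emeasure0 null_sets_def)
    then show "S \<in> null_sets M" using S by (simp add: M_def null_sets_def emeasure_distr)
  qed
  then obtain v where v[measurable]: "v \<in> borel_measurable borel" and vM: "density lborel v = M"
    using sigma_finite_measure.Radon_Nikodym[OF sigma_finite_lborel, of M] by (auto simp: M_def)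
  have v_Icc: "(\<integral>\<^sup>+x. v x * indicator {a..b} x \<partial>lborel) = ennreal (f b - f a)" if "a \<le> b" for a b
    using M_Icc[OF that] unfolding vM[symmetric] by (simp add: emeasure_density)
  have v_cball: "(\<integral>\<^sup>+x. v x * indicator (cball c \<rho>) x \<partial>lborel) = ennreal (f (c + \<rho>) - f (c - \<rho>))"
    if "\<rho> > 0" for c \<rho>
    using v_Icc[of "c - \<rho>" "c + \<rho>"] that by (simp add: cball_eq_atLeastAtMost)
  \<comment> \<open>The interval between \<open>x\<close> and \<open>y\<close> is a ball about their
    midpoint, so allowing all balls that contain \<open>x\<close> captures the one-sided difference
    quotients. The cut-off \<open>N\<close> keeps the integrals finite.\<close>
  define E1 where "E1 r q N = {x. - N < x \<and> x < N \<and> v x \<le> ennreal r \<and>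
      (\<forall>d>0. \<exists>c \<rho>. 0 < \<rho> \<and> \<rho> < d \<and> x \<in> cball c \<rho> \<and> q * (2 * \<rho>) \<le> f (c + \<rho>) - f (c - \<rho>))}" for r q N :: real
  define E2 where "E2 r q N = {x. - N < x \<and> x < N \<and> ennreal q \<le> v x \<and>
      (\<forall>d>0. \<exists>c \<rho>. 0 < \<rho> \<and> \<rho> < d \<and> x \<in> cball c \<rho> \<and> f (c + \<rho>) - f (c - \<rho>) \<le> r * (2 * \<rho>))}" for r q N :: real
  have vfin: "(\<integral>\<^sup>+x. v x * indicator {a<..<b} x \<partial>lborel) < \<infinity>" for a b
  proof (cases "a \<le> b")
    case True
    have "(\<integral>\<^sup>+x. v x * indicator {a<..<b} x \<partial>lborel) \<le> (\<integral>\<^sup>+x. v x * indicator {a..b} x \<partial>lborel)"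
      by (intro nn_integral_mono) (auto simp: indicator_def)
    also have "\<dots> < \<infinity>" by (simp add: v_Icc[OF True])
    finally show ?thesis .
  qed simp
  have le_sub_add: "x \<le> (x - y) + y" for x y :: ennreal
    by (metis add.commute ennreal_minus_le_iff order_refl)
  have [measurable]: "cball c \<rho> \<in> sets borel" for c \<rho> :: real by simp
  \<comment> \<open>Subtraction in \<open>ennreal\<close> is truncated, so \<open>v - r\<close>
    vanishes exactly where \<open>v \<le> r\<close>, while its mean over the bad balls is still at
    least \<open>q - r\<close>.\<close>
  have N1: "negligible (E1 r q N)" if rq: "0 \<le> r" "r < q" for r q N
  proof (rule negligible_upper_density_pos[where u = "\<lambda>x. v x - ennreal r" and \<delta> = "q - r" and a = "-N" and b = N])
    have "(\<integral>\<^sup>+x. (v x - ennreal r) * indicator {-N<..<N} x \<partial>lborel) \<le> (\<integral>\<^sup>+x. v x * indicator {-N<..<N} x \<partial>lborel)"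
      by (intro nn_integral_mono mult_right_mono) auto
    then show "(\<integral>\<^sup>+x. (v x - ennreal r) * indicator {-N<..<N} x \<partial>lborel) < \<infinity>"
      using vfin[of "-N" N] by (rule le_less_trans)
    show "- N < x \<and> x < N \<and> v x - ennreal r = 0" if "x \<in> E1 r q N" for x
      using that by (auto simp: E1_def intro!: diff_eq_0_ennreal intro: le_less_trans)
    fix x d :: real assume "x \<in> E1 r q N" "d > 0"
    then obtain c \<rho> where c: "0 < \<rho>" "\<rho> < d" "x \<in> cball c \<rho>" "q * (2 * \<rho>) \<le> f (c + \<rho>) - f (c - \<rho>)"
      unfolding E1_def by blast
    let ?I = "\<integral>\<^sup>+x. (v x - ennreal r) * indicator (cball c \<rho>) x \<partial>lborel"
    have "ennreal (q * (2 * \<rho>)) \<le> (\<integral>\<^sup>+x. v x * indicator (cball c \<rho>) x \<partial>lborel)"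
      using c by (simp add: v_cball ennreal_leI)
    also have "\<dots> \<le> (\<integral>\<^sup>+x. (v x - ennreal r) * indicator (cball c \<rho>) x + ennreal r * indicator (cball c \<rho>) x \<partial>lborel)"
      by (intro nn_integral_mono) (auto simp: indicator_def le_sub_add)
    also have "\<dots> = ?I + ennreal (r * (2 * \<rho>))"
      using c rq by (subst nn_integral_add) (measurable, auto simp: nn_integral_cmult cball_eq_atLeastAtMost ennreal_mult)
    finally have "ennreal (q * (2 * \<rho>)) \<le> ?I + ennreal (r * (2 * \<rho>))" .
    then show "\<exists>c r'. 0 < r' \<and> r' < d \<and> x \<in> cball c r' \<and>
         ennreal ((q - r) * (2 * r')) \<le> (\<integral>\<^sup>+x. (v x - ennreal r) * indicator (cball c r') x \<partial>lborel)"
      using c rq by (intro exI[of _ c] exI[of _ \<rho>])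
        (cases ?I; auto simp: left_diff_distrib ennreal_plus[symmetric] simp del: ennreal_plus)
  qed (use rq in auto)
  have N2: "negligible (E2 r q N)" if rq: "r < q" for r q N
  proof (rule negligible_upper_density_pos[where u = "\<lambda>x. ennreal q - v x" and \<delta> = "q - r" and a = "-N" and b = N])
    have "(\<integral>\<^sup>+x. (ennreal q - v x) * indicator {-N<..<N} x \<partial>lborel) \<le> (\<integral>\<^sup>+x. ennreal q * indicator {-N<..<N} x \<partial>lborel)"
      by (intro nn_integral_mono mult_right_mono) (auto simp: diff_le_self_ennreal)
    also have "\<dots> < \<infinity>" 
      by (cases "N \<ge> 0") (auto simp: nn_integral_cmult ennreal_mult_less_top)
    finally show "(\<integral>\<^sup>+x. (ennreal q - v x) * indicator {-N<..<N} x \<partial>lborel) < \<infinity>" .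
    show "- N < x \<and> x < N \<and> ennreal q - v x = 0" if "x \<in> E2 r q N" for x
      using that by (auto simp: E2_def intro!: diff_eq_0_ennreal)
    fix x d :: real assume "x \<in> E2 r q N" "d > 0"
    then obtain c \<rho> where c: "0 < \<rho>" "\<rho> < d" "x \<in> cball c \<rho>" "f (c + \<rho>) - f (c - \<rho>) \<le> r * (2 * \<rho>)"
      unfolding E2_def by blast
    \<comment> \<open>The slopes of \<open>f\<close> are at least 1, which forces
      \<open>r > 0\<close>; otherwise \<open>ennreal\<close> would silently replace negative bounds
      by 0.\<close>
    have "2 * \<rho> \<le> f (c + \<rho>) - f (c - \<rho>)" using f_lo[of "c - \<rho>" "c + \<rho>"] c by auto
    then have "0 < r * (2 * \<rho>)" using c by linarith
    then have r: "r > 0" using c by (simp add: zero_less_mult_iff)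
    let ?I = "\<integral>\<^sup>+x. (ennreal q - v x) * indicator (cball c \<rho>) x \<partial>lborel"
    have "ennreal (q * (2 * \<rho>)) = (\<integral>\<^sup>+x. ennreal q * indicator (cball c \<rho>) x \<partial>lborel)"
      using c rq r by (auto simp: nn_integral_cmult cball_eq_atLeastAtMost ennreal_mult)
    also have "\<dots> \<le> (\<integral>\<^sup>+x. (ennreal q - v x) * indicator (cball c \<rho>) x + v x * indicator (cball c \<rho>) x \<partial>lborel)"
      by (intro nn_integral_mono) (auto simp: indicator_def le_sub_add)
    also have "\<dots> = ?I + ennreal (f (c + \<rho>) - f (c - \<rho>))"
      using c by (subst nn_integral_add) (measurable, auto simp: v_cball)
    also have "\<dots> \<le> ?I + ennreal (r * (2 * \<rho>))"
      using c by (intro add_left_mono ennreal_leI) auto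
    finally have "ennreal (q * (2 * \<rho>)) \<le> ?I + ennreal (r * (2 * \<rho>))" .
    then show "\<exists>c r'. 0 < r' \<and> r' < d \<and> x \<in> cball c r' \<and>
         ennreal ((q - r) * (2 * r')) \<le> (\<integral>\<^sup>+x. (ennreal q - v x) * indicator (cball c r') x \<partial>lborel)"
      using c rq r by (intro exI[of _ c] exI[of _ \<rho>])
        (cases ?I; auto simp: left_diff_distrib ennreal_plus[symmetric] simp del: ennreal_plus)
  qed (use rq in auto)
  define B where "B = (\<Union>N::nat. \<Union>r\<in>\<rat>. \<Union>q\<in>\<rat>. (if 0 \<le> r \<and> r < q then E1 r q N else {}) \<union> (if r < q then E2 r q N else {}))"
  have "B \<in> null_sets lebesgue"
    unfolding B_def
    by (intro null_sets_UN' null_sets.Un countable_rat countableI_type)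
      (use N1 N2 in \<open>auto simp: negligible_iff_null_sets\<close>)
  then have "AE x in lebesgue. x \<notin> B" by (rule AE_not_in)
  then have AE: "AE x in lborel. x \<notin> B"
    by (simp add: AE_completion_iff)
  have "g differentiable (at x)" if x: "x \<notin> B" for x
  proof -
    obtain N :: nat where N: "\<bar>x\<bar> < real N" using reals_Archimedean2 by blast
    have notE1: "x \<notin> E1 r q N" if "r \<in> \<rat>" "q \<in> \<rat>" "0 \<le> r" "r < q" for r q
      using x that unfolding B_def by (auto split: if_splits)
    have notE2: "x \<notin> E2 r q N" if "r \<in> \<rat>" "q \<in> \<rat>" "r < q" for r q
      using x that unfolding B_def by (auto split: if_splits)
    have mid1: "(x + y) / 2 + \<bar>y - x\<bar> / 2 = max x y" and mid2: "(x + y) / 2 - \<bar>y - x\<bar> / 2 = min x y" for y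
      by (auto simp: max_def min_def abs_if field_simps)
    have up: "\<exists>d>0. \<forall>y. y \<noteq> x \<and> \<bar>y - x\<bar> < d \<longrightarrow> (f y - f x) / (y - x) < q"
      if q: "v x < ennreal q" for q
    proof -
      obtain V where V: "v x = ennreal V" "V \<ge> 0" using q by (cases "v x") auto
      then have "V < q" using q by (simp add: ennreal_less_iff)
      then obtain r where r: "r \<in> \<rat>" "V < r" "r < q" using Rats_dense_in_real by blast
      then obtain q' where q': "q' \<in> \<rat>" "r < q'" "q' < q" using Rats_dense_in_real by blast
      have "x \<notin> E1 r q' N" using notE1 r q' V by auto
      moreover have "v x \<le> ennreal r" using r V by (auto intro: ennreal_leI)
      ultimately obtain d where d: "d > 0" "\<And>c \<rho>. 0 < \<rho> \<Longrightarrow> \<rho> < d \<Longrightarrow> x \<in> cball c \<rho> \<Longrightarrow> f (c + \<rho>) - f (c - \<rho>) < q' * (2 * \<rho>)"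
        using N unfolding E1_def mem_Collect_eq not_le[symmetric] abs_less_iff by force
      have "(f y - f x) / (y - x) < q" if y: "y \<noteq> x" "\<bar>y - x\<bar> < d" for y
      proof -
        have "f ((x+y)/2 + \<bar>y-x\<bar>/2) - f ((x+y)/2 - \<bar>y-x\<bar>/2) < q' * (2 * (\<bar>y-x\<bar>/2))"
          by (rule d(2)) (use y in \<open>auto simp: dist_real_def field_simps abs_if\<close>)
        then have "(f y - f x) / (y - x) < q'" using y
          by (cases "x < y") (auto simp: mid1 mid2 divide_simps algebra_simps)
        then show ?thesis using q' by simp
      qed
      then show ?thesis using d(1) by blast
    qed
    have lo: "\<exists>d>0. \<forall>y. y \<noteq> x \<and> \<bar>y - x\<bar> < d \<longrightarrow> r < (f y - f x) / (y - x)"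
      if r: "r < q" "ennreal q \<le> v x" for r q
    proof -
      obtain r' where r': "r' \<in> \<rat>" "r < r'" "r' < q" using r Rats_dense_in_real by blast
      then obtain q' where q': "q' \<in> \<rat>" "r' < q'" "q' < q" using Rats_dense_in_real by blast
      have "x \<notin> E2 r' q' N" using notE2 r' q' by auto
      moreover have "ennreal q' \<le> v x" using q' by (intro order_trans[OF ennreal_leI r(2)]) simp
      ultimately obtain d where d: "d > 0" "\<And>c \<rho>. 0 < \<rho> \<Longrightarrow> \<rho> < d \<Longrightarrow> x \<in> cball c \<rho> \<Longrightarrow> r' * (2 * \<rho>) < f (c + \<rho>) - f (c - \<rho>)"
        using N unfolding E2_def mem_Collect_eq not_le[symmetric] abs_less_iff by force
      have "r < (f y - f x) / (y - x)" if y: "y \<noteq> x" "\<bar>y - x\<bar> < d" for y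
      proof -
        have "r' * (2 * (\<bar>y-x\<bar>/2)) < f ((x+y)/2 + \<bar>y-x\<bar>/2) - f ((x+y)/2 - \<bar>y-x\<bar>/2)"
          by (rule d(2)) (use y in \<open>auto simp: dist_real_def field_simps abs_if\<close>)
        then have "r' < (f y - f x) / (y - x)" using y
          by (cases "x < y") (auto simp: mid1 mid2 divide_simps algebra_simps)
        then show ?thesis using r' by simp
      qed
      then show ?thesis using d(1) by blast
    qed
    \<comment> \<open>This excludes an infinite density: it would produce slopes above
      \<open>2 * L + 3\<close>, whereas those of \<open>f\<close> are at most
      \<open>2 * L + 1\<close>.\<close>
    have "v x < ennreal (2 * L + 4)"
    proof (rule ccontr)
      assume "\<not> v x < ennreal (2 * L + 4)"
      then obtain d where d: "d > 0" "\<And>y. y \<noteq> x \<Longrightarrow> \<bar>y - x\<bar> < d \<Longrightarrow> 2 * L + 3 < (f y - f x) / (y - x)"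
        using lo[of "2 * L + 3" "2 * L + 4"] by (auto simp: not_less)
      have "2 * L + 3 < (f (x + d/2) - f x) / (d / 2)" using d(2)[of "x + d/2"] d(1) by auto
      moreover have "(f (x + d/2) - f x) / (d / 2) \<le> 2 * L + 1"
        using f_hi[of x "x + d/2"] d(1) by (simp add: field_simps)
      ultimately show False by linarith
    qed
    then obtain V where V: "v x = ennreal V" "V \<ge> 0" by (cases "v x") auto
    have "((\<lambda>y. (f y - f x) / (y - x)) \<longlongrightarrow> V) (at x)"
    proof (rule order_tendstoI)
      fix a assume "a < V"
      from lo[of a V] this V show "\<forall>\<^sub>F y in at x. a < (f y - f x) / (y - x)"
        by (auto simp: eventually_at dist_real_def)
    next
      fix a assume "V < a"
      from up[of a] this V show "\<forall>\<^sub>F y in at x. (f y - f x) / (y - x) < a"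
        by (auto simp: eventually_at dist_real_def ennreal_less_iff)
    qed
    then have "(f has_field_derivative V) (at x)" by (simp add: has_field_derivative_iff)
    then have "((\<lambda>x. f x - (L + 1) * x) has_field_derivative V - (L + 1) * 1) (at x)"
      by (intro DERIV_diff DERIV_cmult DERIV_ident)
    moreover have "(\<lambda>x. f x - (L + 1) * x) = g" by (auto simp: f_def)
    ultimately show ?thesis
      by (auto simp: differentiable_def has_field_derivative_def)
  qed
  then show ?thesis by (rule eventually_mono[OF AE])
qed

section \<open>Semiconcave functions and the Clarke sub-differential\<close>

text \<open>A proximal superdifferential with one constant \<open>c\<close> and with all
  \<open>X\<close> as test points, not only nearby ones. In this global form the condition can be
  integrated over directions and summed along a trajectory.\<close>

definition quad_superdiff :: "real \<Rightarrow> ('a::euclidean_space \<Rightarrow> real) \<Rightarrow> 'a \<Rightarrow> 'a set" where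
  "quad_superdiff c F Y = {v. \<forall>X. F X \<le> F Y + v \<bullet> (X - Y) + c * (norm (X - Y))\<^sup>2}"

lemma quad_superdiffD:
  "v \<in> quad_superdiff c F Y \<Longrightarrow> F X \<le> F Y + v \<bullet> (X - Y) + c * (norm (X - Y))\<^sup>2"
  by (simp add: quad_superdiff_def)

lemma quad_superdiff_monotone:
  assumes "v \<in> quad_superdiff c F Y" "w \<in> quad_superdiff c F X"
  shows "0 \<le> (v - w) \<bullet> (X - Y) + 2 * c * (norm (X - Y))\<^sup>2"
  using quad_superdiffD[OF assms(1), of X] quad_superdiffD[OF assms(2), of Y]
  by (simp add: inner_diff_left inner_diff_right norm_minus_commute)

text \<open>Moving from \<open>Y\<close> in the direction \<open>u = G - v\<close>, the difference
  quotients tend to \<open>u \<bullet> G\<close> but are bounded by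
  \<open>u \<bullet> v + O(t)\<close>; so \<open>u \<bullet> u \<le> 0\<close>.\<close>

lemma quad_superdiff_gderiv_unique:
  assumes v: "v \<in> quad_superdiff c F Y" and G: "GDERIV F Y :> G"
  shows "G = v"
proof (rule ccontr)
  assume ne: "G \<noteq> v"
  define u where "u = G - v"
  have u: "u \<noteq> 0" using ne by (simp add: u_def)
  have "(F has_derivative (\<lambda>h. h \<bullet> G)) (at Y)" using G by (simp add: gderiv_def)
  moreover have "((\<lambda>t. Y + t *\<^sub>R u) has_derivative (\<lambda>t. t *\<^sub>R u)) (at 0)"
    by (auto intro!: derivative_eq_intros)
  ultimately have "((\<lambda>t. F (Y + t *\<^sub>R u)) has_derivative (\<lambda>t. (t *\<^sub>R u) \<bullet> G)) (at 0)"
    using has_derivative_compose[of "\<lambda>t. Y + t *\<^sub>R u" "\<lambda>t. t *\<^sub>R u" 0 UNIV F "\<lambda>h. h \<bullet> G"] by simp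
  then have "((\<lambda>t. F (Y + t *\<^sub>R u)) has_field_derivative (u \<bullet> G)) (at 0)"
    unfolding has_field_derivative_def by (rule has_derivative_eq_rhs) (auto simp: mult.commute)
  then have "((\<lambda>t. (F (Y + t *\<^sub>R u) - F Y) / t) \<longlongrightarrow> u \<bullet> G) (at_right 0)"
    by (auto simp: has_field_derivative_iff intro: tendsto_within_subset)
  moreover have "((\<lambda>t. u \<bullet> v + c * t * (norm u)\<^sup>2) \<longlongrightarrow> u \<bullet> v + c * 0 * (norm u)\<^sup>2) (at_right 0)"
    by (intro tendsto_intros)
  moreover have "\<forall>\<^sub>F t in at_right 0. (F (Y + t *\<^sub>R u) - F Y) / t \<le> u \<bullet> v + c * t * (norm u)\<^sup>2"
    unfolding eventually_at_filter
  proof (intro always_eventually allI impI)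
    fix t :: real assume "t \<noteq> 0" "t \<in> {0<..}"
    then show "(F (Y + t *\<^sub>R u) - F Y) / t \<le> u \<bullet> v + c * t * (norm u)\<^sup>2"
      using quad_superdiffD[OF v, of "Y + t *\<^sub>R u"]
      by (simp add: field_simps power2_eq_square inner_commute)
  qed
  ultimately have "u \<bullet> G \<le> u \<bullet> v + c * 0 * (norm u)\<^sup>2"
    by (intro tendsto_le[of "at_right (0::real)"]) auto
  then have "u \<bullet> u \<le> 0" by (simp add: u_def inner_diff_right)
  then show False using u inner_gt_zero_iff[of u] by linarith
qed

text \<open>Trades sequences for an epsilon condition, under which closedness of the set of limiting
  gradients is just the triangle inequality.\<close>

lemma clarke_subdiff_approx:
  "clarke_subdiff F x =
     convex hull {w. \<forall>e>0. \<exists>X G. GDERIV F X :> G \<and> dist X x < e \<and> dist G w < e}"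
proof -
  have "(\<exists>X G. (\<forall>i::nat. GDERIV F (X i) :> G i) \<and> X \<longlonglongrightarrow> x \<and> G \<longlonglongrightarrow> w) \<longleftrightarrow>
        (\<forall>e>0. \<exists>X G. GDERIV F X :> G \<and> dist X x < e \<and> dist G w < e)" (is "?L \<longleftrightarrow> ?R") for w
  proof
    assume ?L
    then obtain X G where XG: "\<And>i::nat. GDERIV F (X i) :> G i" "X \<longlonglongrightarrow> x" "G \<longlonglongrightarrow> w" by blast
    show ?R
    proof (intro allI impI)
      fix e :: real assume "e > 0"
      then have "\<forall>\<^sub>F i in sequentially. dist (X i) x < e \<and> dist (G i) w < e"
        by (intro eventually_conj tendstoD[OF XG(2)] tendstoD[OF XG(3)])
      then show "\<exists>X G. GDERIV F X :> G \<and> dist X x < e \<and> dist G w < e"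
        using XG(1) eventually_happens'[OF sequentially_bot] by blast
    qed
  next
    assume R: ?R
    have "\<forall>i. \<exists>X G. GDERIV F X :> G \<and> dist X x < inverse (real (Suc i)) \<and> dist G w < inverse (real (Suc i))"
      using R by (intro allI) simp
    then obtain X G where XG: "\<And>i. GDERIV F (X i) :> G i"
       "\<And>i. dist (X i) x < inverse (real (Suc i))" "\<And>i. dist (G i) w < inverse (real (Suc i))"
      by metis
    have "X \<longlonglongrightarrow> x" "G \<longlonglongrightarrow> w"
      using XG LIMSEQ_inverse_real_of_nat
      by (auto intro!: metric_tendsto_imp_tendsto[OF LIMSEQ_inverse_real_of_nat] always_eventually simp: less_imp_le)
    with XG(1) show ?L by blast
  qed
  then show ?thesis by (simp add: clarke_subdiff_def)
qed

text \<open>\<open>g\<close> selects one quadratic supergradient at every point, including those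
  where \<open>F\<close> is not differentiable, because it will be the drift of the recursion
  wherever the recursion goes.\<close>

locale semiconcave =
  fixes F :: "'a::euclidean_space \<Rightarrow> real" and g :: "'a \<Rightarrow> 'a" and c A :: real
  assumes g_superdiff: "\<And>Y. g Y \<in> quad_superdiff c F Y"
    and growth: "\<And>Y. norm (g Y) \<le> A * (1 + norm Y)"
    and c_nonneg: "0 \<le> c"
begin

lemma A_nonneg: "0 \<le> A"
  using growth[of 0] order_trans[OF norm_ge_zero] by simp

lemma abs_diff_le:
  "\<bar>F X - F Y\<bar> \<le> max (norm (g X)) (norm (g Y)) * norm (X - Y) + c * (norm (X - Y))\<^sup>2"
proof -
  have "g Y \<bullet> (X - Y) \<le> norm (g Y) * norm (X - Y)" "g X \<bullet> (Y - X) \<le> norm (g X) * norm (X - Y)"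
    using norm_cauchy_schwarz[of "g Y" "X - Y"] norm_cauchy_schwarz[of "g X" "Y - X"]
    by (auto simp: norm_minus_commute)
  moreover have "norm (g Y) * norm (X - Y) \<le> max (norm (g X)) (norm (g Y)) * norm (X - Y)"
      "norm (g X) * norm (X - Y) \<le> max (norm (g X)) (norm (g Y)) * norm (X - Y)"
    by (auto intro: mult_right_mono)
  ultimately show ?thesis
    using quad_superdiffD[OF g_superdiff[of Y], of X] quad_superdiffD[OF g_superdiff[of X], of Y]
    unfolding abs_le_iff norm_minus_commute[of Y X] by linarith
qed

lemma norm_g_le: "norm X \<le> R \<Longrightarrow> norm (g X) \<le> A * (1 + R)"
  using growth[of X] A_nonneg by (meson add_left_mono mult_left_mono order_trans)

lemma isCont_F: "isCont F Y"
proof -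
  have "((\<lambda>X. F X - F Y) \<longlongrightarrow> 0) (at Y)"
  proof (rule Lim_null_comparison)
    show "\<forall>\<^sub>F X in at Y. norm (F X - F Y) \<le> A * (1 + (norm Y + 1)) * norm (X - Y) + c * (norm (X - Y))\<^sup>2"
      unfolding eventually_at
    proof (intro exI[of _ 1] conjI ballI impI, simp)
      fix X assume "X \<noteq> Y \<and> dist X Y < 1"
      then have "norm X \<le> norm Y + 1" using norm_triangle_ineq2[of X Y] by (simp add: dist_norm)
      then have "max (norm (g X)) (norm (g Y)) \<le> A * (1 + (norm Y + 1))"
        using norm_g_le[of X "norm Y + 1"] norm_g_le[of Y "norm Y + 1"] by simp
      then have "max (norm (g X)) (norm (g Y)) * norm (X - Y) \<le> A * (1 + (norm Y + 1)) * norm (X - Y)"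
        by (rule mult_right_mono) simp
      then show "norm (F X - F Y) \<le> A * (1 + (norm Y + 1)) * norm (X - Y) + c * (norm (X - Y))\<^sup>2"
        using abs_diff_le[of X Y] by simp
    qed
    have "((\<lambda>X. A * (1 + (norm Y + 1)) * norm (X - Y) + c * (norm (X - Y))\<^sup>2) \<longlongrightarrow>
        A * (1 + (norm Y + 1)) * norm (Y - Y) + c * (norm (Y - Y))\<^sup>2) (at Y)"
      by (intro tendsto_intros)
    then show "((\<lambda>X. A * (1 + (norm Y + 1)) * norm (X - Y) + c * (norm (X - Y))\<^sup>2) \<longlongrightarrow> 0) (at Y)" by simp
  qed
  then show ?thesis by (simp add: isCont_def LIM_zero_iff)
qed

text \<open>The supergradient inequality based at \<open>Y\<close> bounds the linearisation error
  from above, the one based at \<open>X\<close> bounds it from below; the gap is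
  \<open>norm (g X - g Y) * norm (X - Y)\<close> plus a quadratic term.\<close>

lemma gderiv_at_continuity_point:
  assumes "isCont g Y"
  shows "GDERIV F Y :> g Y"
  unfolding gderiv_def has_derivative_iff_norm
proof (intro conjI bounded_linear_inner_left)
  show "((\<lambda>X. norm (F X - F Y - (X - Y) \<bullet> g Y) / norm (X - Y)) \<longlongrightarrow> 0) (at Y)"
  proof (rule Lim_null_comparison)
    show "\<forall>\<^sub>F X in at Y. norm (norm (F X - F Y - (X - Y) \<bullet> g Y) / norm (X - Y)) \<le> norm (g X - g Y) + c * norm (X - Y)"
      unfolding eventually_at
    proof (intro exI[of _ 1] conjI ballI impI, simp)
      fix X assume X: "X \<noteq> Y \<and> dist X Y < 1"
      have "F X - F Y - (X - Y) \<bullet> g Y \<le> c * (norm (X - Y))\<^sup>2"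
        using quad_superdiffD[OF g_superdiff[of Y], of X] by (simp add: inner_commute)
      moreover have "- (F X - F Y - (X - Y) \<bullet> g Y) \<le> (X - Y) \<bullet> (g Y - g X) + c * (norm (X - Y))\<^sup>2"
        using quad_superdiffD[OF g_superdiff[of X], of Y]
        by (simp add: inner_commute inner_diff_right inner_diff_left norm_minus_commute algebra_simps)
      moreover have "(X - Y) \<bullet> (g Y - g X) \<le> norm (X - Y) * norm (g X - g Y)"
        using norm_cauchy_schwarz[of "X - Y" "g Y - g X"] by (simp add: norm_minus_commute)
      moreover have "0 \<le> norm (X - Y) * norm (g X - g Y)" by simp
      moreover have "(norm (g X - g Y) + c * norm (X - Y)) * norm (X - Y) =
          norm (X - Y) * norm (g X - g Y) + c * (norm (X - Y))\<^sup>2"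
        by (simp add: power2_eq_square algebra_simps)
      ultimately have "\<bar>F X - F Y - (X - Y) \<bullet> g Y\<bar> \<le> (norm (g X - g Y) + c * norm (X - Y)) * norm (X - Y)"
        unfolding abs_le_iff by linarith
      then show "norm (norm (F X - F Y - (X - Y) \<bullet> g Y) / norm (X - Y)) \<le> norm (g X - g Y) + c * norm (X - Y)"
        using X by (simp add: divide_le_eq)
    qed
    have "(g \<longlongrightarrow> g Y) (at Y)" using assms by (simp add: isCont_def)
    then have "((\<lambda>X. norm (g X - g Y) + c * norm (X - Y)) \<longlongrightarrow> norm (g Y - g Y) + c * norm (Y - Y)) (at Y)"
      by (intro tendsto_intros)
    then show "((\<lambda>X. norm (g X - g Y) + c * norm (X - Y)) \<longlongrightarrow> 0) (at Y)" by simp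
  qed
qed

text \<open>The superdifferential is monotone up to a quadratic term, so if \<open>v\<close> were separated from the
  limits of gradients in direction \<open>a\<close>, gradients at points close to \<open>x + t a\<close>, \<open>t \<rightarrow> 0\<close>, would
  violate monotonicity.\<close>

lemma quad_superdiff_subset_clarke:
  assumes dense: "\<And>U. open U \<Longrightarrow> U \<noteq> {} \<Longrightarrow> \<exists>Y\<in>U. isCont g Y"
    and v: "v \<in> quad_superdiff c F x"
  shows "v \<in> clarke_subdiff F x"
proof -
  define S where "S = {w. \<forall>e>0. \<exists>X G. GDERIV F X :> G \<and> dist X x < e \<and> dist G w < e}"
  \<comment> \<open>Compactness of \<open>S\<close> makes its convex hull closed, as strict
    separation requires. Boundedness comes from the growth bound, since every gradient of
    \<open>F\<close> coincides with \<open>g\<close>.\<close>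
  have "closed S"
  proof (rule closure_subset_eq[THEN iffD1], rule subsetI)
    fix w assume "w \<in> closure S"
    then have w: "\<forall>e>0. \<exists>y\<in>S. dist y w < e" by (simp add: closure_approachable)
    show "w \<in> S" unfolding S_def
    proof (clarify)
      fix e :: real assume e: "e > 0"
      obtain y where y: "y \<in> S" "dist y w < e/2" using w e half_gt_zero by blast
      obtain X G where "GDERIV F X :> G" "dist X x < e/2" "dist G y < e/2"
        using y(1) e by (auto simp: S_def dest: spec[of _ "e/2"])
      then show "\<exists>X G. GDERIV F X :> G \<and> dist X x < e \<and> dist G w < e"
        using y(2) e dist_triangle[of G w y] by (intro exI[of _ X] exI[of _ G]) auto
    qed
  qed
  moreover have "bounded S"
    unfolding bounded_iff
  proof (intro exI ballI)
    fix w assume "w \<in> S"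
    then obtain X G where XG: "GDERIV F X :> G" "dist X x < 1" "dist G w < 1"
      by (auto simp: S_def dest: spec[of _ 1])
    have "norm X \<le> norm x + 1" using XG(2) using norm_triangle_ineq2[of X x] by (simp add: dist_norm)
    then have "norm G \<le> A * (1 + (norm x + 1))"
      using norm_g_le[of X "norm x + 1"] quad_superdiff_gderiv_unique[OF g_superdiff XG(1)] by simp
    moreover have "norm w \<le> norm G + 1"
      using XG(3) norm_triangle_ineq2[of w G] by (simp add: dist_norm norm_minus_commute)
    ultimately show "norm w \<le> A * (1 + (norm x + 1)) + 1" by simp
  qed
  ultimately have "compact S" by (simp add: compact_eq_bounded_closed)
  then have cl: "closed (convex hull S)" by (simp add: compact_convex_hull compact_imp_closed)
  have "v \<in> convex hull S"
  proof (rule ccontr)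
    assume "v \<notin> convex hull S"
    then obtain a b where ab: "a \<bullet> v < b" "\<And>w. w \<in> convex hull S \<Longrightarrow> b < a \<bullet> w"
      using separating_hyperplane_closed_point[OF convex_convex_hull cl] by blast
    define t where "t j = inverse (real (Suc j))" for j
    have t: "t j > 0" "t j \<le> 1" for j by (auto simp: t_def inverse_le_1_iff)
    have t0: "t \<longlonglongrightarrow> 0" unfolding t_def by (rule LIMSEQ_inverse_real_of_nat)
    \<comment> \<open>The tolerance is the square of \<open>t j\<close>, of smaller order than
      \<open>t j\<close> itself, so that the rescaled directions \<open>e j\<close> below still
      converge to \<open>a\<close>.\<close>
    have "\<exists>X. isCont g X \<and> dist X (x + t j *\<^sub>R a) < (t j)\<^sup>2" for j
      using dense[of "ball (x + t j *\<^sub>R a) ((t j)\<^sup>2)"] t[of j] by (auto simp: dist_commute)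
    then obtain X where X: "\<And>j. isCont g (X j)" "\<And>j. dist (X j) (x + t j *\<^sub>R a) < (t j)\<^sup>2"
      by metis
    define e where "e j = (X j - x) /\<^sub>R t j" for j
    have Xe: "X j = x + t j *\<^sub>R e j" for j using t[of j] by (simp add: e_def)
    have ea: "norm (e j - a) \<le> t j" for j
    proof -
      have "X j - (x + t j *\<^sub>R a) = t j *\<^sub>R (e j - a)" by (simp add: Xe scaleR_diff_right)
      then have "t j * norm (e j - a) < (t j)\<^sup>2" using X(2)[of j] t[of j] by (simp add: dist_norm)
      then show ?thesis using t[of j] by (simp add: power2_eq_square)
    qed
    have e_lim: "e \<longlonglongrightarrow> a"
      by (rule LIM_zero_cancel, rule Lim_null_comparison[OF _ t0]) (use ea in auto)
    have "X \<longlonglongrightarrow> x + 0 *\<^sub>R a" unfolding Xe by (intro tendsto_intros t0 e_lim)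
    then have X_lim: "X \<longlonglongrightarrow> x" by simp
    have "\<exists>B. \<forall>j. norm (X j) \<le> B"
      using convergent_imp_Bseq[OF convergentI[OF X_lim]] by (auto simp: Bseq_def)
    then obtain B where B: "\<And>j. norm (X j) \<le> B" by blast
    then have "\<forall>j. g (X j) \<in> cball 0 (A * (1 + B))" using norm_g_le by simp
    then obtain w k where wk: "strict_mono (k :: nat \<Rightarrow> nat)" "((\<lambda>j. g (X j)) \<circ> k) \<longlonglongrightarrow> w"
      using seq_compactE[OF compact_imp_seq_compact[OF compact_cball], of "\<lambda>j. g (X j)"] by blast
    have wk2: "(\<lambda>j. g (X (k j))) \<longlonglongrightarrow> w" using wk(2) by (simp add: o_def)
    have sub: "(\<lambda>j. f (k j)) \<longlonglongrightarrow> l" if "f \<longlonglongrightarrow> l" for f :: "nat \<Rightarrow> 'c::topological_space" and l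
      using LIMSEQ_subseq_LIMSEQ[OF that wk(1)] by (simp add: o_def)
    have "w \<in> S" unfolding S_def
    proof (clarify)
      fix r :: real assume "r > 0"
      then have "\<forall>\<^sub>F j in sequentially. dist (X (k j)) x < r \<and> dist (g (X (k j))) w < r"
        by (intro eventually_conj tendstoD[OF sub[OF X_lim]] tendstoD[OF wk2])
      then obtain j where "dist (X (k j)) x < r" "dist (g (X (k j))) w < r"
        using eventually_happens'[OF sequentially_bot] by blast
      then show "\<exists>X G. GDERIV F X :> G \<and> dist X x < r \<and> dist G w < r"
        using gderiv_at_continuity_point[OF X(1)] by blast
    qed
    then have "b < a \<bullet> w" by (intro ab hull_inc)
    \<comment> \<open>Monotonicity between \<open>x\<close> and \<open>X j\<close>, divided by
      \<open>t j\<close>. In the limit \<open>a \<bullet> w \<le> a \<bullet> v < b\<close>,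
      although \<open>w\<close> is a limiting gradient and lies on the other side of the
      hyperplane.\<close>
    have "0 \<le> (v - g (X j)) \<bullet> e j + 2 * c * t j * (norm (e j))\<^sup>2" for j
    proof -
      have "0 \<le> t j * ((v - g (X j)) \<bullet> e j + 2 * c * t j * (norm (e j))\<^sup>2)"
        using quad_superdiff_monotone[OF v g_superdiff, of "X j"] t[of j]
        by (simp add: Xe power_mult_distrib power2_eq_square algebra_simps)
      then show ?thesis using t[of j] by (simp add: zero_le_mult_iff)
    qed
    moreover have "(\<lambda>j. (v - g (X (k j))) \<bullet> e (k j) + 2 * c * t (k j) * (norm (e (k j)))\<^sup>2) \<longlonglongrightarrow>
        (v - w) \<bullet> a + 2 * c * 0 * (norm a)\<^sup>2"
      by (intro tendsto_intros wk2 sub[OF e_lim] sub[OF t0])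
    ultimately have "0 \<le> (v - w) \<bullet> a + 2 * c * 0 * (norm a)\<^sup>2"
      by (intro LIMSEQ_le_const) auto
    then show False using ab(1) \<open>b < a \<bullet> w\<close> by (simp add: inner_diff_left inner_commute[of _ a] inner_diff_right)
  qed
  then show ?thesis by (simp add: clarke_subdiff_approx S_def)
qed

end

section \<open>Limits of perturbed gradient recursions\<close>

lemma interpolate_cell:
  assumes "\<alpha> > 0" "\<alpha> * real t \<le> s" "s \<le> \<alpha> * real (Suc t)"
  shows "interpolate \<alpha> y s = y t + (s / \<alpha> - real t) *\<^sub>R (y (Suc t) - y t)"
proof (cases "s = \<alpha> * real (Suc t)")
  case True
  then have s: "s / \<alpha> = real (Suc t)" using assms by simp
  then have "nat \<lfloor>s / \<alpha>\<rfloor> = Suc t" by (simp only: floor_of_nat nat_int)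
  then show ?thesis by (simp add: interpolate_def Let_def s del: of_nat_Suc) simp
next
  case False
  then have "real t \<le> s / \<alpha>" "s / \<alpha> < real t + 1"
    using assms by (auto simp: field_simps)
  then have "\<lfloor>s / \<alpha>\<rfloor> = int t" by (intro floor_unique) auto
  then show ?thesis by (simp add: interpolate_def Let_def)
qed

lemma interpolate_grid: "\<alpha> > 0 \<Longrightarrow> interpolate \<alpha> y (\<alpha> * real t) = y t"
  by (subst interpolate_cell[of \<alpha> t]) (auto simp: algebra_simps)

lemma nat_floor_cell:
  assumes "\<alpha> > 0" "0 \<le> s"
  shows "\<alpha> * real (nat \<lfloor>s / \<alpha>\<rfloor>) \<le> s" "s \<le> \<alpha> * real (Suc (nat \<lfloor>s / \<alpha>\<rfloor>))"
    "s - \<alpha> \<le> \<alpha> * real (nat \<lfloor>s / \<alpha>\<rfloor>)"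
proof -
  have "0 \<le> \<lfloor>s / \<alpha>\<rfloor>" using assms by simp
  then have "real (nat \<lfloor>s / \<alpha>\<rfloor>) \<le> s / \<alpha>" "s / \<alpha> \<le> real (nat \<lfloor>s / \<alpha>\<rfloor>) + 1"
    by (auto simp: of_nat_nat)
  from this[THEN mult_left_mono, of \<alpha>]
  show 1: "\<alpha> * real (nat \<lfloor>s / \<alpha>\<rfloor>) \<le> s" "s \<le> \<alpha> * real (Suc (nat \<lfloor>s / \<alpha>\<rfloor>))"
    using assms by (auto simp del: of_nat_nat simp: algebra_simps)
  then show "s - \<alpha> \<le> \<alpha> * real (nat \<lfloor>s / \<alpha>\<rfloor>)" by (simp add: algebra_simps)
qed

text \<open>Inside one cell this is the increment bound. A longer interval is cut at its last
  interior grid point, by induction on the number of cells.\<close>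

lemma interpolate_lipschitz:
  fixes y :: "nat \<Rightarrow> 'a::real_normed_vector"
  assumes \<alpha>: "\<alpha> > 0" and incr: "\<And>t. \<alpha> * real t \<le> T \<Longrightarrow> norm (y (Suc t) - y t) \<le> \<alpha> * L"
    and s: "0 \<le> s" "s \<le> s'" "s' \<le> T"
  shows "norm (interpolate \<alpha> y s' - interpolate \<alpha> y s) \<le> L * (s' - s)"
proof -
  let ?I = "interpolate \<alpha> y"
  have "norm (y (Suc 0) - y 0) \<le> \<alpha> * L" using incr[of 0] s by simp
  then have "0 \<le> \<alpha> * L" using norm_ge_zero order_trans by blast
  then have L: "L \<ge> 0" using \<alpha> by (simp add: zero_le_mult_iff)
  have cell: "norm (?I b - ?I a) \<le> L * (b - a)"
    if "\<alpha> * real t \<le> a" "a \<le> b" "b \<le> \<alpha> * real (Suc t)" "\<alpha> * real t \<le> T" for a b t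
  proof -
    have "?I b - ?I a = ((b - a) / \<alpha>) *\<^sub>R (y (Suc t) - y t)"
      using that \<alpha> by (simp add: interpolate_cell[of \<alpha> t] diff_divide_distrib scaleR_diff_left)
    then have "norm (?I b - ?I a) = (b - a) / \<alpha> * norm (y (Suc t) - y t)" using that \<alpha> by simp
    also have "\<dots> \<le> (b - a) / \<alpha> * (\<alpha> * L)" using that \<alpha> by (intro mult_left_mono incr) auto
    finally show ?thesis using \<alpha> by (simp add: mult.commute)
  qed
  have "norm (?I b - ?I s) \<le> L * (b - s)" if "s \<le> b" "b \<le> T" "b \<le> \<alpha> * real m" for b m
    using that
  proof (induction m arbitrary: b)
    case 0
    then show ?case using s \<alpha> cell[of 0 s b] L by auto
  next
    case (Suc m)
    show ?case
    proof (cases "b \<le> \<alpha> * real m")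
      case True then show ?thesis using Suc by auto
    next
      case False
      then have bm: "\<alpha> * real m < b" by simp
      show ?thesis
      proof (cases "s \<le> \<alpha> * real m")
        case True
        have "norm (?I b - ?I (\<alpha> * real m)) \<le> L * (b - \<alpha> * real m)"
          using bm Suc.prems by (intro cell[of m]) auto
        moreover have "norm (?I (\<alpha> * real m) - ?I s) \<le> L * (\<alpha> * real m - s)"
          using bm Suc.prems True by (intro Suc.IH) auto
        moreover have "norm (?I b - ?I s) \<le> norm (?I b - ?I (\<alpha> * real m)) + norm (?I (\<alpha> * real m) - ?I s)"
          using norm_triangle_ineq[of "?I b - ?I (\<alpha> * real m)" "?I (\<alpha> * real m) - ?I s"] by simp
        ultimately show ?thesis by (simp add: algebra_simps)
      next
        case False
        then show ?thesis using bm Suc.prems by (intro cell[of m]) auto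
      qed
    qed
  qed
  from this[of s' "Suc (nat \<lfloor>s' / \<alpha>\<rfloor>)"] show ?thesis
    using s nat_floor_cell(2)[OF \<alpha>, of s'] by auto
qed

corollary interpolate_lipschitz_abs:
  fixes y :: "nat \<Rightarrow> 'a::real_normed_vector"
  assumes "\<alpha> > 0" "\<And>t. \<alpha> * real t \<le> T \<Longrightarrow> norm (y (Suc t) - y t) \<le> \<alpha> * L" "a \<in> {0..T}" "b \<in> {0..T}"
  shows "norm (interpolate \<alpha> y b - interpolate \<alpha> y a) \<le> L * \<bar>b - a\<bar>"
  using interpolate_lipschitz[of \<alpha> T y L a b] interpolate_lipschitz[of \<alpha> T y L b a] assms
  by (cases "a \<le> b") (auto simp: norm_minus_commute)

text \<open>Ascoli's theorem on the half-line: diagonal extraction at the nonnegative rationals,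
  then the common Lipschitz constant on \<open>{0..T}\<close> upgrades convergence there to uniform
  convergence.\<close>

lemma equi_lipschitz_convergent_subsequence:
  fixes I :: "nat \<Rightarrow> real \<Rightarrow> 'a::euclidean_space"
  assumes bnd: "\<And>T. \<exists>R. \<forall>i. \<forall>s\<in>{0..T}. norm (I i s) \<le> R"
    and lip: "\<And>T. \<exists>L. \<forall>i. \<forall>s\<in>{0..T}. \<forall>s'\<in>{0..T}. norm (I i s' - I i s) \<le> L * \<bar>s' - s\<bar>"
  obtains k Y where "strict_mono (k :: nat \<Rightarrow> nat)"
    "\<And>T. uniform_limit {0..T} (\<lambda>i. I (k i)) Y sequentially"
proof -
  obtain R where R: "\<And>T i s. s \<in> {0..T} \<Longrightarrow> norm (I i s) \<le> R T" using bnd by metis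
  \<comment> \<open>The bound \<open>R q\<close> depends on the time, whereas the extraction
    principle wants one bound for all points. The scaling factor is independent of \<open>i\<close>
    and so does not affect convergence.\<close>
  define f where "f i q = I i q /\<^sub>R (1 + \<bar>R q\<bar>)" for i q
  have f1: "norm (f i q) \<le> 1" if "q \<in> \<rat> \<inter> {0..}" for i q
  proof -
    have "norm (I i q) \<le> 1 + \<bar>R q\<bar>" using R[of q q i] that by auto
    then show ?thesis by (simp add: f_def field_simps)
  qed
  obtain k where k: "strict_mono (k :: nat \<Rightarrow> nat)"
    and conv: "\<And>q. q \<in> \<rat> \<inter> {0..} \<Longrightarrow> \<exists>l. (\<lambda>n. f (k n) q) \<longlonglongrightarrow> l"
    by (rule function_convergent_subsequence[of "\<rat> \<inter> {0..}" f 1]) (use f1 countable_rat in auto)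
  have conv': "Cauchy (\<lambda>n. I (k n) q)" if q: "q \<in> \<rat> \<inter> {0..}" for q
  proof -
    obtain l where "(\<lambda>n. f (k n) q) \<longlonglongrightarrow> l" using conv[OF q] by blast
    then have "(\<lambda>n. (1 + \<bar>R q\<bar>) *\<^sub>R f (k n) q) \<longlonglongrightarrow> (1 + \<bar>R q\<bar>) *\<^sub>R l" by (intro tendsto_intros)
    then have "(\<lambda>n. I (k n) q) \<longlonglongrightarrow> (1 + \<bar>R q\<bar>) *\<^sub>R l"
      by (simp add: f_def add_nonneg_eq_0_iff)
    then show ?thesis by (rule LIMSEQ_imp_Cauchy)
  qed
  have UC: "\<exists>M. \<forall>m\<ge>M. \<forall>n\<ge>M. \<forall>s\<in>{0..T}. dist (I (k m) s) (I (k n) s) < e" if e: "e > 0" for T e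
  proof -
    obtain L where L: "\<And>i s s'. s \<in> {0..T} \<Longrightarrow> s' \<in> {0..T} \<Longrightarrow> norm (I i s' - I i s) \<le> L * \<bar>s' - s\<bar>"
      using lip[of T] by blast
    define L' where "L' = \<bar>L\<bar> + 1"
    have L': "norm (I i s' - I i s) \<le> L' * \<bar>s' - s\<bar>" if "s \<in> {0..T}" "s' \<in> {0..T}" for i s s'
    proof -
      have "L * \<bar>s' - s\<bar> \<le> L' * \<bar>s' - s\<bar>" by (intro mult_right_mono) (auto simp: L'_def)
      then show ?thesis using L[OF that, of i] by linarith
    qed
    \<comment> \<open>On a mesh of width \<open>1 / N\<close> each curve varies by less than
      \<open>e / 3\<close>, so the Cauchy property at the finitely many grid points, which are
      rational, is uniform on \<open>{0..T}\<close>.\<close>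
    obtain N :: nat where N: "N > 0" "L' / real N < e / 3"
    proof -
      obtain N :: nat where "L' * 3 / e < real N" using reals_Archimedean2 by blast
      moreover have "0 \<le> L' * 3 / e" using e by (simp add: L'_def)
      ultimately have "N > 0" using of_nat_0_less_iff[where 'a=real] by (metis le_less_trans)
      moreover from this have "L' / real N < e / 3" using \<open>L' * 3 / e < real N\<close> e by (simp add: field_simps)
      ultimately have "N > 0" "L' / real N < e / 3" by blast+
      then show ?thesis by (rule that)
    qed
    define J where "J = (\<lambda>j. real j / real N) ` {j. real j / real N \<le> T}"
    have "{j. real j / real N \<le> T} \<subseteq> {..nat \<lceil>T * real N\<rceil>}"
      using N(1) by (auto simp: field_simps) linarith
    then have finJ: "finite J" unfolding J_def using finite_subset by blast
    have J: "q \<in> \<rat> \<inter> {0..}" "q \<in> {0..T}" if "q \<in> J" for q using that by (auto simp: J_def)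
    have "\<forall>q\<in>J. \<forall>\<^sub>F M in sequentially. \<forall>m\<ge>M. \<forall>n\<ge>M. dist (I (k m) q) (I (k n) q) < e / 3"
    proof
      fix q assume "q \<in> J"
      then have "Cauchy (\<lambda>n. I (k n) q)" using J conv' by blast
      then obtain M where "\<forall>m\<ge>M. \<forall>n\<ge>M. dist (I (k m) q) (I (k n) q) < e / 3"
        using e unfolding Cauchy_def by (meson divide_pos_pos zero_less_numeral)
      then show "\<forall>\<^sub>F M in sequentially. \<forall>m\<ge>M. \<forall>n\<ge>M. dist (I (k m) q) (I (k n) q) < e / 3"
        unfolding eventually_sequentially by (intro exI[of _ M]) auto
    qed
    then have "\<forall>\<^sub>F M in sequentially. \<forall>q\<in>J. \<forall>m\<ge>M. \<forall>n\<ge>M. dist (I (k m) q) (I (k n) q) < e / 3"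
      using finJ by (intro eventually_ball_finite) auto
    then obtain M where M: "\<And>q m n. q \<in> J \<Longrightarrow> m \<ge> M \<Longrightarrow> n \<ge> M \<Longrightarrow> dist (I (k m) q) (I (k n) q) < e / 3"
      unfolding eventually_sequentially by blast
    have "dist (I (k m) s) (I (k n) s) < e" if s: "s \<in> {0..T}" "m \<ge> M" "n \<ge> M" for s m n
    proof -
      define q where "q = real (nat \<lfloor>s * real N\<rfloor>) / real N"
      have q: "q \<le> s" "s - q \<le> 1 / real N"
        using nat_floor_cell[of "1 / real N" s] s N(1) by (auto simp: q_def field_simps)
      then have qJ: "q \<in> J" using s unfolding J_def q_def by (intro imageI) auto
      have near: "dist (I i s) (I i q) < e / 3" for i
      proof -
        have "norm (I i s - I i q) \<le> L' * \<bar>s - q\<bar>" using L' J[OF qJ] s by blast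
        also have "\<dots> \<le> L' * (1 / real N)" using q by (intro mult_left_mono) (auto simp: L'_def)
        finally have "norm (I i s - I i q) \<le> L' / real N" by simp
        then show ?thesis using N(2) unfolding dist_norm by linarith
      qed
      have "dist (I (k m) s) (I (k n) s) \<le>
          dist (I (k m) s) (I (k m) q) + dist (I (k m) q) (I (k n) q) + dist (I (k n) s) (I (k n) q)"
        using dist_triangle[of "I (k m) s" "I (k n) s" "I (k m) q"]
          dist_triangle2[of "I (k m) q" "I (k n) s" "I (k n) q"] by linarith
      then show ?thesis using near[of "k m"] near[of "k n"] M[OF qJ s(2,3)] by linarith
    qed
    then show ?thesis by blast
  qed
  define Y where "Y s = lim (\<lambda>n. I (k n) s)" for s
  have Y: "(\<lambda>n. I (k n) s) \<longlonglongrightarrow> Y s" if "s \<ge> 0" for s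
  proof -
    have "Cauchy (\<lambda>n. I (k n) s)" unfolding Cauchy_def using UC[of _ s] that by (meson atLeastAtMost_iff order_refl)
    then show ?thesis unfolding Y_def by (simp add: Cauchy_convergent convergent_LIMSEQ_iff[symmetric])
  qed
  have "uniform_limit {0..T} (\<lambda>i. I (k i)) Y sequentially" for T
    unfolding uniform_limit_iff
  proof (intro allI impI)
    fix e :: real assume e: "e > 0"
    obtain M where M: "\<And>m n s. m \<ge> M \<Longrightarrow> n \<ge> M \<Longrightarrow> s \<in> {0..T} \<Longrightarrow> dist (I (k m) s) (I (k n) s) < e / 2"
      using UC[of "e/2" T] e by (meson half_gt_zero)
    have "dist (I (k m) s) (Y s) < e" if "m \<ge> M" "s \<in> {0..T}" for m s
    proof -
      have "(\<lambda>n. dist (I (k m) s) (I (k n) s)) \<longlonglongrightarrow> dist (I (k m) s) (Y s)"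
        using that by (intro tendsto_intros Y) auto
      then have "dist (I (k m) s) (Y s) \<le> e / 2"
        by (rule LIMSEQ_le_const2) (use M that in \<open>auto intro!: exI[of _ M] less_imp_le\<close>)
      then show ?thesis using e by linarith
    qed
    then show "\<forall>\<^sub>F n in sequentially. \<forall>x\<in>{0..T}. dist (I (k n) x) (Y x) < e"
      unfolding eventually_sequentially by blast
  qed
  then show ?thesis using that k by blast
qed

text \<open>Clamping time to \<open>[0, N]\<close> yields curves on the whole line with globally
  Lipschitz coordinates, which agree with \<open>Y\<close> near every time strictly between 0 and
  \<open>N\<close>. Time 0 is a single point and is discarded.\<close>

lemma lipschitz_curve_AE_vector_derivative:
  fixes Y :: "real \<Rightarrow> 'a::euclidean_space"
  assumes lip: "\<And>T. \<exists>L. \<forall>s\<in>{0..T}. \<forall>s'\<in>{0..T}. norm (Y s' - Y s) \<le> L * \<bar>s' - s\<bar>"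
  shows "AE s in lborel. 0 \<le> s \<longrightarrow> (\<exists>V. (Y has_vector_derivative V) (at s))"
proof -
  define f where "f N s = Y (min (max s 0) (real N))" for N :: nat and s
  have "AE s in lborel. (\<lambda>s. f N s \<bullet> b) differentiable (at s)" if b: "b \<in> Basis" for N b
  proof -
    obtain L where L: "\<And>s s'. s \<in> {0..real N} \<Longrightarrow> s' \<in> {0..real N} \<Longrightarrow> norm (Y s' - Y s) \<le> L * \<bar>s' - s\<bar>"
      using lip[of "real N"] by blast
    have "\<bar>f N x \<bullet> b - f N y \<bullet> b\<bar> \<le> \<bar>L\<bar> * \<bar>x - y\<bar>" for x y
    proof -
      let ?c = "\<lambda>s. min (max s 0) (real N)"
      have "\<bar>f N x \<bullet> b - f N y \<bullet> b\<bar> \<le> norm (f N x - f N y)"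
        using Basis_le_norm[OF b] by (simp add: inner_diff_left[symmetric])
      also have "\<dots> \<le> L * \<bar>?c x - ?c y\<bar>" unfolding f_def by (intro L) auto
      also have "\<dots> \<le> \<bar>L\<bar> * \<bar>x - y\<bar>" by (intro mult_mono) auto
      finally show ?thesis .
    qed
    then show ?thesis by (rule lipschitz_AE_differentiable)
  qed
  then have "AE s in lborel. \<forall>N. \<forall>b\<in>Basis. (\<lambda>s. f N s \<bullet> b) differentiable (at s)"
    by (subst AE_all_countable) (auto intro!: AE_finite_allI)
  moreover have "AE s in lborel. s \<noteq> (0::real)" by (rule AE_lborel_singleton)
  ultimately show ?thesis
  proof eventually_elim
    case (elim s)
    show ?case
    proof
      assume "0 \<le> s"
      then have s: "0 < s" using elim by simp
      obtain N :: nat where N: "s < real N" using reals_Archimedean2 by blast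
      have "f N differentiable (at s)" using elim by (subst differentiable_componentwise_within) auto
      then obtain V where "(f N has_vector_derivative V) (at s)"
        using vector_derivative_works by blast
      moreover have "f N x = Y x" if "x \<in> {0<..<real N}" for x using that by (simp add: f_def)
      ultimately have "(Y has_vector_derivative V) (at s)"
        using has_vector_derivative_transform_within_open[of "f N" V s "{0<..<real N}" Y] s N by auto
      then show "\<exists>V. (Y has_vector_derivative V) (at s)" ..
    qed
  qed
qed

lemma lipschitz_imp_C_abs:
  fixes Y :: "real \<Rightarrow> 'a::real_normed_vector"
  assumes lip: "\<And>T. \<exists>L. \<forall>s\<in>{0..T}. \<forall>s'\<in>{0..T}. norm (Y s' - Y s) \<le> L * \<bar>s' - s\<bar>"
  shows "Y \<in> C_abs"
  unfolding C_abs_def abs_continuous_on_def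
proof (intro CollectI allI impI)
  fix T e :: real assume "0 \<le> T" and e: "0 < e"
  obtain L where L: "\<And>s s'. s \<in> {0..T} \<Longrightarrow> s' \<in> {0..T} \<Longrightarrow> norm (Y s' - Y s) \<le> L * \<bar>s' - s\<bar>"
    using lip[of T] by blast
  show "\<exists>\<delta>>0. \<forall>I. finite I \<and> (\<forall>(a, b)\<in>I. a \<le> b \<and> {a..b} \<subseteq> {0..T}) \<and>
     disjoint_family_on (\<lambda>(a, b). {a<..<b}) I \<and> (\<Sum>(a, b)\<in>I. b - a) < \<delta> \<longrightarrow> (\<Sum>(a, b)\<in>I. dist (Y a) (Y b)) < e"
  proof (intro exI[of _ "e / (\<bar>L\<bar> + 1)"] conjI allI impI)
    show "0 < e / (\<bar>L\<bar> + 1)" using e by (auto intro!: divide_pos_pos)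
    fix I assume I: "finite I \<and> (\<forall>(a, b)\<in>I. a \<le> b \<and> {a..b} \<subseteq> {0..T}) \<and>
     disjoint_family_on (\<lambda>(a, b). {a<..<b}) I \<and> (\<Sum>(a, b)\<in>I. b - a) < e / (\<bar>L\<bar> + 1)"
    have "(\<Sum>(a, b)\<in>I. dist (Y a) (Y b)) \<le> (\<Sum>(a, b)\<in>I. (\<bar>L\<bar> + 1) * (b - a))"
    proof (rule sum_mono, clarify)
      fix a b assume "(a, b) \<in> I"
      then have ab: "a \<le> b" "a \<in> {0..T}" "b \<in> {0..T}" using I by (auto dest!: bspec)
      have "dist (Y a) (Y b) \<le> L * (b - a)" using L[OF ab(2,3)] ab(1) by (simp add: dist_norm norm_minus_commute)
      also have "\<dots> \<le> (\<bar>L\<bar> + 1) * (b - a)" using ab by (intro mult_right_mono) auto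
      finally show "dist (Y a) (Y b) \<le> (\<bar>L\<bar> + 1) * (b - a)" .
    qed
    also have "\<dots> = (\<bar>L\<bar> + 1) * (\<Sum>(a, b)\<in>I. b - a)" by (simp add: sum_distrib_left case_prod_unfold)
    also have "\<dots> < e"
    proof -
      have "(\<Sum>(a, b)\<in>I. b - a) < e / (\<bar>L\<bar> + 1)" using I by blast
      moreover have "0 < \<bar>L\<bar> + 1" by simp
      ultimately show ?thesis by (metis mult.commute pos_less_divide_eq)
    qed
    finally show "(\<Sum>(a, b)\<in>I. dist (Y a) (Y b)) < e" .
  qed
qed

section \<open>Passage to the limit: derivatives of limit curves are negatives of Clarke
  subgradients\<close>

context semiconcave
begin

text \<open>The supergradient inequalities are summed over the steps between times \<open>s\<close>
  and \<open>s + h\<close>. The step size times the sum of the gradients is minus the displacement,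
  up to two noise terms, so in the limit only \<open>Y (s + h) - Y s\<close> remains. Dividing by
  \<open>h\<close> and letting \<open>h\<close> tend to 0 from the right brings in
  \<open>V\<close>.\<close>

lemma quad_superdiff_of_limit:
  fixes \<alpha> :: "nat \<Rightarrow> real" and y :: "nat \<Rightarrow> nat \<Rightarrow> 'a" and Y :: "real \<Rightarrow> 'a"
  assumes \<alpha>: "\<And>i. \<alpha> i > 0" "\<alpha> \<longlonglongrightarrow> 0"
    and incr: "\<And>T. \<exists>L. \<forall>i t. \<alpha> i * real t \<le> T \<longrightarrow> norm (y i (Suc t) - y i t) \<le> \<alpha> i * L"
    and bnd: "\<And>T. \<exists>R. \<forall>i t. \<alpha> i * real t \<le> T \<longrightarrow> norm (y i t) \<le> R"
    and noise: "\<And>T e. e > 0 \<Longrightarrow> \<exists>i0. \<forall>i\<ge>i0. \<forall>m. \<alpha> i * real m \<le> T \<longrightarrow>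
          norm (y i m - y i 0 + \<alpha> i *\<^sub>R (\<Sum>t<m. g (y i t))) \<le> e"
    and conv: "\<And>T. uniform_limit {0..T} (\<lambda>i. interpolate (\<alpha> i) (y i)) Y sequentially"
    and s: "0 \<le> s" and V: "((\<lambda>h. (Y (s + h) - Y s) /\<^sub>R h) \<longlongrightarrow> V) (at_right 0)"
  shows "- V \<in> quad_superdiff c F (Y s)"
  unfolding quad_superdiff_def
proof (intro CollectI allI, rule field_le_epsilon)
  fix X and e :: real assume e: "e > 0"
  define T where "T = s + 1"
  define I where "I i = interpolate (\<alpha> i) (y i)" for i
  obtain L0 where L0: "\<And>i t. \<alpha> i * real t \<le> T \<Longrightarrow> norm (y i (Suc t) - y i t) \<le> \<alpha> i * L0" using incr by blast
  define L where "L = \<bar>L0\<bar> + 1"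
  have L: "\<alpha> i * real t \<le> T \<Longrightarrow> norm (y i (Suc t) - y i t) \<le> \<alpha> i * L" for i t
    using order_trans[OF L0[of i t] mult_left_mono[of L0 L "\<alpha> i"]] \<alpha>(1)[of i] by (simp add: L_def)
  have L1: "L \<ge> 1" by (simp add: L_def)
  obtain R where R: "\<And>i t. \<alpha> i * real t \<le> T \<Longrightarrow> norm (y i t) \<le> R" using bnd by blast
  have lip: "norm (I i b - I i a) \<le> L * \<bar>b - a\<bar>" if "a \<in> {0..T}" "b \<in> {0..T}" for i a b
    using interpolate_lipschitz_abs[of "\<alpha> i" T "y i" L a b] \<alpha>(1) L that by (simp add: I_def)
  have IY: "(\<lambda>i. I i a) \<longlonglongrightarrow> Y a" if "a \<in> {0..T}" for a
    unfolding I_def using tendsto_uniform_limitI[OF conv that] .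
  define G where "G = A * (1 + R)"
  have G: "\<alpha> i * real t \<le> T \<Longrightarrow> norm (g (y i t)) \<le> G" for i t
    unfolding G_def by (intro norm_g_le R)
  \<comment> \<open>Bounds the cost of moving the base point of the inequality from \<open>z\<close>
    to \<open>Y s\<close>, uniformly over supergradients of norm at most \<open>G\<close>. It is
    continuous and vanishes at \<open>Y s\<close>.\<close>
  define Q where "Q z = \<bar>F z - F (Y s)\<bar> + G * norm (z - Y s) + c * \<bar>(norm (X - z))\<^sup>2 - (norm (X - Y s))\<^sup>2\<bar>" for z
  have "isCont Q (Y s)" unfolding Q_def by (intro continuous_intros isCont_F)
  then obtain \<rho> where \<rho>0: "\<rho> > 0" and "\<forall>z. norm (z - Y s) < \<rho> \<longrightarrow> norm (Q z - Q (Y s)) < e"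
    using e unfolding isCont_def LIM_def dist_norm by (metis diff_self norm_zero)
  moreover have "Q (Y s) = 0" by (simp add: Q_def)
  ultimately have "Q z < e" if "dist z (Y s) < \<rho>" for z
    using that by (auto simp: dist_norm dest!: spec[of _ z])
  note \<rho> = \<rho>0 this
  have near: "F X \<le> F (Y s) + w \<bullet> (X - Y s) + c * (norm (X - Y s))\<^sup>2 + e"
    if "dist z (Y s) < \<rho>" "w = g z" "norm w \<le> G" for z w
  proof -
    have "F X \<le> F z + w \<bullet> (X - z) + c * (norm (X - z))\<^sup>2"
      using quad_superdiffD[OF g_superdiff[of z], of X] that by simp
    moreover have "w \<bullet> (X - z) = w \<bullet> (X - Y s) + w \<bullet> (Y s - z)" by (simp add: inner_diff_right)
    moreover have "w \<bullet> (Y s - z) \<le> G * norm (z - Y s)"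
      using norm_cauchy_schwarz[of w "Y s - z"] mult_right_mono[OF that(3), of "norm (z - Y s)"]
      by (simp add: norm_minus_commute)
    moreover have "c * (norm (X - z))\<^sup>2 - c * (norm (X - Y s))\<^sup>2 \<le> c * \<bar>(norm (X - z))\<^sup>2 - (norm (X - Y s))\<^sup>2\<bar>"
      unfolding right_diff_distrib[symmetric] by (intro mult_left_mono c_nonneg) auto
    ultimately show ?thesis using \<rho>(2)[OF that(1)] unfolding Q_def by linarith
  qed
  \<comment> \<open>For steps below \<open>h0\<close>, every iterate used is at a time within
    \<open>h0\<close> of \<open>s\<close>. It therefore lies within \<open>\<rho> / 4\<close> of the
    interpolated position at \<open>s\<close>, which is itself eventually within
    \<open>\<rho> / 4\<close> of \<open>Y s\<close>.\<close>
  define h0 where "h0 = min 1 (\<rho> / (4 * L))"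
  have h0: "h0 > 0" "h0 \<le> 1" "L * h0 \<le> \<rho> / 4"
    using \<rho> L1 by (auto simp: h0_def min_def field_simps)
  have key: "h * F X \<le> h * (F (Y s) + c * (norm (X - Y s))\<^sup>2 + e) - (Y (s + h) - Y s) \<bullet> (X - Y s)"
    if h: "0 < h" "h < h0" for h
  proof -
    define t1 where "t1 i = nat \<lfloor>s / \<alpha> i\<rfloor>" for i
    define t2 where "t2 i = nat \<lfloor>(s + h) / \<alpha> i\<rfloor>" for i
    have t1: "\<alpha> i * real (t1 i) \<le> s" "s - \<alpha> i \<le> \<alpha> i * real (t1 i)" for i
      unfolding t1_def by (rule nat_floor_cell(1)[OF \<alpha>(1) s], rule nat_floor_cell(3)[OF \<alpha>(1) s])
    have t2: "\<alpha> i * real (t2 i) \<le> s + h" "s + h - \<alpha> i \<le> \<alpha> i * real (t2 i)" for i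
      unfolding t2_def using s h
      by (intro nat_floor_cell(1)[OF \<alpha>(1)], simp, intro nat_floor_cell(3)[OF \<alpha>(1)], simp)
    have t12: "t1 i \<le> t2 i" for i
      unfolding t1_def t2_def using \<alpha>(1)[of i] h by (intro nat_mono floor_mono divide_right_mono) auto
    have hT: "s + h \<le> T" using h h0 by (simp add: T_def)
    have grid: "I i (\<alpha> i * real t) = y i t" for i t
      unfolding I_def by (rule interpolate_grid[OF \<alpha>(1)])
    have lim_grid: "(\<lambda>i. y i (t i)) \<longlonglongrightarrow> Y a" 
      if "a \<in> {0..T}" "\<And>i. \<alpha> i * real (t i) \<le> a" "\<And>i. a - \<alpha> i \<le> \<alpha> i * real (t i)" for t a
    proof -
      have "(\<lambda>i. y i (t i) - I i a) \<longlonglongrightarrow> 0"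
      proof (rule Lim_null_comparison)
        show "\<forall>\<^sub>F i in sequentially. norm (y i (t i) - I i a) \<le> L * \<alpha> i"
        proof (rule always_eventually, rule allI)
          fix i
          have "norm (I i (\<alpha> i * real (t i)) - I i a) \<le> L * \<bar>\<alpha> i * real (t i) - a\<bar>"
            using that(1) that(2)[of i] \<alpha>(1)[of i] by (intro lip) auto
          also have "\<dots> \<le> L * \<alpha> i" using that(2)[of i] that(3)[of i] L1 by (intro mult_left_mono) auto
          finally show "norm (y i (t i) - I i a) \<le> L * \<alpha> i" by (simp add: grid)
        qed
        show "(\<lambda>i. L * \<alpha> i) \<longlonglongrightarrow> 0" using tendsto_mult_left[OF \<alpha>(2), of L] by simp
      qed
      from tendsto_add[OF this IY[OF that(1)]] show ?thesis by simp
    qed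
    have yt1: "(\<lambda>i. y i (t1 i)) \<longlonglongrightarrow> Y s" by (rule lim_grid) (use t1 s in \<open>auto simp: T_def\<close>)
    have yt2: "(\<lambda>i. y i (t2 i)) \<longlonglongrightarrow> Y (s + h)" by (rule lim_grid) (use t2 s h hT in auto)
    define M where "M i m = y i m - y i 0 + \<alpha> i *\<^sub>R (\<Sum>t<m. g (y i t))" for i m
    have Mlim: "(\<lambda>i. M i (t i)) \<longlonglongrightarrow> 0" if t: "\<And>i. \<alpha> i * real (t i) \<le> T" for t
    proof (rule LIMSEQ_I)
      fix r :: real assume "r > 0"
      then obtain i0 where "\<forall>i\<ge>i0. \<forall>m. \<alpha> i * real m \<le> T \<longrightarrow> norm (M i m) \<le> r / 2"
        unfolding M_def using noise[of "r/2" T] by auto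
      then show "\<exists>no. \<forall>n\<ge>no. norm (M n (t n) - 0) < r"
        using t \<open>r > 0\<close> by (intro exI[of _ i0]) fastforce
    qed
    have sumg: "\<alpha> i *\<^sub>R (\<Sum>t\<in>{t1 i..<t2 i}. g (y i t)) = M i (t2 i) - M i (t1 i) - (y i (t2 i) - y i (t1 i))" for i
    proof -
      have "(\<Sum>t<t2 i. g (y i t)) = (\<Sum>t<t1 i. g (y i t)) + (\<Sum>t\<in>{t1 i..<t2 i}. g (y i t))"
        unfolding lessThan_atLeast0 by (rule sum.atLeastLessThan_concat[symmetric]) (use t12 in auto)
      then show ?thesis by (simp add: M_def scaleR_add_right)
    qed
    let ?w = "\<lambda>i. \<alpha> i * real (t2 i - t1 i)"
    have ineq: "\<forall>\<^sub>F i in sequentially. ?w i * F X \<le> ?w i * (F (Y s) + c * (norm (X - Y s))\<^sup>2 + e)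
        + (M i (t2 i) - M i (t1 i) - (y i (t2 i) - y i (t1 i))) \<bullet> (X - Y s)"
    proof -
      have "\<forall>\<^sub>F i in sequentially. \<alpha> i < h0" using order_tendstoD(2)[OF \<alpha>(2)] h0 by blast
      moreover have "\<forall>\<^sub>F i in sequentially. dist (I i s) (Y s) < \<rho> / 4"
        by (rule tendstoD[OF IY]) (use s \<rho> in \<open>auto simp: T_def\<close>)
      ultimately show ?thesis
      proof eventually_elim
        case (elim i)
        have each: "F X \<le> F (Y s) + g (y i t) \<bullet> (X - Y s) + c * (norm (X - Y s))\<^sup>2 + e"
          if t: "t \<in> {t1 i..<t2 i}" for t
        proof (rule near[OF _ refl])
          have "\<alpha> i * real t \<le> \<alpha> i * real (t2 i)" "\<alpha> i * real (t1 i) \<le> \<alpha> i * real t"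
            using t \<alpha>(1)[of i] by auto
          then have t': "\<alpha> i * real t \<le> s + h" "s - \<alpha> i \<le> \<alpha> i * real t"
            using t1(2)[of i] t2(1)[of i] by linarith+
          then have tT: "\<alpha> i * real t \<le> T" using hT by linarith
          show "norm (g (y i t)) \<le> G" by (rule G[OF tT])
          have "norm (I i (\<alpha> i * real t) - I i s) \<le> L * \<bar>\<alpha> i * real t - s\<bar>"
            using tT s \<alpha>(1)[of i] by (intro lip) (auto simp: T_def)
          also have "\<dots> \<le> L * h0" using t' elim h L1 by (intro mult_left_mono) auto
          finally have "dist (y i t) (I i s) \<le> \<rho> / 4" using h0 by (simp add: grid dist_norm)
          then show "dist (y i t) (Y s) < \<rho>"
            using elim dist_triangle[of "y i t" "Y s" "I i s"] \<rho> by linarith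
        qed
        have "real (t2 i - t1 i) * F X = (\<Sum>t\<in>{t1 i..<t2 i}. F X)" by simp
        also have "\<dots> \<le> (\<Sum>t\<in>{t1 i..<t2 i}. (F (Y s) + c * (norm (X - Y s))\<^sup>2 + e) + g (y i t) \<bullet> (X - Y s))"
          using each by (intro sum_mono) (simp add: algebra_simps)
        also have "\<dots> = real (t2 i - t1 i) * (F (Y s) + c * (norm (X - Y s))\<^sup>2 + e)
            + (\<Sum>t\<in>{t1 i..<t2 i}. g (y i t)) \<bullet> (X - Y s)"
          by (simp add: sum.distrib inner_sum_left)
        finally have "\<alpha> i * (real (t2 i - t1 i) * F X) \<le> \<alpha> i * \<dots>"
          using \<alpha>(1)[of i] by (intro mult_left_mono) auto
        then show ?case
          unfolding sumg[symmetric] by (simp add: distrib_left mult.assoc)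
      qed
    qed
    have wlim: "?w \<longlonglongrightarrow> h"
    proof -
      have "(\<lambda>i. ?w i - h) \<longlonglongrightarrow> 0"
      proof (rule Lim_null_comparison[OF _ \<alpha>(2)], rule always_eventually, rule allI)
        fix i
        have "?w i = \<alpha> i * real (t2 i) - \<alpha> i * real (t1 i)"
          using t12[of i] by (simp add: of_nat_diff right_diff_distrib)
        then show "norm (?w i - h) \<le> \<alpha> i" using t1[of i] t2[of i] by auto
      qed
      then show ?thesis by (rule LIM_zero_cancel)
    qed
    have "\<alpha> i * real (t1 i) \<le> T" "\<alpha> i * real (t2 i) \<le> T" for i
      using t1(1)[of i] t2(1)[of i] hT h by linarith+
    then have M1: "(\<lambda>i. M i (t1 i)) \<longlonglongrightarrow> 0" and M2: "(\<lambda>i. M i (t2 i)) \<longlonglongrightarrow> 0"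
      by (auto intro!: Mlim)
    have "h * F X \<le> h * (F (Y s) + c * (norm (X - Y s))\<^sup>2 + e) + (0 - 0 - (Y (s + h) - Y s)) \<bullet> (X - Y s)"
      by (rule tendsto_le[OF sequentially_bot _ _ ineq])
        (intro tendsto_intros wlim yt1 yt2 M1 M2)+
    then show ?thesis by (simp add: inner_diff_left)
  qed
  have "F X \<le> (F (Y s) + c * (norm (X - Y s))\<^sup>2 + e) - V \<bullet> (X - Y s)"
  proof (rule tendsto_le[OF trivial_limit_at_right_real])
    show "((\<lambda>h. (F (Y s) + c * (norm (X - Y s))\<^sup>2 + e) - ((Y (s + h) - Y s) /\<^sub>R h) \<bullet> (X - Y s)) \<longlongrightarrow>
        (F (Y s) + c * (norm (X - Y s))\<^sup>2 + e) - V \<bullet> (X - Y s)) (at_right 0)"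
      by (intro tendsto_intros V)
    show "((\<lambda>h. F X) \<longlongrightarrow> F X) (at_right (0::real))" by simp
    show "\<forall>\<^sub>F h in at_right 0. F X \<le> (F (Y s) + c * (norm (X - Y s))\<^sup>2 + e) - ((Y (s + h) - Y s) /\<^sub>R h) \<bullet> (X - Y s)"
      unfolding eventually_at_right_field
    proof (intro exI[of _ h0] conjI allI impI h0)
      fix h assume h: "0 < h" "h < h0"
      have "h * F X \<le> h * ((F (Y s) + c * (norm (X - Y s))\<^sup>2 + e) - ((Y (s + h) - Y s) /\<^sub>R h) \<bullet> (X - Y s))"
      proof -
        have "h * (((Y (s + h) - Y s) /\<^sub>R h) \<bullet> (X - Y s)) = (Y (s + h) - Y s) \<bullet> (X - Y s)" using h by simp
        then show ?thesis using key[OF h] by (subst right_diff_distrib) linarith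
      qed
      then show "F X \<le> (F (Y s) + c * (norm (X - Y s))\<^sup>2 + e) - ((Y (s + h) - Y s) /\<^sub>R h) \<bullet> (X - Y s)"
        using h by simp
    qed
  qed
  then show "F X \<le> F (Y s) + - V \<bullet> (X - Y s) + c * (norm (X - Y s))\<^sup>2 + e" by simp
qed

text \<open>A locally uniform limit inherits the Lipschitz bounds and hence has a derivative almost
  everywhere. At those times the negated derivative is a quadratic supergradient, which density of
  the continuity points of \<open>g\<close> turns into a Clarke subgradient.\<close>

proposition clarke_flow_limit:
  fixes \<alpha> :: "nat \<Rightarrow> real" and y :: "nat \<Rightarrow> nat \<Rightarrow> 'a"
  assumes dense: "\<And>U. open U \<Longrightarrow> U \<noteq> {} \<Longrightarrow> \<exists>Y\<in>U. isCont g Y"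
    and \<alpha>: "\<And>i. \<alpha> i > 0" "\<alpha> \<longlonglongrightarrow> 0"
    and incr: "\<And>T. \<exists>L. \<forall>i t. \<alpha> i * real t \<le> T \<longrightarrow> norm (y i (Suc t) - y i t) \<le> \<alpha> i * L"
    and bnd: "\<And>T. \<exists>R. \<forall>i t. \<alpha> i * real t \<le> T \<longrightarrow> norm (y i t) \<le> R"
    and noise: "\<And>T e. e > 0 \<Longrightarrow> \<exists>i0. \<forall>i\<ge>i0. \<forall>m. \<alpha> i * real m \<le> T \<longrightarrow>
          norm (y i m - y i 0 + \<alpha> i *\<^sub>R (\<Sum>t<m. g (y i t))) \<le> e"
    and K: "closed K" "\<And>i. y i 0 \<in> K"
  obtains k Y where "strict_mono (k :: nat \<Rightarrow> nat)" "Y \<in> clarke_flow F K"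
    "\<And>T. uniform_limit {0..T} (\<lambda>i. interpolate (\<alpha> (k i)) (y (k i))) Y sequentially"
proof -
  define I where "I i = interpolate (\<alpha> i) (y i)" for i
  have lip: "\<exists>L. \<forall>i. \<forall>s\<in>{0..T}. \<forall>s'\<in>{0..T}. norm (I i s' - I i s) \<le> L * \<bar>s' - s\<bar>" for T
  proof -
    obtain L where L: "\<And>i t. \<alpha> i * real t \<le> T \<Longrightarrow> norm (y i (Suc t) - y i t) \<le> \<alpha> i * L" using incr by blast
    have "norm (I i b - I i a) \<le> L * \<bar>b - a\<bar>" if "a \<in> {0..T}" "b \<in> {0..T}" for i a b
    using interpolate_lipschitz_abs[of "\<alpha> i" T "y i" L a b] \<alpha>(1) L that by (simp add: I_def)
    then show ?thesis by blast
  qed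
  have I0: "I i 0 = y i 0" for i using interpolate_grid[OF \<alpha>(1)[of i], of "y i" 0] by (simp add: I_def)
  have bndI: "\<exists>R. \<forall>i. \<forall>s\<in>{0..T}. norm (I i s) \<le> R" for T
  proof -
    obtain R where R: "\<And>i t. \<alpha> i * real t \<le> T \<Longrightarrow> norm (y i t) \<le> R" using bnd by blast
    obtain L where L: "\<And>i s s'. s\<in>{0..T} \<Longrightarrow> s'\<in>{0..T} \<Longrightarrow> norm (I i s' - I i s) \<le> L * \<bar>s' - s\<bar>"
      using lip[of T] by blast
    have "norm (I i s) \<le> R + \<bar>L\<bar> * T" if s: "s \<in> {0..T}" for i s
    proof -
      have "norm (I i s - I i 0) \<le> L * \<bar>s - 0\<bar>" using s by (intro L) auto
      also have "\<dots> \<le> \<bar>L\<bar> * T" using s by (intro mult_mono) auto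
      finally show ?thesis using R[of i 0] s norm_triangle_sub[of "I i s" "I i 0"] by (auto simp: I0)
    qed
    then show ?thesis by blast
  qed
  obtain k Y where k: "strict_mono (k :: nat \<Rightarrow> nat)"
    and unif: "\<And>T. uniform_limit {0..T} (\<lambda>i. I (k i)) Y sequentially"
    using equi_lipschitz_convergent_subsequence[OF bndI lip] by blast
  have lim: "(\<lambda>i. I (k i) s) \<longlonglongrightarrow> Y s" if "0 \<le> s" for s
    by (rule tendsto_uniform_limitI[OF unif[of s]]) (use that in auto)
  have lipY: "\<exists>L. \<forall>s\<in>{0..T}. \<forall>s'\<in>{0..T}. norm (Y s' - Y s) \<le> L * \<bar>s' - s\<bar>" for T
  proof -
    obtain L where L: "\<And>i s s'. s\<in>{0..T} \<Longrightarrow> s'\<in>{0..T} \<Longrightarrow> norm (I i s' - I i s) \<le> L * \<bar>s' - s\<bar>"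
      using lip[of T] by blast
    have "norm (Y s' - Y s) \<le> L * \<bar>s' - s\<bar>" if "s \<in> {0..T}" "s' \<in> {0..T}" for s s'
    proof (rule LIMSEQ_le_const2)
      show "(\<lambda>i. norm (I (k i) s' - I (k i) s)) \<longlonglongrightarrow> norm (Y s' - Y s)"
        using that by (intro tendsto_intros lim) auto
    qed (intro exI allI impI L that)
    then show ?thesis by blast
  qed
  have k_ge: "k i \<ge> i" for i using k by (rule seq_suble)
  have \<alpha>k: "(\<lambda>i. \<alpha> (k i)) \<longlonglongrightarrow> 0" using LIMSEQ_subseq_LIMSEQ[OF \<alpha>(2) k] by (simp add: o_def)
  have "AE s in lborel. 0 \<le> s \<longrightarrow> (\<exists>v\<in>clarke_subdiff F (Y s). (Y has_vector_derivative - v) (at s within {0..}))"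
    using lipschitz_curve_AE_vector_derivative[OF lipY]
  proof eventually_elim
    case (elim s)
    show ?case
    proof
      assume s: "0 \<le> s"
      then obtain V where V: "(Y has_vector_derivative V) (at s)" using elim by blast
      have "((\<lambda>h. norm (Y (s + h) - Y s - h *\<^sub>R V) / norm h) \<longlongrightarrow> 0) (at 0)"
        using V by (simp add: has_vector_derivative_def has_derivative_at)
      moreover have "norm (Y (s + h) - Y s - h *\<^sub>R V) / norm h = norm ((Y (s + h) - Y s) /\<^sub>R h - V)"
        if "h \<noteq> 0" for h
      proof -
        have "(Y (s + h) - Y s) /\<^sub>R h - V = (Y (s + h) - Y s - h *\<^sub>R V) /\<^sub>R h"
          using that by (simp add: scaleR_diff_right)
        then show ?thesis by (simp add: divide_inverse)
      qed
      then have "\<forall>\<^sub>F h in at 0. norm (Y (s + h) - Y s - h *\<^sub>R V) / norm h = norm ((Y (s + h) - Y s) /\<^sub>R h - V)"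
        unfolding eventually_at_filter by (intro always_eventually) blast
      ultimately have "((\<lambda>h. norm ((Y (s + h) - Y s) /\<^sub>R h - V)) \<longlongrightarrow> 0) (at 0)"
        by (rule Lim_transform_eventually)
      then have "((\<lambda>h. (Y (s + h) - Y s) /\<^sub>R h) \<longlongrightarrow> V) (at 0)"
        by (rule LIM_zero_cancel[OF tendsto_norm_zero_cancel])
      then have "((\<lambda>h. (Y (s + h) - Y s) /\<^sub>R h) \<longlongrightarrow> V) (at_right 0)"
        by (rule tendsto_within_subset) auto
      then have "- V \<in> quad_superdiff c F (Y s)"
      proof (rule quad_superdiff_of_limit[rotated -1])
        show "\<alpha> (k i) > 0" for i by (rule \<alpha>)
        show "\<exists>L. \<forall>i t. \<alpha> (k i) * real t \<le> T \<longrightarrow> norm (y (k i) (Suc t) - y (k i) t) \<le> \<alpha> (k i) * L" for T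
          using incr[of T] by blast
        show "\<exists>R. \<forall>i t. \<alpha> (k i) * real t \<le> T \<longrightarrow> norm (y (k i) t) \<le> R" for T
          using bnd[of T] by blast
        show "\<exists>i0. \<forall>i\<ge>i0. \<forall>m. \<alpha> (k i) * real m \<le> T \<longrightarrow>
          norm (y (k i) m - y (k i) 0 + \<alpha> (k i) *\<^sub>R (\<Sum>t<m. g (y (k i) t))) \<le> e" if "e > 0" for T e
        proof -
          obtain i0 where "\<forall>i\<ge>i0. \<forall>m. \<alpha> i * real m \<le> T \<longrightarrow>
            norm (y i m - y i 0 + \<alpha> i *\<^sub>R (\<Sum>t<m. g (y i t))) \<le> e" using noise[OF \<open>e > 0\<close>, of T] by blast
          moreover have "i0 \<le> k i" if "i0 \<le> i" for i using that k_ge[of i] by linarith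
          ultimately show ?thesis by (intro exI[of _ i0]) simp
        qed
      qed (fact \<alpha>k unif[unfolded I_def] s)+
      then have "- V \<in> clarke_subdiff F (Y s)" by (intro quad_superdiff_subset_clarke dense)
      moreover have "(Y has_vector_derivative - (- V)) (at s within {0..})"
        using V by (simp add: has_vector_derivative_at_within)
      ultimately show "\<exists>v\<in>clarke_subdiff F (Y s). (Y has_vector_derivative - v) (at s within {0..})" by blast
    qed
  qed
  moreover have "Y 0 \<in> K"
    by (rule closed_sequentially[OF K(1) _ lim[OF order_refl]]) (simp add: I0 K(2))
  ultimately have "Y \<in> clarke_flow F K"
    using lipschitz_imp_C_abs[OF lipY] by (simp add: clarke_flow_def)
  then show thesis using that k unif by (simp add: I_def)
qed

end

section \<open>The metric on curves and uniform stability of the Clarke flow\<close>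

lemma norm_inf2_triangle: "norm_inf2 (u + v) \<le> norm_inf2 u + norm_inf2 v"
proof -
  have ge: "norm (w $ k) \<le> norm_inf2 w" for w :: "real ^ 'd ^ 'n" and k
    unfolding norm_inf2_def by (rule Max_ge) auto
  have "norm ((u + v) $ k) \<le> norm_inf2 u + norm_inf2 v" for k
    using norm_triangle_ineq[of "u $ k" "v $ k"] ge[of u k] ge[of v k] by simp
  then show ?thesis unfolding norm_inf2_def[of "u + v"] by (subst Max_le_iff) auto
qed

text \<open>Terms of the series that look at times up to \<open>N\<close> change by at most \<delta>
  and have total weight at most 1; the remaining weights sum to \<open>(1 / 2) ^ N\<close>, and
  their factors are truncated at 1.\<close>

lemma d_c_perturb:
  fixes X Y Y' :: "real \<Rightarrow> real ^ 'd ^ 'n"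
  assumes le: "\<And>s. s \<in> {0..real N} \<Longrightarrow> norm (X s - Y s) \<le> \<delta>" and \<delta>: "0 \<le> \<delta>"
    and cont: "\<And>T. continuous_on {0..T} X" "\<And>T. continuous_on {0..T} Y" "\<And>T. continuous_on {0..T} Y'"
  shows "d_c X Y' \<le> d_c Y Y' + \<delta> + (1 / 2) ^ N"
proof -
  let ?S = "\<lambda>Y k. SUP s\<in>{0..real (Suc k)}. norm_inf2 (Y s - Y' s)"
  let ?f = "\<lambda>Y k. (1 / 2 :: real) ^ Suc k * min 1 (?S Y k)"
  let ?h = "\<lambda>k. (1 / 2 :: real) ^ Suc k * (if k < N then \<delta> else 1)"
  have bdd: "bdd_above ((\<lambda>s. norm_inf2 (Y s - Y' s)) ` {0..real (Suc k)})"
    if "\<And>T. continuous_on {0..T} Y" for Y :: "real \<Rightarrow> real ^ 'd ^ 'n" and k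
  proof -
    have "compact ((\<lambda>s. Y s - Y' s) ` {0..real (Suc k)})"
      by (intro compact_continuous_image continuous_on_diff cont that compact_Icc)
    then obtain B where "\<forall>x\<in>(\<lambda>s. Y s - Y' s) ` {0..real (Suc k)}. norm x \<le> B"
      using compact_imp_bounded bounded_iff by metis
    then show ?thesis
      by (intro bdd_aboveI2[of _ _ B]) (meson image_eqI norm_inf2_le_norm order_trans)
  qed
  have nonneg: "0 \<le> ?S Y k" if "\<And>T. continuous_on {0..T} Y" for Y :: "real \<Rightarrow> real ^ 'd ^ 'n" and k
    by (rule cSUP_upper2[OF bdd[OF that], of 0]) (auto simp: norm_inf2_nonneg)
  have S_le: "?S X k \<le> ?S Y k + \<delta>" if "k < N" for k
  proof (rule cSUP_least)
    fix s assume s: "s \<in> {0..real (Suc k)}"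
    then have "s \<in> {0..real N}" using that by auto
    then have "norm_inf2 (X s - Y s) \<le> \<delta>" by (rule order_trans[OF norm_inf2_le_norm le])
    moreover have "norm_inf2 (Y s - Y' s) \<le> ?S Y k" by (rule cSUP_upper[OF s bdd[OF cont(2)]])
    ultimately show "norm_inf2 (X s - Y' s) \<le> ?S Y k + \<delta>"
      using norm_inf2_triangle[of "X s - Y s" "Y s - Y' s"] by simp
  qed auto
  have f_le: "?f X k \<le> ?f Y k + ?h k" for k
  proof -
    have "min 1 (?S X k) \<le> min 1 (?S Y k) + (if k < N then \<delta> else 1)"
      using S_le[of k] nonneg[OF cont(2), of k] \<delta> by (auto simp: min_def)
    then show ?thesis unfolding distrib_left[symmetric] by (intro mult_left_mono) auto
  qed
  have half: "(\<lambda>k. (1 / 2 :: real) ^ Suc k) sums 1" by (rule power_half_series)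
  have summ: "summable (?f Y)" if "\<And>T. continuous_on {0..T} Y" for Y :: "real \<Rightarrow> real ^ 'd ^ 'n"
    by (rule summable_comparison_test'[OF sums_summable[OF half], where N = 0])
       (use nonneg[OF that] in \<open>auto simp: abs_mult mult_left_le\<close>)
  have "summable ?h"
  proof (rule summable_comparison_test'[where N = 0])
    show "summable (\<lambda>k. (1 / 2 :: real) ^ Suc k * (\<delta> + 1))" by (intro summable_mult2 sums_summable[OF half])
    show "norm (?h k) \<le> (1 / 2) ^ Suc k * (\<delta> + 1)" for k
      using \<delta> by (auto intro!: mult_left_mono)
  qed
  have "(\<Sum>k. ?h k) = (\<Sum>k. ?h (k + N)) + (\<Sum>k<N. ?h k)"
    by (rule suminf_split_initial_segment[OF \<open>summable ?h\<close>])
  also have "(\<Sum>k. ?h (k + N)) = (\<Sum>k. (1 / 2) ^ N * (1 / 2) ^ Suc k)"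
    by (intro suminf_cong) (simp add: power_add)
  also have "\<dots> = (1 / 2) ^ N"
    using sums_unique[OF sums_mult[OF half, of "(1 / 2) ^ N"]] by simp
  also have "(\<Sum>k<N. ?h k) = (\<Sum>k<N. (1 / 2) ^ Suc k) * \<delta>" by (simp add: sum_distrib_right)
  also have "\<dots> \<le> 1 * \<delta>"
  proof (rule mult_right_mono[OF _ \<delta>])
    show "(\<Sum>k<N. (1 / 2 :: real) ^ Suc k) \<le> 1"
      using sum_le_suminf[OF sums_summable[OF half], of "{..<N}"] unfolding sums_unique[OF half, symmetric] by simp
  qed
  finally have h: "(\<Sum>k. ?h k) \<le> (1 / 2) ^ N + \<delta>" by simp
  have "d_c X Y' \<le> (\<Sum>k. ?f Y k + ?h k)"
    unfolding d_c_def by (intro suminf_le f_le summ cont summable_add \<open>summable ?h\<close>)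
  also have "\<dots> = d_c Y Y' + (\<Sum>k. ?h k)"
    unfolding d_c_def by (rule suminf_add[symmetric, OF summ[OF cont(2)] \<open>summable ?h\<close>])
  finally show ?thesis using h by linarith
qed

lemma d_c_le:
  fixes Y Y' :: "real \<Rightarrow> real ^ 'd ^ 'n"
  assumes le: "\<And>s. s \<in> {0..real N} \<Longrightarrow> norm (Y s - Y' s) \<le> \<delta>"
    and cont: "\<And>T. continuous_on {0..T} Y" "\<And>T. continuous_on {0..T} Y'"
  shows "d_c Y Y' \<le> \<delta> + (1 / 2) ^ N"
proof -
  have "0 \<le> \<delta>" by (rule order_trans[OF norm_ge_zero le[of 0]]) simp
  moreover have "d_c Y' Y' = 0" by (simp add: d_c_def norm_inf2_def)
  ultimately show ?thesis using d_c_perturb[OF le _ cont cont(2)] by simp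
qed

text \<open>Discrete Gronwall inequality: \<open>1 + norm y\<close> grows per step by a factor of at
  most \<open>1 + \<alpha> * B \<le> exp (\<alpha> * B)\<close>. The bound thus depends on the
  elapsed time \<open>\<alpha> * t\<close> and not on the number of steps.\<close>

lemma linear_growth_bound:
  fixes y :: "nat \<Rightarrow> 'a::real_normed_vector"
  assumes "0 \<le> \<alpha>" "0 \<le> B" and incr: "\<And>t. norm (y (Suc t) - y t) \<le> \<alpha> * (B * (1 + norm (y t)))"
  shows "1 + norm (y t) \<le> exp (B * (\<alpha> * real t)) * (1 + norm (y 0))"
proof (induction t)
  case (Suc t)
  have "1 + norm (y (Suc t)) \<le> (1 + \<alpha> * B) * (1 + norm (y t))"
    using incr[of t] norm_triangle_sub[of "y (Suc t)" "y t"] by (simp add: algebra_simps)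
  also have "\<dots> \<le> exp (\<alpha> * B) * (exp (B * (\<alpha> * real t)) * (1 + norm (y 0)))"
    using assms Suc by (intro mult_mono exp_ge_add_one_self) auto
  also have "\<dots> = exp (B * (\<alpha> * real (Suc t))) * (1 + norm (y 0))"
    by (simp add: exp_add[symmetric] algebra_simps)
  finally show ?case .
qed simp

lemma continuous_on_interpolate:
  fixes y :: "nat \<Rightarrow> 'a::real_normed_vector"
  assumes \<alpha>: "\<alpha> > 0"
  shows "continuous_on {0..T} (interpolate \<alpha> y)"
proof -
  define L where "L = Max ((\<lambda>t. norm (y (Suc t) - y t)) ` {..nat \<lceil>T / \<alpha>\<rceil>}) / \<alpha>"
  have L: "norm (y (Suc t) - y t) \<le> \<alpha> * L" if "\<alpha> * real t \<le> T" for t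
  proof -
    have "real t \<le> T / \<alpha>" using that \<alpha> by (simp add: field_simps)
    then have "t \<le> nat \<lceil>T / \<alpha>\<rceil>" by linarith
    then have "norm (y (Suc t) - y t) \<le> Max ((\<lambda>t. norm (y (Suc t) - y t)) ` {..nat \<lceil>T / \<alpha>\<rceil>})"
      by (intro Max_ge) auto
    then show ?thesis using \<alpha> by (simp add: L_def)
  qed
  have "(\<bar>L\<bar>)-lipschitz_on {0..T} (interpolate \<alpha> y)"
  proof (rule lipschitz_onI)
    fix a b assume ab: "a \<in> {0..T}" "b \<in> {0..T}"
    have "norm (interpolate \<alpha> y a - interpolate \<alpha> y b) \<le> L * \<bar>a - b\<bar>"
      by (rule interpolate_lipschitz_abs[OF \<alpha> _ ab(2,1)]) (rule L)
    also have "\<dots> \<le> \<bar>L\<bar> * \<bar>a - b\<bar>" by (intro mult_right_mono) auto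
    finally show "dist (interpolate \<alpha> y a) (interpolate \<alpha> y b) \<le> \<bar>L\<bar> * dist a b"
      by (simp add: dist_norm)
  qed auto
  then show ?thesis by (rule lipschitz_on_continuous_on)
qed

lemma C_abs_continuous_on: "Y \<in> C_abs \<Longrightarrow> continuous_on {0..T} Y"
  by (cases "T \<ge> 0") (auto simp: C_abs_def intro: abs_continuous_on_imp_continuous_on)

text \<open>If no constants worked, the choices \<open>T = i + 1\<close> and \<delta> = \<alpha>1 =
  \<open>1 / (i + 1)\<close> would all fail. The resulting counterexamples have vanishing steps and
  vanishing noise, so a subsequence converges locally uniformly to a curve of the flow,
  contradicting their distance from it. The constants precede the trajectory \<open>y\<close>, which
  is what allows a pathwise application to every random outcome.\<close>

theorem clarke_flow_stability:
  fixes F :: "real ^ 'd ^ 'n \<Rightarrow> real"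
  assumes sc: "semiconcave F g c A"
    and dense: "\<And>U. open U \<Longrightarrow> U \<noteq> {} \<Longrightarrow> \<exists>Y\<in>U. isCont g Y"
    and K: "compact K" and B: "0 \<le> B" and \<epsilon>: "\<epsilon> > 0"
  obtains T \<delta> \<alpha>1 where "0 < T" "0 < \<delta>" "0 < \<alpha>1"
    "\<And>\<alpha> y. 0 < \<alpha> \<Longrightarrow> \<alpha> < \<alpha>1 \<Longrightarrow> y 0 \<in> K \<Longrightarrow>
      (\<And>t. norm (y (Suc t) - y t) \<le> \<alpha> * (B * (1 + norm (y t)))) \<Longrightarrow>
      (\<And>m. \<alpha> * real m \<le> T \<Longrightarrow> norm (y m - y 0 + \<alpha> *\<^sub>R (\<Sum>t<m. g (y t))) \<le> \<delta>) \<Longrightarrow>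
      d_c_set (interpolate \<alpha> y) (clarke_flow F K) \<le> ereal \<epsilon>"
proof (rule ccontr)
  interpret semiconcave F g c A by (rule sc)
  assume contra: "\<not> thesis"
  have "\<exists>\<alpha> y. 0 < \<alpha> \<and> \<alpha> < inverse (real (Suc i)) \<and> y 0 \<in> K \<and>
      (\<forall>t. norm (y (Suc t) - y t) \<le> \<alpha> * (B * (1 + norm (y t)))) \<and>
      (\<forall>m. \<alpha> * real m \<le> real (Suc i) \<longrightarrow> norm (y m - y 0 + \<alpha> *\<^sub>R (\<Sum>t<m. g (y t))) \<le> inverse (real (Suc i))) \<and>
      \<not> d_c_set (interpolate \<alpha> y) (clarke_flow F K) \<le> ereal \<epsilon>" for i
  proof (rule ccontr)
    assume "\<not> ?thesis"
    then show False
      using contra that[of "real (Suc i)" "inverse (real (Suc i))" "inverse (real (Suc i))"]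
      by (simp del: of_nat_Suc) blast
  qed
  then obtain \<alpha> y where *: "\<And>i. 0 < \<alpha> i" "\<And>i. \<alpha> i < inverse (real (Suc i))" "\<And>i. y i 0 \<in> K"
    "\<And>i t. norm (y i (Suc t) - y i t) \<le> \<alpha> i * (B * (1 + norm (y i t)))"
    "\<And>i m. \<alpha> i * real m \<le> real (Suc i) \<Longrightarrow> norm (y i m - y i 0 + \<alpha> i *\<^sub>R (\<Sum>t<m. g (y i t))) \<le> inverse (real (Suc i))"
    "\<And>i. \<not> d_c_set (interpolate (\<alpha> i) (y i)) (clarke_flow F K) \<le> ereal \<epsilon>"
    by metis
  have \<alpha>0: "\<alpha> \<longlonglongrightarrow> 0"
    by (rule Lim_null_comparison[OF _ LIMSEQ_inverse_real_of_nat])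
      (use *(1,2) in \<open>auto intro!: always_eventually simp: less_imp_le\<close>)
  obtain RK where RK: "\<And>x. x \<in> K \<Longrightarrow> norm x \<le> RK"
    using compact_imp_bounded[OF K] bounded_iff by metis
  have growth_y: "1 + norm (y i t) \<le> exp (B * \<bar>T\<bar>) * (1 + RK)" if "\<alpha> i * real t \<le> T" for i t T
  proof -
    have "1 + norm (y i t) \<le> exp (B * (\<alpha> i * real t)) * (1 + norm (y i 0))"
      by (rule linear_growth_bound[where y = "y i" and \<alpha> = "\<alpha> i", OF less_imp_le[OF *(1)] B *(4)])
    also have "\<dots> \<le> exp (B * \<bar>T\<bar>) * (1 + RK)"
      using that RK[OF *(3)[of i]] B by (intro mult_mono) (auto intro!: mult_left_mono)
    finally show ?thesis .
  qed
  obtain k Y where k: "strict_mono (k :: nat \<Rightarrow> nat)" and Y: "Y \<in> clarke_flow F K"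
    and unif: "\<And>T. uniform_limit {0..T} (\<lambda>i. interpolate (\<alpha> (k i)) (y (k i))) Y sequentially"
  proof (rule clarke_flow_limit[OF dense *(1) \<alpha>0])
    show "\<exists>L. \<forall>i t. \<alpha> i * real t \<le> T \<longrightarrow> norm (y i (Suc t) - y i t) \<le> \<alpha> i * L" for T
    proof (intro exI allI impI)
      fix i t assume t: "\<alpha> i * real t \<le> T"
      have "B * (1 + norm (y i t)) \<le> B * (exp (B * \<bar>T\<bar>) * (1 + RK))"
        by (rule mult_left_mono[OF growth_y[OF t] B])
      then show "norm (y i (Suc t) - y i t) \<le> \<alpha> i * (B * (exp (B * \<bar>T\<bar>) * (1 + RK)))"
        using *(4)[of i t] *(1)[of i] by (meson less_imp_le mult_left_mono order_trans)
    qed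
    show "\<exists>R. \<forall>i t. \<alpha> i * real t \<le> T \<longrightarrow> norm (y i t) \<le> R" for T
    proof (intro exI allI impI)
      fix i t assume "\<alpha> i * real t \<le> T"
      from growth_y[OF this] show "norm (y i t) \<le> exp (B * \<bar>T\<bar>) * (1 + RK)" by simp
    qed
    show "\<exists>i0. \<forall>i\<ge>i0. \<forall>m. \<alpha> i * real m \<le> T \<longrightarrow>
          norm (y i m - y i 0 + \<alpha> i *\<^sub>R (\<Sum>t<m. g (y i t))) \<le> e" if "e > 0" for T e
    proof -
      obtain i0 where i0: "inverse (real (Suc i0)) < e" using reals_Archimedean[OF \<open>e > 0\<close>] by blast
      obtain i1 :: nat where i1: "T < real i1" using reals_Archimedean2 by blast
      show ?thesis
      proof (intro exI[of _ "max i0 i1"] allI impI)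
        fix i m assume i: "max i0 i1 \<le> i" and m: "\<alpha> i * real m \<le> T"
        have "\<alpha> i * real m \<le> real (Suc i)" using i i1 m by (simp add: max_def split: if_splits)
        from *(5)[OF this] have "norm (y i m - y i 0 + \<alpha> i *\<^sub>R (\<Sum>t<m. g (y i t))) \<le> inverse (real (Suc i))" .
        also have "\<dots> \<le> inverse (real (Suc i0))" using i by (intro le_imp_inverse_le) auto
        finally show "norm (y i m - y i 0 + \<alpha> i *\<^sub>R (\<Sum>t<m. g (y i t))) \<le> e" using i0 by simp
      qed
    qed
    show "closed K" using K by (rule compact_imp_closed)
    show "y i 0 \<in> K" for i by (rule *(3))
  qed auto
  \<comment> \<open>Half of \<epsilon> is spent on the tail of the metric beyond time
    \<open>N\<close>, the other half on uniform closeness before \<open>N\<close>.\<close>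
  obtain N where N: "(1 / 2 :: real) ^ N < \<epsilon> / 2"
    using real_arch_pow_inv[of "\<epsilon> / 2" "1 / 2"] \<epsilon> by auto
  have "\<forall>\<^sub>F i in sequentially. \<forall>s\<in>{0..real N}. dist (interpolate (\<alpha> (k i)) (y (k i)) s) (Y s) < \<epsilon> / 2"
    by (rule uniform_limitD[OF unif half_gt_zero[OF \<epsilon>]])
  then obtain i where i: "\<And>s. s \<in> {0..real N} \<Longrightarrow> dist (interpolate (\<alpha> (k i)) (y (k i)) s) (Y s) < \<epsilon> / 2"
    using eventually_happens'[OF sequentially_bot] by blast
  have "d_c (interpolate (\<alpha> (k i)) (y (k i))) Y \<le> \<epsilon> / 2 + (1 / 2) ^ N"
    using i Y by (intro d_c_le continuous_on_interpolate *(1) C_abs_continuous_on)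
      (auto simp: dist_norm clarke_flow_def less_imp_le)
  then have "d_c (interpolate (\<alpha> (k i)) (y (k i))) Y \<le> \<epsilon>" using N by linarith
  then have "d_c_set (interpolate (\<alpha> (k i)) (y (k i))) (clarke_flow F K) \<le> ereal \<epsilon>"
    unfolding d_c_set_def by (intro INF_lower2[OF Y]) simp
  with *(6) show False by blast
qed

section \<open>Sorting permutations\<close>

text \<open>A counting argument: if \<open>f (p k) < f (q k)\<close>, the values not exceeding
  \<open>f (p k)\<close> include those that \<open>p\<close> lists at all positions up to
  \<open>k\<close>, but \<open>q\<close> lists them all strictly before \<open>k\<close>, and there
  are fewer such positions. Ties make the permutation ambiguous, never the sorted values.\<close>

lemma sorted_rearrangement_unique:
  fixes f :: "'i::{finite,linorder} \<Rightarrow> 'a::linorder" and p q :: "'i \<Rightarrow> 'i"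
  assumes "bij p" "bij q" "mono (\<lambda>k. f (p k))" "mono (\<lambda>k. f (q k))"
  shows "f (p k) = f (q k)"
proof -
  have "f (q k) \<le> f (p k)" if pq: "bij p" "bij q" "mono (\<lambda>k. f (p k))" "mono (\<lambda>k. f (q k))" for p q :: "'i \<Rightarrow> 'i"
  proof (rule ccontr)
    assume less: "\<not> f (q k) \<le> f (p k)"
    have "p ` {..k} \<subseteq> {j. f j \<le> f (p k)}" using monoD[OF pq(3)] by auto
    moreover have "{j. f j \<le> f (p k)} \<subseteq> q ` {..<k}"
    proof
      fix j assume j: "j \<in> {j. f j \<le> f (p k)}"
      obtain i where i: "j = q i" using pq(2) by (metis bij_pointE)
      have "i < k"
      proof (rule ccontr)
        assume "\<not> i < k"
        then have "f (q k) \<le> f (q i)" using monoD[OF pq(4), of k i] by simp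
        then show False using j i less by auto
      qed
      then show "j \<in> q ` {..<k}" using i by auto
    qed
    ultimately have "card (p ` {..k}) \<le> card (q ` {..<k})" by (intro card_mono) auto
    moreover have "card (p ` {..k}) = card {..k}" "card (q ` {..<k}) = card {..<k}"
      using pq(1,2) by (auto intro!: card_image simp: bij_def intro: inj_on_subset)
    moreover have "card {..<k} < card {..k}" by (intro psubset_card_mono) auto
    ultimately show False by simp
  qed
  from this[OF assms] this[OF assms(2,1,4,3)] show ?thesis by (rule order_antisym[rotated])
qed

lemma sorting_permutation_exists:
  fixes f :: "'i::{finite,linorder} \<Rightarrow> 'a::linorder"
  shows "\<exists>p :: 'i \<Rightarrow> 'i. bij p \<and> mono (\<lambda>k. f (p k))"
proof -
  define xs where "xs = sort_key f (sorted_list_of_set (UNIV :: 'i set))"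
  \<comment> \<open>The rank of an index, by which list positions are transported to the ordered
    index type.\<close>
  define r where "r k = card {..<k}" for k :: 'i
  have len: "length xs = card (UNIV :: 'i set)" by (simp add: xs_def)
  have xs: "distinct xs" "set xs = UNIV" "sorted (map f xs)" by (simp_all add: xs_def)
  have r_less: "r k < length xs" for k
    unfolding r_def len by (intro psubset_card_mono) auto
  have r_mono: "r j \<le> r k" if "j \<le> k" for j k
    unfolding r_def using that by (intro card_mono) auto
  have "r j < r k" if "j < k" for j k
    unfolding r_def using that by (intro psubset_card_mono) auto
  then have "inj r" by (intro linorder_injI) (simp add: less_imp_neq)
  have "inj (\<lambda>k. xs ! r k)"
    using \<open>inj r\<close> by (intro injI) (simp add: nth_eq_iff_index_eq[OF xs(1) r_less r_less] inj_eq)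
  then have "bij (\<lambda>k. xs ! r k)" by (simp add: bij_def finite_UNIV_inj_surj)
  moreover have "mono (\<lambda>k. f (xs ! r k))"
  proof (rule monoI)
    fix j k :: 'i assume "j \<le> k"
    then show "f (xs ! r j) \<le> f (xs ! r k)"
      using sorted_nth_mono[OF xs(3), of "r j" "r k"] r_mono r_less by simp
  qed
  ultimately show ?thesis by blast
qed

section \<open>Optimal transport on the line\<close>

text \<open>Discrete dual potentials: convexity of \<open>P\<close> along the sorted points \<open>a\<close> with slopes \<open>b\<close>.\<close>

lemma sorted_potential_exists:
  fixes a b :: "'i::{finite,linorder} \<Rightarrow> real"
  assumes "mono a" "mono b"
  shows "\<exists>P. \<forall>i k. P k + b k * (a i - a k) \<le> P i"
proof -
  have "\<exists>P. \<forall>i\<in>A. \<forall>k\<in>A. P k + b k * (a i - a k) \<le> P i" if "finite A" for A :: "'i set"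
    using that
  proof (induction A rule: finite_linorder_max_induct)
    case (insert m A)
    then obtain P where P: "\<And>i k. i \<in> A \<Longrightarrow> k \<in> A \<Longrightarrow> P k + b k * (a i - a k) \<le> P i" by blast
    show ?case
    proof (cases "A = {}")
      case False
      \<comment> \<open>The least value that the existing tangent lines allow at the new largest
        index. The maximum is attained at some \<open>k0\<close>, and since the slope
        \<open>b m\<close> is at least \<open>b k0\<close>, the new tangent line stays below the
        earlier values.\<close>
      define v where "v = Max ((\<lambda>k. P k + b k * (a m - a k)) ` A)"
      have v_ge: "P k + b k * (a m - a k) \<le> v" if "k \<in> A" for k
        unfolding v_def using insert.hyps that by (intro Max_ge) auto
      have "v \<in> (\<lambda>k. P k + b k * (a m - a k)) ` A"
        unfolding v_def using insert.hyps False by (intro Max_in) auto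
      then obtain k0 where k0: "k0 \<in> A" "v = P k0 + b k0 * (a m - a k0)" by blast
      have last: "v + b m * (a i - a m) \<le> P i" if i: "i \<in> A" for i
      proof -
        have "i < m" "k0 < m" using insert.hyps i k0 by auto
        then have "b m * (a i - a m) \<le> b k0 * (a i - a m)"
          using monoD[OF assms(1), of i m] monoD[OF assms(2), of k0 m] by (intro mult_right_mono_neg) auto
        then have "v + b m * (a i - a m) \<le> P k0 + b k0 * (a i - a k0)"
          using k0 by (simp add: algebra_simps)
        also have "\<dots> \<le> P i" by (rule P[OF i k0(1)])
        finally show ?thesis .
      qed
      have "m \<notin> A" using insert.hyps by auto
      then show ?thesis
        using P v_ge last by (intro exI[of _ "P(m := v)"]) auto
    qed auto
  qed auto
  from this[of UNIV] show ?thesis by simp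
qed

text \<open>The easy half of Kantorovich duality. From
  \<open>x * y \<le> \<phi> x + \<psi> y\<close>, with equality at the sorted pairs, the cost is at
  least \<open>(x * x - 2 * \<phi> x) + (y * y - 2 * \<psi> y)\<close>, whose integral depends on
  the marginals alone and equals the sorted cost.\<close>

lemma couplings_cost_sorted:
  fixes a b :: "'i::{finite,linorder} \<Rightarrow> real" and p q :: "'i \<Rightarrow> 'i"
  assumes "mono (\<lambda>k. a (p k))" "mono (\<lambda>k. b (q k))" and p: "bij p" and q: "bij q"
    and \<pi>: "\<pi> \<in> couplings (empirical_measure UNIV a) (empirical_measure UNIV b)"
  shows "ennreal ((\<Sum>k\<in>UNIV. (a (p k) - b (q k))\<^sup>2) / real CARD('i)) \<le> (\<integral>\<^sup>+ (x, y). ennreal ((dist x y)\<^sup>2) \<partial>\<pi>)"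
proof -
  obtain P where P: "\<And>i k. P k + b (q k) * (a (p i) - a (p k)) \<le> P i"
    using sorted_potential_exists[OF assms(1,2)] by blast
  \<comment> \<open>The convex envelope of the tangent lines through the discrete potential, and the
    Legendre transform of that potential over the sorted points. Taking finite maxima makes both
    measurable on the whole line.\<close>
  define \<phi> where "\<phi> x = (MAX k\<in>UNIV. P k + b (q k) * (x - a (p k)))" for x
  define \<psi> where "\<psi> y = (MAX i\<in>UNIV. a (p i) * y - P i)" for y
  have [measurable]: "\<phi> \<in> borel_measurable borel" "\<psi> \<in> borel_measurable borel"
    unfolding \<phi>_def \<psi>_def by (auto intro!: borel_measurable_Max)
  have \<phi>: "\<phi> (a (p i)) = P i" for i
    unfolding \<phi>_def using P[of _ i] by (intro Max_eqI) (auto intro!: image_eqI[of _ _ i])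
  have \<psi>: "\<psi> (b (q k)) = a (p k) * b (q k) - P k" for k
    unfolding \<psi>_def
  proof (intro Max_eqI)
    fix y assume "y \<in> range (\<lambda>i. a (p i) * b (q k) - P i)"
    then obtain i where "y = a (p i) * b (q k) - P i" by blast
    then show "y \<le> a (p k) * b (q k) - P k" using P[of k i] by (simp add: algebra_simps)
  qed auto
  have young: "x * y \<le> \<phi> x + \<psi> y" if "x \<in> range a" for x y
  proof -
    obtain i where i: "x = a (p i)" using \<open>x \<in> range a\<close> p by (metis bij_pointE imageE)
    have "a (p i) * y - P i \<le> \<psi> y" unfolding \<psi>_def by (intro Max_ge) auto
    then show ?thesis by (simp add: i \<phi>)
  qed
  have sets\<pi>[simp, measurable_cong]: "sets \<pi> = sets (borel \<Otimes>\<^sub>M borel)"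
    and fst\<pi>: "distr \<pi> borel fst = distr (uniform_count_measure UNIV) borel a"
    and snd\<pi>: "distr \<pi> borel snd = distr (uniform_count_measure UNIV) borel b"
    using \<pi> by (auto simp: couplings_def empirical_measure_def)
  have marginal: "integrable \<pi> (\<lambda>z. f (pr z)) \<and> (\<integral>z. f (pr z) \<partial>\<pi>) = (\<Sum>k\<in>UNIV. f (c k)) / real CARD('i)"
    if pr: "distr \<pi> borel pr = distr (uniform_count_measure UNIV) borel c"
      and [measurable]: "pr \<in> borel_measurable \<pi>" "f \<in> borel_measurable borel"
    for f :: "real \<Rightarrow> real" and pr and c :: "'i \<Rightarrow> real"
  proof -
    have "integrable (distr \<pi> borel pr) f" unfolding pr
      by (subst integrable_distr_eq) (auto simp: uniform_count_measure_def integrable_point_measure_finite)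
    moreover have "(\<integral>x. f x \<partial>distr \<pi> borel pr) = (\<Sum>k\<in>UNIV. f (c k)) / real CARD('i)" unfolding pr
      by (subst integral_distr) (auto simp: integral_uniform_count_measure)
    ultimately show ?thesis by (subst (asm) integrable_distr_eq; subst (asm) integral_distr) auto
  qed
  note fst_int = marginal[OF fst\<pi>] and snd_int = marginal[OF snd\<pi>]
  have "AE x in distr \<pi> borel fst. x \<in> range a"
    unfolding fst\<pi> by (subst AE_distr_iff) (auto intro!: finite_imp_closed borel_closed)
  then have AE: "AE z in \<pi>. fst z \<in> range a"
    by (subst (asm) AE_distr_iff) (auto intro!: finite_imp_closed borel_closed)
  let ?f = "\<lambda>x. x\<^sup>2 - 2 * \<phi> x" and ?g = "\<lambda>y. y\<^sup>2 - 2 * \<psi> y"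
  have perm: "(\<Sum>k\<in>UNIV. h (r k)) = (\<Sum>k\<in>UNIV. h k)" if "bij r" for r :: "'i \<Rightarrow> 'i" and h :: "'i \<Rightarrow> real"
    using sum.reindex_bij_betw[of r UNIV UNIV h] that by simp
  have "(\<Sum>k\<in>UNIV. (a (p k) - b (q k))\<^sup>2) = (\<Sum>k\<in>UNIV. ?f (a (p k)) + ?g (b (q k)))"
    by (intro sum.cong refl) (simp add: \<phi> \<psi> power2_eq_square algebra_simps)
  also have "\<dots> = (\<Sum>k\<in>UNIV. ?f (a k)) + (\<Sum>k\<in>UNIV. ?g (b k))"
    using perm[OF p, of "\<lambda>k. ?f (a k)"] perm[OF q, of "\<lambda>k. ?g (b k)"] by (simp add: sum.distrib)
  finally have "(\<Sum>k\<in>UNIV. (a (p k) - b (q k))\<^sup>2) / real CARD('i) = (\<integral>z. ?f (fst z) + ?g (snd z) \<partial>\<pi>)"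
    using fst_int[of ?f] snd_int[of ?g] by (subst Bochner_Integration.integral_add) (auto simp: add_divide_distrib)
  \<comment> \<open>The dual integrand can be negative; \<open>ennreal\<close> drops its negative
    part, hence an inequality.\<close>
  also have "ennreal \<dots> \<le> (\<integral>\<^sup>+z. ennreal (?f (fst z) + ?g (snd z)) \<partial>\<pi>)"
  proof -
    have "integrable \<pi> (\<lambda>z. ?f (fst z) + ?g (snd z))"
      using fst_int[of ?f] snd_int[of ?g] by (intro Bochner_Integration.integrable_add) auto
    then show ?thesis
      by (cases "\<integral>\<^sup>+z. ennreal (?f (fst z) + ?g (snd z)) \<partial>\<pi>")
        (auto simp: real_lebesgue_integral_def intro!: ennreal_leI)
  qed
  also have "\<dots> \<le> (\<integral>\<^sup>+z. (case z of (x, y) \<Rightarrow> ennreal ((dist x y)\<^sup>2)) \<partial>\<pi>)"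
  proof (rule nn_integral_mono_AE, use AE in eventually_elim)
    fix z :: "real \<times> real" assume "fst z \<in> range a"
    from young[OF this, of "snd z"]
    show "ennreal (?f (fst z) + ?g (snd z)) \<le> (case z of (x, y) \<Rightarrow> ennreal ((dist x y)\<^sup>2))"
      by (auto simp: case_prod_unfold dist_real_def power2_eq_square algebra_simps intro!: ennreal_leI)
  qed
  finally show ?thesis .
qed

lemma empirical_measure_permute:
  assumes r: "bij (r :: 'i::finite \<Rightarrow> 'i)"
  shows "empirical_measure UNIV (\<lambda>k. b (r k)) = empirical_measure UNIV b"
  unfolding empirical_measure_def
proof (rule measure_eqI)
  fix X assume "X \<in> sets (distr (uniform_count_measure UNIV) borel (\<lambda>k. b (r k)))"
  moreover have "card ((\<lambda>k. b (r k)) -` X) = card (b -` X)"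
  proof -
    have "(\<lambda>k. b (r k)) -` X = r -` (b -` X)" by auto
    then show ?thesis using r by (simp add: card_vimage_inj bij_def)
  qed
  ultimately show "emeasure (distr (uniform_count_measure UNIV) borel (\<lambda>k. b (r k))) X =
      emeasure (distr (uniform_count_measure UNIV) borel b) X"
    by (simp add: emeasure_distr emeasure_uniform_count_measure)
qed simp

lemma permutation_coupling:
  fixes a b :: "'i::finite \<Rightarrow> real" and p q :: "'i \<Rightarrow> 'i"
  assumes p: "bij p" and q: "bij q"
  obtains \<pi> where "\<pi> \<in> couplings (empirical_measure UNIV a) (empirical_measure UNIV b)"
    "(\<integral>\<^sup>+ (x, y). ennreal ((dist x y)\<^sup>2) \<partial>\<pi>) =
       ennreal ((\<Sum>k\<in>UNIV. (a (p k) - b (q k))\<^sup>2) / real CARD('i))"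
proof
  let ?\<pi> = "distr (uniform_count_measure UNIV) (borel \<Otimes>\<^sub>M borel) (\<lambda>k. (a (p k), b (q k)))"
  show "?\<pi> \<in> couplings (empirical_measure UNIV a) (empirical_measure UNIV b)"
    using empirical_measure_permute[OF p, of a] empirical_measure_permute[OF q, of b]
    unfolding couplings_def empirical_measure_def by (auto simp: distr_distr comp_def)
  have "(\<integral>\<^sup>+ (x, y). ennreal ((dist x y)\<^sup>2) \<partial>?\<pi>) =
      (\<Sum>k\<in>UNIV. ennreal ((a (p k) - b (q k))\<^sup>2) * ennreal (1 / real CARD('i)))"
    by (subst nn_integral_distr)
      (auto simp: uniform_count_measure_def nn_integral_point_measure_finite dist_real_def mult.commute
        space_pair_measure)
  also have "\<dots> = ennreal ((\<Sum>k\<in>UNIV. (a (p k) - b (q k))\<^sup>2) / real CARD('i))"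
    by (simp add: sum_divide_distrib ennreal_mult[symmetric])
  finally show "(\<integral>\<^sup>+ (x, y). ennreal ((dist x y)\<^sup>2) \<partial>?\<pi>) = \<dots>" .
qed

text \<open>Valid for every pairing, sorted or not. This one-sided bound is what allows a matching
  that is optimal for one matrix to be tested at another.\<close>

lemma W2_le_permutation:
  fixes a b :: "'i::finite \<Rightarrow> real" and q :: "'i \<Rightarrow> 'i"
  assumes q: "bij q"
  shows "(W2 (empirical_measure UNIV a) (empirical_measure UNIV b))\<^sup>2 \<le>
    (\<Sum>k\<in>UNIV. (a k - b (q k))\<^sup>2) / real CARD('i)"
proof -
  let ?C = "\<lambda>\<pi>. \<integral>\<^sup>+ (x, y). ennreal ((dist x y)\<^sup>2) \<partial>\<pi>"
  obtain \<pi> where \<pi>: "\<pi> \<in> couplings (empirical_measure UNIV a) (empirical_measure UNIV b)"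
      "?C \<pi> = ennreal ((\<Sum>k\<in>UNIV. (a k - b (q k))\<^sup>2) / real CARD('i))"
    by (rule permutation_coupling[OF bij_id q, of a b, unfolded id_apply]) blast
  have "(INF \<pi>\<in>couplings (empirical_measure UNIV a) (empirical_measure UNIV b). ?C \<pi>)
      \<le> ennreal ((\<Sum>k\<in>UNIV. (a k - b (q k))\<^sup>2) / real CARD('i))"
    unfolding \<pi>(2)[symmetric] by (rule INF_lower[OF \<pi>(1)])
  then show ?thesis by (simp add: W2_def enn2real_leI sum_nonneg)
qed

lemma W2_sorted:
  fixes a b :: "'i::{finite,linorder} \<Rightarrow> real" and p q :: "'i \<Rightarrow> 'i"
  assumes a: "mono (\<lambda>k. a (p k))" and b: "mono (\<lambda>k. b (q k))" and p: "bij p" and q: "bij q"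
  shows "(W2 (empirical_measure UNIV a) (empirical_measure UNIV b))\<^sup>2 =
    (\<Sum>k\<in>UNIV. (a (p k) - b (q k))\<^sup>2) / real CARD('i)" (is "_ = ?S")
proof -
  let ?C = "\<lambda>\<pi>. \<integral>\<^sup>+ (x, y). ennreal ((dist x y)\<^sup>2) \<partial>\<pi>"
  obtain \<pi> where \<pi>: "\<pi> \<in> couplings (empirical_measure UNIV a) (empirical_measure UNIV b)"
    "?C \<pi> = ennreal ?S" by (rule permutation_coupling[OF p q])
  then have "(INF \<pi>\<in>couplings (empirical_measure UNIV a) (empirical_measure UNIV b). ?C \<pi>) = ennreal ?S"
    using couplings_cost_sorted[OF a b p q] by (intro antisym INF_lower2[OF \<pi>(1)] INF_greatest) auto
  then show ?thesis by (simp add: W2_def sum_nonneg)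
qed

section \<open>The sliced energy\<close>

lemma empirical_measure_slice:
  fixes Y :: "real ^ 'd ^ 'n"
  shows "distr (empirical_measure UNIV (\<lambda>k. Y $ k)) borel (\<lambda>x. \<theta> \<bullet> x) = empirical_measure UNIV (\<lambda>k. \<theta> \<bullet> Y $ k)"
  unfolding empirical_measure_def by (subst distr_distr) (auto simp: comp_def)

lemma w_slice_sorted:
  fixes Y Z :: "real ^ 'd ^ 'n::{finite,linorder}"
  assumes "sorts_along \<theta> Y p" "sorts_along \<theta> Z q"
  shows "w_slice Z \<theta> Y = (\<Sum>k\<in>UNIV. (\<theta> \<bullet> Y $ p k - \<theta> \<bullet> Z $ q k)\<^sup>2) / real CARD('n)"
  using assms W2_sorted[of "\<lambda>k. \<theta> \<bullet> Y $ k" p "\<lambda>k. \<theta> \<bullet> Z $ k" q]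
  by (simp add: w_slice_def empirical_measure_slice sorts_along_def)

lemma w_slice_le_permutation:
  fixes Y Z :: "real ^ 'd ^ 'n::{finite,linorder}"
  assumes "bij q"
  shows "w_slice Z \<theta> Y \<le> (\<Sum>k\<in>UNIV. (\<theta> \<bullet> Y $ k - \<theta> \<bullet> Z $ q k)\<^sup>2) / real CARD('n)"
  using W2_le_permutation[OF assms, of "\<lambda>k. \<theta> \<bullet> Y $ k" "\<lambda>k. \<theta> \<bullet> Z $ k"]
  by (simp add: w_slice_def empirical_measure_slice)

text \<open>The matching that is optimal at \<open>Y\<close> is merely admissible at
  \<open>X\<close>. Freezing it gives a quadratic upper bound for the slice energy that is exact at
  \<open>Y\<close> and whose linear part is \<open>sgd_grad\<close>. The remainder has constant
  \<open>1 / n\<close> because projecting a row on a unit vector does not increase its norm.\<close>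

lemma sgd_grad_quad_superdiff:
  fixes Y Z :: "real ^ 'd ^ 'n::{finite,linorder}"
  assumes \<theta>: "norm \<theta> = 1" and Y: "sorts_along \<theta> Y (\<tau> \<theta> Y)" and Z: "sorts_along \<theta> Z (\<tau> \<theta> Z)"
  shows "sgd_grad \<tau> Z Y \<theta> \<in> quad_superdiff (1 / real CARD('n)) (w_slice Z \<theta>) Y"
  unfolding quad_superdiff_def
proof (intro CollectI allI)
  fix X :: "real ^ 'd ^ 'n::{finite,linorder}"
  define p where "p = \<tau> \<theta> Y"
  define q where "q = \<tau> \<theta> Z \<circ> inv p"
  let ?n = "real CARD('n)"
  have p: "bij p" and q: "bij q"
    using Y Z by (auto simp: sorts_along_def p_def q_def intro!: bij_comp bij_imp_bij_inv)
  define u where "u k = \<theta> \<bullet> Y $ k - \<theta> \<bullet> Z $ q k" for k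
  define v where "v k = \<theta> \<bullet> (X $ k - Y $ k)" for k
  have u': "u k = \<theta> \<bullet> (Y $ k - Z $ q k)" for k
    by (simp add: u_def inner_diff_right)
  have "w_slice Z \<theta> Y = (\<Sum>k\<in>UNIV. (u (p k))\<^sup>2) / ?n"
    using w_slice_sorted[OF Y Z] p by (simp add: u_def q_def p_def bij_is_inj)
  also have "(\<Sum>k\<in>UNIV. (u (p k))\<^sup>2) = (\<Sum>k\<in>UNIV. (u k)\<^sup>2)"
    using sum.reindex_bij_betw[of p UNIV UNIV "\<lambda>k. (u k)\<^sup>2"] p by simp
  finally have wY: "w_slice Z \<theta> Y = (\<Sum>k\<in>UNIV. (u k)\<^sup>2) / ?n" .
  have "w_slice Z \<theta> X \<le> (\<Sum>k\<in>UNIV. (\<theta> \<bullet> X $ k - \<theta> \<bullet> Z $ q k)\<^sup>2) / ?n"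
    by (rule w_slice_le_permutation[OF q])
  also have "(\<Sum>k\<in>UNIV. (\<theta> \<bullet> X $ k - \<theta> \<bullet> Z $ q k)\<^sup>2) = (\<Sum>k\<in>UNIV. (u k)\<^sup>2 + 2 * u k * v k + (v k)\<^sup>2)"
    by (intro sum.cong refl) (simp add: u_def v_def inner_diff_right power2_eq_square algebra_simps)
  also have "\<dots> = (\<Sum>k\<in>UNIV. (u k)\<^sup>2) + (\<Sum>k\<in>UNIV. 2 * u k * v k) + (\<Sum>k\<in>UNIV. (v k)\<^sup>2)"
    by (simp add: sum.distrib)
  also have "(\<Sum>k\<in>UNIV. (v k)\<^sup>2) \<le> (norm (X - Y))\<^sup>2"
  proof -
    have "(v k)\<^sup>2 \<le> (norm ((X - Y) $ k))\<^sup>2" for k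
    proof -
      have "\<bar>v k\<bar> \<le> norm ((X - Y) $ k)" using Cauchy_Schwarz_ineq2[of \<theta> "X $ k - Y $ k"] \<theta> by (simp add: v_def)
      then show ?thesis by (metis abs_ge_zero power2_abs power_mono)
    qed
    then have "(\<Sum>k\<in>UNIV. (v k)\<^sup>2) \<le> (\<Sum>k\<in>UNIV. (norm ((X - Y) $ k))\<^sup>2)" by (intro sum_mono) auto
    then show ?thesis by (simp add: norm_vec_def L2_set_def sum_nonneg)
  qed
  finally have "w_slice Z \<theta> X \<le> ((\<Sum>k\<in>UNIV. (u k)\<^sup>2) + (\<Sum>k\<in>UNIV. 2 * u k * v k) + (norm (X - Y))\<^sup>2) / ?n"
    by (simp add: divide_right_mono)
  moreover have "sgd_grad \<tau> Z Y \<theta> \<bullet> (X - Y) = (\<Sum>k\<in>UNIV. 2 * u k * v k) / ?n"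
  proof -
    have "sgd_grad \<tau> Z Y \<theta> \<bullet> (X - Y) = (\<Sum>k\<in>UNIV. sgd_grad \<tau> Z Y \<theta> $ k \<bullet> (X - Y) $ k)"
      by (rule inner_vec_def)
    also have "\<dots> = (\<Sum>k\<in>UNIV. 2 * u k * v k / ?n)"
      by (intro sum.cong refl) (simp add: sgd_grad_def u' v_def q_def p_def)
    finally show ?thesis by (simp add: sum_divide_distrib)
  qed
  ultimately show "w_slice Z \<theta> X \<le> w_slice Z \<theta> Y + sgd_grad \<tau> Z Y \<theta> \<bullet> (X - Y) + 1 / ?n * (norm (X - Y))\<^sup>2"
    by (simp add: wY add_divide_distrib)
qed

text \<open>Bounding the norm by the sum of the row norms lets the factor \<open>2 / n\<close>
  absorb the number of rows. The product form matches the growth condition of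
  \<open>semiconcave\<close>.\<close>

lemma norm_sgd_grad_le:
  fixes Y Z :: "real ^ 'd ^ 'n::{finite,linorder}"
  assumes \<theta>: "norm \<theta> = 1"
  shows "norm (sgd_grad \<tau> Z Y \<theta>) \<le> 2 * (1 + norm Z) * (1 + norm Y)"
proof -
  let ?n = "real CARD('n)"
  have row: "norm (sgd_grad \<tau> Z Y \<theta> $ k) \<le> 2 / ?n * (norm Y + norm Z)" for k
  proof -
    let ?q = "(\<tau> \<theta> Z \<circ> inv (\<tau> \<theta> Y)) k"
    have "\<bar>\<theta> \<bullet> (Y $ k - Z $ ?q)\<bar> \<le> norm (Y $ k - Z $ ?q)"
      using Cauchy_Schwarz_ineq2[of \<theta> "Y $ k - Z $ ?q"] \<theta> by simp
    also have "\<dots> \<le> norm (Y $ k) + norm (Z $ ?q)" by (rule norm_triangle_ineq4)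
    also have "\<dots> \<le> norm Y + norm Z" by (intro add_mono Finite_Cartesian_Product.norm_nth_le)
    finally show ?thesis using \<theta> by (simp add: sgd_grad_def divide_right_mono)
  qed
  have "norm (sgd_grad \<tau> Z Y \<theta>) \<le> (\<Sum>k\<in>UNIV. norm (sgd_grad \<tau> Z Y \<theta> $ k))"
    unfolding norm_vec_def by (rule L2_set_le_sum) simp
  also have "\<dots> \<le> (\<Sum>k::'n\<in>UNIV. 2 / ?n * (norm Y + norm Z))" by (intro sum_mono row)
  also have "\<dots> = 2 * (norm Y + norm Z)" by simp
  also have "\<dots> \<le> 2 * (1 + norm Z) * (1 + norm Y)" by (simp add: algebra_simps)
  finally show ?thesis .
qed

section \<open>Ties, and gradients as measurable functions of position and direction\<close>

definition tie_free :: "real ^ 'd \<Rightarrow> real ^ 'd ^ 'n \<Rightarrow> bool" where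
  "tie_free \<theta> Y \<longleftrightarrow> inj (\<lambda>k. \<theta> \<bullet> Y $ k)"

lemma sorts_along_unique:
  fixes Y :: "real ^ 'd ^ 'n::{finite,linorder}"
  assumes "tie_free \<theta> Y" "sorts_along \<theta> Y p" "sorts_along \<theta> Y q"
  shows "p = q"
proof
  fix k
  have "\<theta> \<bullet> Y $ p k = \<theta> \<bullet> Y $ q k"
    using sorted_rearrangement_unique[of p q "\<lambda>k. \<theta> \<bullet> Y $ k" k] assms by (simp add: sorts_along_def)
  then show "p k = q k" using assms(1) by (auto simp: tie_free_def dest: injD)
qed

text \<open>Ties in \<open>Z\<close> are harmless: the gradient sees \<open>Z\<close> only through
  its projected values in sorted order, and these do not depend on the sorting permutation. At
  \<open>Y\<close> the permutation itself matters, and it is unique without ties.\<close>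

lemma sgd_grad_cong:
  fixes Y Z :: "real ^ 'd ^ 'n::{finite,linorder}"
  assumes "tie_free \<theta> Y" "sorts_along \<theta> Y (\<tau> \<theta> Y)" "sorts_along \<theta> Y (\<tau>' \<theta> Y)"
    "sorts_along \<theta> Z (\<tau> \<theta> Z)" "sorts_along \<theta> Z (\<tau>' \<theta> Z)"
  shows "sgd_grad \<tau> Z Y \<theta> = sgd_grad \<tau>' Z Y \<theta>"
proof -
  have "\<tau> \<theta> Y = \<tau>' \<theta> Y" by (rule sorts_along_unique[OF assms(1-3)])
  moreover have "\<theta> \<bullet> Z $ \<tau> \<theta> Z k = \<theta> \<bullet> Z $ \<tau>' \<theta> Z k" for k
    using sorted_rearrangement_unique[of "\<tau> \<theta> Z" "\<tau>' \<theta> Z" "\<lambda>k. \<theta> \<bullet> Z $ k" k] assms(4,5)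
    by (simp add: sorts_along_def)
  ultimately show ?thesis by (simp add: sgd_grad_def inner_diff_right)
qed

abbreviation perm_index :: "('n::finite \<Rightarrow> 'n) \<Rightarrow> nat" where
  "perm_index \<equiv> to_nat_on UNIV"

text \<open>A measurable choice of sorting permutations: the first one in a fixed enumeration.\<close>

definition canonical_sort :: "real ^ 'd \<Rightarrow> real ^ 'd ^ 'n::{finite,linorder} \<Rightarrow> 'n \<Rightarrow> 'n" where
  "canonical_sort \<theta> Y = arg_min perm_index (sorts_along \<theta> Y)"

lemma sorts_along_canonical_sort: "sorts_along \<theta> Y (canonical_sort \<theta> Y)"
proof -
  obtain p where "sorts_along \<theta> Y p"
    using sorting_permutation_exists[of "\<lambda>k. \<theta> \<bullet> Y $ k"] by (auto simp: sorts_along_def)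
  then show ?thesis unfolding canonical_sort_def by (rule arg_min_natI[of "sorts_along \<theta> Y" p])
qed

text \<open>Rewrites the minimisation as finitely many sorting conditions, each a finite conjunction
  of inequalities in the matrix and the direction, which makes measurability evident.\<close>

lemma canonical_sort_eq_iff:
  fixes Y :: "real ^ 'd ^ 'n::{finite,linorder}"
  shows "canonical_sort \<theta> Y = p \<longleftrightarrow> sorts_along \<theta> Y p \<and>
    (\<forall>q\<in>{q. perm_index q < perm_index p}. \<not> sorts_along \<theta> Y q)" (is "?L \<longleftrightarrow> ?R")
proof
  assume ?L then show ?R
    using sorts_along_canonical_sort[of \<theta> Y] arg_min_nat_le[of "sorts_along \<theta> Y" _ perm_index]
    unfolding canonical_sort_def by (auto simp: not_less[symmetric])
next
  assume R: ?R
  have "perm_index (canonical_sort \<theta> Y) \<le> perm_index p"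
    using R unfolding canonical_sort_def by (intro arg_min_nat_le[of "sorts_along \<theta> Y" p]) auto
  moreover have "\<not> perm_index (canonical_sort \<theta> Y) < perm_index p"
    using R sorts_along_canonical_sort[of \<theta> Y] by auto
  ultimately have "perm_index (canonical_sort \<theta> Y) = perm_index p" by simp
  then show ?L using inj_on_to_nat_on[of "UNIV :: ('n \<Rightarrow> 'n) set"] by (simp add: inj_eq)
qed

lemma borel_measurable_slice[measurable]:
  fixes f :: "'a \<Rightarrow> real ^ 'd ^ 'n::{finite,linorder}"
  assumes [measurable]: "f \<in> borel_measurable M"
  shows "(\<lambda>x. f x $ k) \<in> borel_measurable M"
proof -
  have "(\<lambda>Y :: real ^ 'd ^ 'n::{finite,linorder}. Y $ k) \<in> borel_measurable borel"
    by (intro borel_measurable_continuous_onI continuous_intros)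
  from measurable_compose[OF assms this] show ?thesis .
qed

lemma measurable_canonical_sort[measurable]:
  "(\<lambda>(Y :: real ^ 'd ^ 'n::{finite,linorder}, \<theta>). canonical_sort \<theta> Y) \<in> borel \<Otimes>\<^sub>M borel \<rightarrow>\<^sub>M count_space UNIV"
  unfolding measurable_count_space_eq2_countable
proof (intro conjI ballI)
  have [measurable]: "Measurable.pred (borel \<Otimes>\<^sub>M borel) (\<lambda>x :: (real ^ 'd ^ 'n::{finite,linorder}) \<times> (real ^ 'd). sorts_along (snd x) (fst x) p)" for p
    unfolding sorts_along_def mono_def by measurable
  fix p :: "'n \<Rightarrow> 'n"
  have "(\<lambda>(Y :: real ^ 'd ^ 'n::{finite,linorder}, \<theta>). canonical_sort \<theta> Y) -` {p} \<inter> space (borel \<Otimes>\<^sub>M borel) =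
     {x \<in> space (borel \<Otimes>\<^sub>M borel). canonical_sort (snd x) (fst x) = p}" by auto
  also have "\<dots> \<in> sets (borel \<Otimes>\<^sub>M borel)"
    unfolding canonical_sort_eq_iff by measurable
  finally show "(\<lambda>(Y :: real ^ 'd ^ 'n::{finite,linorder}, \<theta>). canonical_sort \<theta> Y) -` {p} \<inter> space (borel \<Otimes>\<^sub>M borel) \<in> sets (borel \<Otimes>\<^sub>M borel)" .
qed auto

text \<open>Cut off outside the sphere, so that the linear growth bound holds everywhere.\<close>

definition slice_grad :: "real ^ 'd ^ 'n::{finite,linorder} \<Rightarrow> real ^ 'd ^ 'n::{finite,linorder} \<Rightarrow> real ^ 'd \<Rightarrow> real ^ 'd ^ 'n::{finite,linorder}" where
  "slice_grad Z Y \<theta> = (if norm \<theta> = 1 then sgd_grad canonical_sort Z Y \<theta> else 0)"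

lemma norm_slice_grad_le: "norm (slice_grad Z Y \<theta>) \<le> 2 * (1 + norm Z) * (1 + norm Y)"
proof (cases "norm \<theta> = 1")
  case True
  then show ?thesis unfolding slice_grad_def using norm_sgd_grad_le[OF True] by simp
qed (simp add: slice_grad_def)

text \<open>With both permutations fixed the gradient is jointly continuous; the actual permutations
  are measurable functions with countably many values.\<close>

lemma measurable_slice_grad:
  fixes Z :: "real ^ 'd ^ 'n::{finite,linorder}"
  shows
  "(\<lambda>x. slice_grad Z (fst x) (snd x)) \<in> borel_measurable (borel \<Otimes>\<^sub>M borel)"
proof -
  define G :: "('n \<Rightarrow> 'n) \<Rightarrow> ('n \<Rightarrow> 'n) \<Rightarrow> (real ^ 'd ^ 'n::{finite,linorder}) \<times> (real ^ 'd) \<Rightarrow> real ^ 'd ^ 'n::{finite,linorder}" where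
    "G p q x = (\<chi> k. (2 / real CARD('n)) *\<^sub>R ((snd x \<bullet> (fst x $ k - Z $ (q \<circ> inv p) k)) *\<^sub>R snd x))" for p q x
  have G: "G p q \<in> borel_measurable (borel \<Otimes>\<^sub>M borel)" for p q
    unfolding G_def borel_prod
    by (intro borel_measurable_continuous_onI continuous_intros continuous_on_vec_lambda)
  have cs: "(\<lambda>x. canonical_sort (snd x) (fst x :: real ^ 'd ^ 'n::{finite,linorder})) \<in> borel \<Otimes>\<^sub>M borel \<rightarrow>\<^sub>M count_space UNIV"
    using measurable_canonical_sort[where 'n='n and 'd='d] by (simp add: case_prod_unfold)
  have csZ: "(\<lambda>x :: (real ^ 'd ^ 'n::{finite,linorder}) \<times> (real ^ 'd). canonical_sort (snd x) Z) \<in> borel \<Otimes>\<^sub>M borel \<rightarrow>\<^sub>M count_space UNIV"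
    by (rule measurable_compose[OF _ cs, of "\<lambda>x. (Z, snd x)", simplified]) measurable
  have "(\<lambda>x. G (canonical_sort (snd x) (fst x)) (canonical_sort (snd x) Z) x) \<in> borel_measurable (borel \<Otimes>\<^sub>M borel)"
    by (rule measurable_compose_countable[OF measurable_compose_countable[OF G csZ] cs])
  moreover have "G (canonical_sort (snd x) (fst x)) (canonical_sort (snd x) Z) x = sgd_grad canonical_sort Z (fst x) (snd x)" for x
    by (simp add: G_def sgd_grad_def)
  ultimately have [measurable]: "(\<lambda>x. sgd_grad canonical_sort Z (fst x) (snd x)) \<in> borel_measurable (borel \<Otimes>\<^sub>M borel)"
    by simp
  show ?thesis unfolding slice_grad_def by measurable
qed

lemma measurable_w_slice:
  fixes Y Z :: "real ^ 'd ^ 'n::{finite,linorder}"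
  shows "(\<lambda>\<theta>. w_slice Z \<theta> Y) \<in> borel_measurable borel"
proof -
  define G :: "('n \<Rightarrow> 'n) \<Rightarrow> ('n \<Rightarrow> 'n) \<Rightarrow> (real ^ 'd) \<Rightarrow> real" where
    "G p q \<theta> = (\<Sum>k\<in>UNIV. (\<theta> \<bullet> Y $ p k - \<theta> \<bullet> Z $ q k)\<^sup>2) / real CARD('n)" for p q \<theta>
  have G: "G p q \<in> borel_measurable borel" for p q unfolding G_def by measurable
  have cs: "(\<lambda>\<theta>. canonical_sort \<theta> X) \<in> borel \<rightarrow>\<^sub>M count_space UNIV" for X :: "real ^ 'd ^ 'n::{finite,linorder}"
    using measurable_compose[OF _ measurable_canonical_sort, of "\<lambda>\<theta>. (X, \<theta>)" borel] by simp
  have "(\<lambda>\<theta>. G (canonical_sort \<theta> Y) (canonical_sort \<theta> Z) \<theta>) \<in> borel_measurable borel"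
    by (rule measurable_compose_countable[OF measurable_compose_countable[OF G cs] cs])
  moreover have "G (canonical_sort \<theta> Y) (canonical_sort \<theta> Z) \<theta> = w_slice Z \<theta> Y" for \<theta>
    by (simp add: G_def w_slice_sorted[OF sorts_along_canonical_sort sorts_along_canonical_sort])
  ultimately show ?thesis by simp
qed

lemma w_slice_bounds:
  fixes Y Z :: "real ^ 'd ^ 'n::{finite,linorder}"
  assumes \<theta>: "norm \<theta> = 1"
  shows "0 \<le> w_slice Z \<theta> Y" "w_slice Z \<theta> Y \<le> (norm Y + norm Z)\<^sup>2"
proof -
  show "0 \<le> w_slice Z \<theta> Y" by (simp add: w_slice_def)
  have "(\<theta> \<bullet> Y $ k - \<theta> \<bullet> Z $ k)\<^sup>2 \<le> (norm Y + norm Z)\<^sup>2" for k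
  proof -
    have "\<bar>\<theta> \<bullet> Y $ k - \<theta> \<bullet> Z $ k\<bar> \<le> norm (Y $ k - Z $ k)"
      using Cauchy_Schwarz_ineq2[of \<theta> "Y $ k - Z $ k"] \<theta> by (simp add: inner_diff_right)
    also have "\<dots> \<le> norm (Y $ k) + norm (Z $ k)" by (rule norm_triangle_ineq4)
    also have "\<dots> \<le> norm Y + norm Z" by (intro add_mono Finite_Cartesian_Product.norm_nth_le)
    finally show ?thesis by (metis abs_ge_zero power2_abs power_mono)
  qed
  then have "(\<Sum>k\<in>UNIV. (\<theta> \<bullet> Y $ k - \<theta> \<bullet> Z $ k)\<^sup>2) \<le> (\<Sum>k::'n\<in>UNIV. (norm Y + norm Z)\<^sup>2)"
    by (intro sum_mono)
  then have "(\<Sum>k\<in>UNIV. (\<theta> \<bullet> Y $ k - \<theta> \<bullet> Z $ k)\<^sup>2) / real CARD('n) \<le> (norm Y + norm Z)\<^sup>2"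
    by (simp add: divide_le_eq mult.commute)
  then show "w_slice Z \<theta> Y \<le> (norm Y + norm Z)\<^sup>2"
    using w_slice_le_permutation[OF bij_id, of Z \<theta> Y] by simp
qed

text \<open>Strict order of finitely many projections is an open condition. The sorting permutation
  is therefore constant near \<open>Y\<close>, where the gradient is then affine in the
  matrix.\<close>

lemma isCont_slice_grad:
  fixes Y Z :: "real ^ 'd ^ 'n::{finite,linorder}"
  assumes "tie_free \<theta> Y"
  shows "isCont (\<lambda>X. slice_grad Z X \<theta>) Y"
proof (cases "norm \<theta> = 1")
  case True
  define p where "p = canonical_sort \<theta> Y"
  have p: "bij p" "mono (\<lambda>k. \<theta> \<bullet> Y $ p k)"
    using sorts_along_canonical_sort[of \<theta> Y] by (auto simp: sorts_along_def p_def)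
  have strict: "\<theta> \<bullet> Y $ p j < \<theta> \<bullet> Y $ p k" if "j < k" for j k
  proof -
    have "\<theta> \<bullet> Y $ p j \<le> \<theta> \<bullet> Y $ p k" using monoD[OF p(2), of j k] that by simp
    moreover have "\<theta> \<bullet> Y $ p j \<noteq> \<theta> \<bullet> Y $ p k"
      using assms that p(1) by (auto simp: tie_free_def bij_def dest!: injD)
    ultimately show ?thesis by simp
  qed
  have "\<forall>\<^sub>F X in at Y. \<theta> \<bullet> X $ p j < \<theta> \<bullet> X $ p k" if "j < k" for j k
  proof -
    have "((\<lambda>X. \<theta> \<bullet> X $ p k - \<theta> \<bullet> X $ p j) \<longlongrightarrow> \<theta> \<bullet> Y $ p k - \<theta> \<bullet> Y $ p j) (at Y)"
      by (intro tendsto_intros)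
    from order_tendstoD(1)[OF this, of 0] show ?thesis using strict[OF that] by simp
  qed
  then have "\<forall>\<^sub>F X in at Y. \<forall>k. \<forall>j. j < k \<longrightarrow> \<theta> \<bullet> X $ p j < \<theta> \<bullet> X $ p k"
    by (auto simp: eventually_all_finite)
  then have ev: "\<forall>\<^sub>F X in at Y. canonical_sort \<theta> X = p"
  proof eventually_elim
    case (elim X)
    have "inj (\<lambda>k. \<theta> \<bullet> X $ p k)" by (intro linorder_injI) (use elim in \<open>simp add: less_imp_neq\<close>)
    then have "inj ((\<lambda>k. \<theta> \<bullet> X $ k) \<circ> p)" by (simp add: comp_def)
    then have "tie_free \<theta> X" using p(1) unfolding tie_free_def
      using inj_on_imageI[of "\<lambda>k. \<theta> \<bullet> X $ k" p UNIV] by (simp add: bij_is_surj)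
    moreover have "sorts_along \<theta> X p" using elim p(1)
      by (auto simp: sorts_along_def intro!: monoI simp: le_less)
    ultimately show ?case using sorts_along_unique sorts_along_canonical_sort by blast
  qed
  define G where "G X = (\<chi> k. (2 / real CARD('n)) *\<^sub>R ((\<theta> \<bullet> (X $ k - Z $ (canonical_sort \<theta> Z \<circ> inv p) k)) *\<^sub>R \<theta>))" for X :: "real ^ 'd ^ 'n::{finite,linorder}"
  have "(G \<longlongrightarrow> G Y) (at Y)" unfolding G_def by (intro tendsto_vec_lambda tendsto_intros)
  moreover have "\<forall>\<^sub>F X in at Y. G X = slice_grad Z X \<theta>"
    using ev by eventually_elim (simp add: G_def slice_grad_def sgd_grad_def True)
  ultimately have "((\<lambda>X. slice_grad Z X \<theta>) \<longlongrightarrow> G Y) (at Y)"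
    by (rule Lim_transform_eventually)
  moreover have "G Y = slice_grad Z Y \<theta>" by (simp add: G_def slice_grad_def sgd_grad_def True p_def)
  ultimately show ?thesis by (simp add: isCont_def)
qed (simp add: slice_grad_def)

text \<open>A tie between rows \<open>i\<close> and \<open>j\<close> means orthogonality to the
  nonzero matrix with \<theta> in row \<open>i\<close> and its negative in row \<open>j\<close>; so
  ties lie in finitely many hyperplanes.\<close>

lemma negligible_not_tie_free:
  fixes \<theta> :: "real ^ 'd"
  assumes "\<theta> \<noteq> 0"
  shows "negligible {Y :: real ^ 'd ^ 'n. \<not> tie_free \<theta> Y}"
proof -
  define H where "H i j = {Y :: real ^ 'd ^ 'n. (axis i \<theta> - axis j \<theta>) \<bullet> Y = 0}" for i j
  have "negligible (H i j)" if "i \<noteq> j" for i j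
  proof -
    have "(axis i \<theta> - axis j \<theta>) $ i \<noteq> (0 :: real ^ 'd)" using assms that by (simp add: axis_def)
    then have "axis i \<theta> - axis j \<theta> \<noteq> (0 :: real ^ 'd ^ 'n)" by (metis zero_index)
    then show ?thesis unfolding H_def by (intro negligible_hyperplane) auto
  qed
  then have "negligible (\<Union> ((\<lambda>(i, j). H i j) ` {(i, j). i \<noteq> j}))"
    by (intro negligible_Union) auto
  moreover have "{Y :: real ^ 'd ^ 'n. \<not> tie_free \<theta> Y} \<subseteq> \<Union> ((\<lambda>(i, j). H i j) ` {(i, j). i \<noteq> j})"
    by (auto simp: H_def tie_free_def inj_def inner_diff_left inner_axis')
  ultimately show ?thesis by (rule negligible_subset)
qed

lemma pred_tie_free[measurable]:
  assumes [measurable]: "f \<in> borel_measurable M" "h \<in> borel_measurable M"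
  shows "Measurable.pred M (\<lambda>x. tie_free (f x) (h x :: real ^ 'd ^ 'n::{finite,linorder}))"
  unfolding tie_free_def inj_def by measurable

text \<open>Covers the uniform and the discrete law of directions at once. The measure lives on the
  whole space, and unit norm is an almost sure property.\<close>

locale sphere_measure = prob_space \<mu> for \<mu> :: "(real ^ 'd) measure" +
  assumes sets_eq[simp, measurable_cong]: "sets \<mu> = sets borel"
    and AE_norm: "AE \<theta> in \<mu>. norm \<theta> = 1"
begin

definition mean_grad :: "real ^ 'd ^ 'n::{finite,linorder} \<Rightarrow> real ^ 'd ^ 'n::{finite,linorder} \<Rightarrow> real ^ 'd ^ 'n::{finite,linorder}" where
  "mean_grad Z Y = (\<integral>\<theta>. slice_grad Z Y \<theta> \<partial>\<mu>)"

lemma measurable_slice_grad2[measurable]: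
  assumes "f \<in> borel_measurable M" "h \<in> borel_measurable M"
  shows "(\<lambda>x. slice_grad Z (f x) (h x)) \<in> borel_measurable M"
  using measurable_compose[OF measurable_Pair[OF assms] measurable_slice_grad] by simp

lemma integrable_slice_grad: "integrable \<mu> (slice_grad Z Y)"
  by (rule integrable_const_bound[where B = "2 * (1 + norm Z) * (1 + norm Y)"])
    (auto intro!: norm_slice_grad_le simp del: distrib_left_numeral)

lemma norm_mean_grad_le: "norm (mean_grad Z Y) \<le> 2 * (1 + norm Z) * (1 + norm Y)"
proof -
  have "norm (mean_grad Z Y) \<le> (\<integral>\<theta>. norm (slice_grad Z Y \<theta>) \<partial>\<mu>)"
    unfolding mean_grad_def by (rule integral_norm_bound)
  also have "\<dots> \<le> (\<integral>\<theta>. 2 * (1 + norm Z) * (1 + norm Y) \<partial>\<mu>)"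
    by (intro integral_mono integrable_norm integrable_slice_grad norm_slice_grad_le) simp
  also have "\<dots> = 2 * (1 + norm Z) * (1 + norm Y)" using prob_space by simp
  finally show ?thesis .
qed

lemma integrable_w_slice:
  fixes Y Z :: "real ^ 'd ^ 'n::{finite,linorder}"
  shows "integrable \<mu> (\<lambda>\<theta>. w_slice Z \<theta> Y)"
proof (rule integrable_const_bound[where B = "(norm Y + norm Z)\<^sup>2"])
  show "AE \<theta> in \<mu>. norm (w_slice Z \<theta> Y) \<le> (norm Y + norm Z)\<^sup>2"
    using AE_norm by eventually_elim (simp add: w_slice_bounds)
  show "(\<lambda>\<theta>. w_slice Z \<theta> Y) \<in> borel_measurable \<mu>"
    using measurable_w_slice by (simp cong: measurable_cong_sets)
qed

text \<open>The constant \<open>1 / n\<close> is the same for every direction, so the slice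
  inequalities can be integrated against \<mu>.\<close>

lemma semiconcave_energy:
  fixes Z :: "real ^ 'd ^ 'n::{finite,linorder}"
  shows "semiconcave (\<lambda>Y. \<integral>\<theta>. w_slice Z \<theta> Y \<partial>\<mu>) (mean_grad Z) (1 / real CARD('n)) (2 * (1 + norm Z))"
proof
  fix Y :: "real ^ 'd ^ 'n::{finite,linorder}"
  show "norm (mean_grad Z Y) \<le> 2 * (1 + norm Z) * (1 + norm Y)" by (rule norm_mean_grad_le)
  show "mean_grad Z Y \<in> quad_superdiff (1 / real CARD('n)) (\<lambda>Y. \<integral>\<theta>. w_slice Z \<theta> Y \<partial>\<mu>) Y"
    unfolding quad_superdiff_def
  proof (intro CollectI allI)
    fix X :: "real ^ 'd ^ 'n::{finite,linorder}"
    have int: "integrable \<mu> (\<lambda>\<theta>. slice_grad Z Y \<theta> \<bullet> (X - Y))"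
      by (intro integrable_inner_left integrable_slice_grad)
    have "(\<integral>\<theta>. w_slice Z \<theta> X \<partial>\<mu>) \<le>
        (\<integral>\<theta>. w_slice Z \<theta> Y + slice_grad Z Y \<theta> \<bullet> (X - Y) + 1 / real CARD('n) * (norm (X - Y))\<^sup>2 \<partial>\<mu>)"
    proof (rule integral_mono_AE)
      show "AE \<theta> in \<mu>. w_slice Z \<theta> X \<le> w_slice Z \<theta> Y + slice_grad Z Y \<theta> \<bullet> (X - Y) + 1 / real CARD('n) * (norm (X - Y))\<^sup>2"
        using AE_norm
      proof eventually_elim
        case (elim \<theta>)
        show ?case
          using quad_superdiffD[OF sgd_grad_quad_superdiff[where \<tau> = canonical_sort,
              OF elim sorts_along_canonical_sort sorts_along_canonical_sort], of Z X Y] elim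
          unfolding slice_grad_def by simp
      qed
      show "integrable \<mu> (\<lambda>\<theta>. w_slice Z \<theta> Y + slice_grad Z Y \<theta> \<bullet> (X - Y) + 1 / real CARD('n) * (norm (X - Y))\<^sup>2)"
        by (intro integrable_w_slice Bochner_Integration.integrable_add int integrable_const)
    qed (rule integrable_w_slice)
    also have "\<dots> = (\<integral>\<theta>. w_slice Z \<theta> Y \<partial>\<mu>) + mean_grad Z Y \<bullet> (X - Y) + 1 / real CARD('n) * (norm (X - Y))\<^sup>2"
      using prob_space Bochner_Integration.integral_add[OF integrable_w_slice[of Z Y] int]
        Bochner_Integration.integral_add[OF Bochner_Integration.integrable_add[OF integrable_w_slice[of Z Y] int]
          integrable_const[of "1 / real CARD('n) * (norm (X - Y))\<^sup>2"]]
      by (simp add: mean_grad_def integral_inner_left[OF integrable_slice_grad])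
    finally show "(\<integral>\<theta>. w_slice Z \<theta> X \<partial>\<mu>) \<le> (\<integral>\<theta>. w_slice Z \<theta> Y \<partial>\<mu>) + mean_grad Z Y \<bullet> (X - Y) +
        1 / real CARD('n) * (norm (X - Y))\<^sup>2" .
  qed
qed simp

lemma isCont_mean_grad:
  fixes Y Z :: "real ^ 'd ^ 'n::{finite,linorder}"
  assumes "AE \<theta> in \<mu>. tie_free \<theta> Y"
  shows "isCont (mean_grad Z) Y"
  unfolding continuous_at_sequentially
proof (intro allI impI)
  fix X :: "nat \<Rightarrow> real ^ 'd ^ 'n::{finite,linorder}" assume X: "X \<longlonglongrightarrow> Y"
  have "\<exists>R. \<forall>j. norm (X j) \<le> R"
    using convergent_imp_Bseq[OF convergentI[OF X]] by (auto simp: Bseq_def)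
  then obtain R where R: "\<And>j. norm (X j) \<le> R" by blast
  show "(mean_grad Z \<circ> X) \<longlonglongrightarrow> mean_grad Z Y"
    unfolding mean_grad_def comp_def
  proof (rule integral_dominated_convergence[where w = "\<lambda>_. 2 * (1 + norm Z) * (1 + R)"])
    show "AE \<theta> in \<mu>. (\<lambda>i. slice_grad Z (X i) \<theta>) \<longlonglongrightarrow> slice_grad Z Y \<theta>"
      using assms by eventually_elim (rule isCont_tendsto_compose[OF isCont_slice_grad X])
    show "AE \<theta> in \<mu>. norm (slice_grad Z (X i) \<theta>) \<le> 2 * (1 + norm Z) * (1 + R)" for i
    proof (rule AE_I2)
      fix \<theta>
      have "norm (slice_grad Z (X i) \<theta>) \<le> 2 * (1 + norm Z) * (1 + norm (X i))" by (rule norm_slice_grad_le)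
      also have "\<dots> \<le> 2 * (1 + norm Z) * (1 + R)" using R[of i] by (intro mult_left_mono) auto
      finally show "norm (slice_grad Z (X i) \<theta>) \<le> 2 * (1 + norm Z) * (1 + R)" .
    qed
  qed auto
qed

text \<open>For each unit direction the matrices with ties are Lebesgue-null. By Fubini almost every
  matrix is free of ties in almost every direction, even if \<mu> is discrete, and a set of full
  measure meets every nonempty open set.\<close>

lemma isCont_mean_grad_dense:
  fixes Z :: "real ^ 'd ^ 'n::{finite,linorder}"
  assumes U: "open U" "U \<noteq> {}"
  shows "\<exists>Y\<in>U. isCont (mean_grad Z) Y"
proof -
  let ?L = "lborel :: (real ^ 'd ^ 'n::{finite,linorder}) measure"
  interpret L: sigma_finite_measure ?L by (rule sigma_finite_lborel)
  interpret P: pair_sigma_finite ?L \<mu> ..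
  have "AE \<theta> in \<mu>. AE Y in ?L. tie_free \<theta> Y"
    using AE_norm
  proof eventually_elim
    case (elim \<theta>)
    then have "\<theta> \<noteq> 0" by auto
    then have "{Y :: real ^ 'd ^ 'n::{finite,linorder}. \<not> tie_free \<theta> Y} \<in> null_sets lebesgue"
      using negligible_not_tie_free negligible_iff_null_sets by blast
    then have "AE Y in completion ?L. tie_free \<theta> Y"
      using AE_not_in by fastforce
    then show ?case by (simp add: AE_completion_iff)
  qed
  then have "AE Y in ?L. AE \<theta> in \<mu>. tie_free \<theta> Y"
    by (subst P.AE_commute) measurable
  then have "AE Y in completion ?L. AE \<theta> in \<mu>. tie_free \<theta> Y"
    by (rule AE_completion)
  then obtain N where N: "N \<in> null_sets lebesgue"
    "\<And>Y :: real ^ 'd ^ 'n::{finite,linorder}. Y \<notin> N \<Longrightarrow> AE \<theta> in \<mu>. tie_free \<theta> Y"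
    by (rule AE_E3) auto
  have "\<not> U \<subseteq> N"
    using open_not_negligible[OF U] N(1) negligible_iff_null_sets negligible_subset by blast
  then obtain Y where "Y \<in> U" "Y \<notin> N" by blast
  then show ?thesis using N(2) isCont_mean_grad by blast
qed

end

section \<open>The noise of the stochastic recursion\<close>

context sphere_measure
begin

abbreviation directions :: "(nat \<Rightarrow> real ^ 'd) measure" where
  "directions \<equiv> \<Pi>\<^sub>M t\<in>(UNIV :: nat set). \<mu>"

lemma prob_space_directions: "prob_space directions"
  by (intro prob_space_PiM prob_space_axioms)

text \<open>A measurable stand-in for \<open>sgd\<close>: the selection is the canonical one and the
  gradient is cut off outside the sphere. \<open>AE_tie_free\<close> and
  \<open>sgd_eq_slice_sgd\<close> identify the two recursions almost surely.\<close>

primrec slice_sgd :: "real ^ 'd ^ 'n::{finite,linorder} \<Rightarrow> real \<Rightarrow> (real ^ 'd ^ 'n::{finite,linorder}) \<times> (nat \<Rightarrow> real ^ 'd) \<Rightarrow> nat \<Rightarrow> real ^ 'd ^ 'n::{finite,linorder}" where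
  "slice_sgd Z \<alpha> \<omega> 0 = fst \<omega>"
| "slice_sgd Z \<alpha> \<omega> (Suc t) = slice_sgd Z \<alpha> \<omega> t - \<alpha> *\<^sub>R slice_grad Z (slice_sgd Z \<alpha> \<omega> t) (snd \<omega> (Suc t))"

text \<open>The martingale part of the recursion, that is, its displacement corrected by the
  accumulated mean drift. It has the form bounded in the hypothesis of
  \<open>clarke_flow_stability\<close>.\<close>

definition noise :: "real ^ 'd ^ 'n::{finite,linorder} \<Rightarrow> real \<Rightarrow> (real ^ 'd ^ 'n::{finite,linorder}) \<times> (nat \<Rightarrow> real ^ 'd) \<Rightarrow> nat \<Rightarrow> real ^ 'd ^ 'n::{finite,linorder}" where
  "noise Z \<alpha> \<omega> m = slice_sgd Z \<alpha> \<omega> m - slice_sgd Z \<alpha> \<omega> 0 + \<alpha> *\<^sub>R (\<Sum>t<m. mean_grad Z (slice_sgd Z \<alpha> \<omega> t))"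

lemma noise_0: "noise Z \<alpha> \<omega> 0 = 0"
  by (simp add: noise_def)

lemma noise_Suc: "noise Z \<alpha> \<omega> (Suc m) = noise Z \<alpha> \<omega> m +
    \<alpha> *\<^sub>R (mean_grad Z (slice_sgd Z \<alpha> \<omega> m) - slice_grad Z (slice_sgd Z \<alpha> \<omega> m) (snd \<omega> (Suc m)))"
  by (simp add: noise_def scaleR_add_right scaleR_diff_right)

text \<open>Adaptedness in concrete form: the position after \<open>t\<close> steps is not affected
  by directions of index larger than \<open>t\<close>.\<close>

lemma slice_sgd_upd: "t < i \<Longrightarrow> slice_sgd Z \<alpha> (x, s(i := \<theta>)) t = slice_sgd Z \<alpha> (x, s) t"
  by (induction t) auto

lemma noise_upd: "m < i \<Longrightarrow> noise Z \<alpha> (x, s(i := \<theta>)) m = noise Z \<alpha> (x, s) m"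
  by (simp add: noise_def slice_sgd_upd)

lemma norm_slice_sgd_step:
  assumes "0 \<le> \<alpha>"
  shows "norm (slice_sgd Z \<alpha> \<omega> (Suc t) - slice_sgd Z \<alpha> \<omega> t) \<le> \<alpha> * (2 * (1 + norm Z) * (1 + norm (slice_sgd Z \<alpha> \<omega> t)))"
  using assms norm_slice_grad_le[of Z "slice_sgd Z \<alpha> \<omega> t" "snd \<omega> (Suc t)"] by (simp add: mult_left_mono)

lemma measurable_mean_grad[measurable]:
  "mean_grad Z \<in> borel_measurable borel"
  unfolding mean_grad_def by measurable

lemma measurable_slice_sgd[measurable]:
  assumes [measurable_cong]: "sets \<nu> = sets borel"
  shows "(\<lambda>\<omega>. slice_sgd Z \<alpha> \<omega> t) \<in> borel_measurable (\<nu> \<Otimes>\<^sub>M directions)"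
  by (induction t) (simp_all, measurable)

lemma measurable_noise[measurable]:
  assumes [measurable_cong]: "sets \<nu> = sets borel"
  shows "(\<lambda>\<omega>. noise Z \<alpha> \<omega> m) \<in> borel_measurable (\<nu> \<Otimes>\<^sub>M directions)"
  unfolding noise_def by measurable

lemma measurable_resample[measurable]:
  assumes "f \<in> M \<rightarrow>\<^sub>M directions" "h \<in> M \<rightarrow>\<^sub>M \<mu>"
  shows "(\<lambda>x. (f x)(i := h x)) \<in> M \<rightarrow>\<^sub>M directions"
  using assms by (intro measurable_fun_upd[where J = UNIV]) auto

text \<open>Replacing one coordinate by an independent copy does not change the product law. This
  plays the part of conditioning on all other coordinates, without conditional expectations.\<close>

lemma nn_integral_resample:
  assumes \<nu>: "prob_space \<nu>" and f[measurable]: "f \<in> borel_measurable (\<nu> \<Otimes>\<^sub>M directions)"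
  shows "(\<integral>\<^sup>+\<omega>. f \<omega> \<partial>(\<nu> \<Otimes>\<^sub>M directions)) =
    (\<integral>\<^sup>+\<omega>. \<integral>\<^sup>+\<theta>. f (fst \<omega>, (snd \<omega>)(i := \<theta>)) \<partial>\<mu> \<partial>(\<nu> \<Otimes>\<^sub>M directions))"
proof -
  interpret S: prob_space directions by (rule prob_space_directions)
  interpret \<nu>: prob_space \<nu> by (rule \<nu>)
  interpret MS: pair_sigma_finite \<mu> directions ..
  have upd: "distr (\<mu> \<Otimes>\<^sub>M directions) directions (\<lambda>(\<theta>, s). s(i := \<theta>)) = directions"
    using distr_pair_PiM_eq_PiM[of "UNIV :: nat set" "\<lambda>_. \<mu>" i] prob_space_axioms by simp
  have "(\<integral>\<^sup>+\<omega>. f \<omega> \<partial>(\<nu> \<Otimes>\<^sub>M directions)) = (\<integral>\<^sup>+x. \<integral>\<^sup>+s. f (x, s) \<partial>directions \<partial>\<nu>)"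
    by (rule S.nn_integral_fst[symmetric]) (rule f)
  also have "\<dots> = (\<integral>\<^sup>+x. \<integral>\<^sup>+s. \<integral>\<^sup>+\<theta>. f (x, s(i := \<theta>)) \<partial>\<mu> \<partial>directions \<partial>\<nu>)"
  proof (rule nn_integral_cong)
    fix x assume x: "x \<in> space \<nu>"
    then have [measurable]: "(\<lambda>s. f (x, s)) \<in> borel_measurable directions" by measurable
    have "(\<integral>\<^sup>+s. f (x, s) \<partial>directions) = (\<integral>\<^sup>+z. f (x, (\<lambda>(\<theta>, s). s(i := \<theta>)) z) \<partial>(\<mu> \<Otimes>\<^sub>M directions))"
      by (subst upd[symmetric], subst nn_integral_distr) (auto simp: case_prod_unfold)
    also have "\<dots> = (\<integral>\<^sup>+s. \<integral>\<^sup>+\<theta>. f (x, s(i := \<theta>)) \<partial>\<mu> \<partial>directions)"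
      by (subst MS.nn_integral_snd[symmetric]) (use x in \<open>auto simp: case_prod_unfold\<close>)
    finally show "(\<integral>\<^sup>+s. f (x, s) \<partial>directions) = \<dots>" .
  qed
  also have "\<dots> = (\<integral>\<^sup>+\<omega>. \<integral>\<^sup>+\<theta>. f (fst \<omega>, (snd \<omega>)(i := \<theta>)) \<partial>\<mu> \<partial>(\<nu> \<Otimes>\<^sub>M directions))"
    by (subst S.nn_integral_fst[symmetric]) auto
  finally show ?thesis .
qed

text \<open>The increment has mean zero, so its cross term with \<open>v\<close> vanishes on
  average. The variance is the second moment of \<open>slice_grad\<close> minus the squared norm of
  its mean, hence at most the square of \<open>D\<close>.\<close>

lemma nn_integral_step_le:
  assumes D: "\<And>\<theta>. norm (slice_grad Z Y \<theta>) \<le> D"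
  shows "(\<integral>\<^sup>+\<theta>. ennreal ((norm (v + \<alpha> *\<^sub>R (mean_grad Z Y - slice_grad Z Y \<theta>)))\<^sup>2) \<partial>\<mu>) \<le> ennreal ((norm v)\<^sup>2 + \<alpha>\<^sup>2 * D\<^sup>2)"
proof -
  let ?\<phi> = "slice_grad Z Y" and ?g = "mean_grad Z Y"
  define u where "u = v + \<alpha> *\<^sub>R ?g"
  have expand: "(norm (v + \<alpha> *\<^sub>R (?g - ?\<phi> \<theta>)))\<^sup>2 = (norm u)\<^sup>2 - 2 * \<alpha> * (?\<phi> \<theta> \<bullet> u) + \<alpha>\<^sup>2 * (norm (?\<phi> \<theta>))\<^sup>2" for \<theta>
    unfolding u_def power2_norm_eq_inner
    by (simp add: inner_add_left inner_add_right inner_diff_left inner_diff_right inner_commute power2_eq_square algebra_simps)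
  have sq: "integrable \<mu> (\<lambda>\<theta>. (norm (?\<phi> \<theta>))\<^sup>2)"
    by (rule integrable_const_bound[where B = "D\<^sup>2"]) (auto intro!: power_mono D)
  have lin: "integrable \<mu> (\<lambda>\<theta>. ?\<phi> \<theta> \<bullet> u)" by (intro integrable_inner_left integrable_slice_grad)
  have 1: "integrable \<mu> (\<lambda>\<theta>. (norm u)\<^sup>2 - 2 * \<alpha> * (?\<phi> \<theta> \<bullet> u))"
    by (intro Bochner_Integration.integrable_diff integrable_const integrable_mult_right lin)
  have 2: "integrable \<mu> (\<lambda>\<theta>. \<alpha>\<^sup>2 * (norm (?\<phi> \<theta>))\<^sup>2)" by (intro integrable_mult_right sq)
  have "(\<integral>\<theta>. (norm (?\<phi> \<theta>))\<^sup>2 \<partial>\<mu>) \<le> (\<integral>\<theta>. D\<^sup>2 \<partial>\<mu>)"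
    by (intro integral_mono sq integrable_const power_mono D) simp
  then have sq_le: "(\<integral>\<theta>. (norm (?\<phi> \<theta>))\<^sup>2 \<partial>\<mu>) \<le> D\<^sup>2" using prob_space by simp
  have "(\<integral>\<theta>. (norm u)\<^sup>2 - 2 * \<alpha> * (?\<phi> \<theta> \<bullet> u) \<partial>\<mu>) = (norm u)\<^sup>2 - 2 * \<alpha> * (?g \<bullet> u)"
    using Bochner_Integration.integral_diff[OF integrable_const[of "(norm u)\<^sup>2"] integrable_mult_right[OF lin, of "2 * \<alpha>"]] prob_space
    by (simp add: mean_grad_def integral_inner_left[OF integrable_slice_grad])
  then have "(\<integral>\<theta>. (norm u)\<^sup>2 - 2 * \<alpha> * (?\<phi> \<theta> \<bullet> u) + \<alpha>\<^sup>2 * (norm (?\<phi> \<theta>))\<^sup>2 \<partial>\<mu>) =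
      (norm u)\<^sup>2 - 2 * \<alpha> * (?g \<bullet> u) + \<alpha>\<^sup>2 * (\<integral>\<theta>. (norm (?\<phi> \<theta>))\<^sup>2 \<partial>\<mu>)"
    using Bochner_Integration.integral_add[OF 1 2] by simp
  also have "\<dots> \<le> (norm u)\<^sup>2 - 2 * \<alpha> * (?g \<bullet> u) + \<alpha>\<^sup>2 * D\<^sup>2"
    using sq_le by (intro add_left_mono mult_left_mono) auto
  also have "\<dots> = (norm v)\<^sup>2 - \<alpha>\<^sup>2 * (?g \<bullet> ?g) + \<alpha>\<^sup>2 * D\<^sup>2"
    unfolding u_def power2_norm_eq_inner
    by (simp add: inner_add_left inner_add_right inner_commute power2_eq_square algebra_simps)
  also have "\<dots> \<le> (norm v)\<^sup>2 + \<alpha>\<^sup>2 * D\<^sup>2" by simp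
  finally have "(\<integral>\<theta>. (norm u)\<^sup>2 - 2 * \<alpha> * (?\<phi> \<theta> \<bullet> u) + \<alpha>\<^sup>2 * (norm (?\<phi> \<theta>))\<^sup>2 \<partial>\<mu>) \<le> (norm v)\<^sup>2 + \<alpha>\<^sup>2 * D\<^sup>2" .
  moreover have "integrable \<mu> (\<lambda>\<theta>. (norm (v + \<alpha> *\<^sub>R (?g - ?\<phi> \<theta>)))\<^sup>2)"
    unfolding expand by (rule Bochner_Integration.integrable_add[OF 1 2])
  from nn_integral_eq_integral[OF this]
  have "(\<integral>\<^sup>+\<theta>. ennreal ((norm (v + \<alpha> *\<^sub>R (?g - ?\<phi> \<theta>)))\<^sup>2) \<partial>\<mu>) =
      ennreal (\<integral>\<theta>. (norm (v + \<alpha> *\<^sub>R (?g - ?\<phi> \<theta>)))\<^sup>2 \<partial>\<mu>)" by simp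
  ultimately show ?thesis unfolding expand by (simp add: ennreal_leI del: ennreal_plus)
qed

text \<open>The noise is a martingale, so its second moment is the sum of those of the increments.\<close>

lemma nn_integral_noise_le:
  assumes \<nu>: "prob_space \<nu>" "sets \<nu> = sets borel" and K: "K \<in> sets borel"
    and D: "\<And>\<omega> t \<theta>. fst \<omega> \<in> K \<Longrightarrow> t < m \<Longrightarrow> norm (slice_grad Z (slice_sgd Z \<alpha> \<omega> t) \<theta>) \<le> D"
  shows "(\<integral>\<^sup>+\<omega>. ennreal ((norm (noise Z \<alpha> \<omega> m))\<^sup>2) * indicator K (fst \<omega>) \<partial>(\<nu> \<Otimes>\<^sub>M directions))
    \<le> ennreal (real m * (\<alpha>\<^sup>2 * D\<^sup>2))"
  using D
proof (induction m)
  case 0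
  then show ?case by (simp add: noise_0)
next
  case (Suc m)
  interpret S: prob_space directions by (rule prob_space_directions)
  interpret \<nu>: prob_space \<nu> by (rule \<nu>)
  interpret PS: pair_prob_space \<nu> directions ..
  note [measurable_cong] = \<nu>(2) and [measurable] = K measurable_noise[OF \<nu>(2)]
  let ?P = "\<nu> \<Otimes>\<^sub>M directions"
  let ?f = "\<lambda>m \<omega>. ennreal ((norm (noise Z \<alpha> \<omega> m))\<^sup>2) * indicator K (fst \<omega>)"
  \<comment> \<open>Only the direction of index \<open>Suc m\<close> is resampled. The initial
    point, the position and the noise after \<open>m\<close> steps do not depend on it, so the inner
    integral is that of a single martingale step.\<close>
  have "(\<integral>\<^sup>+\<omega>. ?f (Suc m) \<omega> \<partial>?P) = (\<integral>\<^sup>+\<omega>. \<integral>\<^sup>+\<theta>. ?f (Suc m) (fst \<omega>, (snd \<omega>)(Suc m := \<theta>)) \<partial>\<mu> \<partial>?P)"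
    by (rule nn_integral_resample[OF \<nu>(1)]) measurable
  also have "\<dots> \<le> (\<integral>\<^sup>+\<omega>. ?f m \<omega> + ennreal (\<alpha>\<^sup>2 * D\<^sup>2) \<partial>?P)"
  proof (rule nn_integral_mono)
    fix \<omega> assume "\<omega> \<in> space ?P"
    show "(\<integral>\<^sup>+\<theta>. ?f (Suc m) (fst \<omega>, (snd \<omega>)(Suc m := \<theta>)) \<partial>\<mu>) \<le> ?f m \<omega> + ennreal (\<alpha>\<^sup>2 * D\<^sup>2)"
    proof (cases "fst \<omega> \<in> K")
      case True
      have "(\<integral>\<^sup>+\<theta>. ?f (Suc m) (fst \<omega>, (snd \<omega>)(Suc m := \<theta>)) \<partial>\<mu>) =
        (\<integral>\<^sup>+\<theta>. ennreal ((norm (noise Z \<alpha> \<omega> m + \<alpha> *\<^sub>R (mean_grad Z (slice_sgd Z \<alpha> \<omega> m)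
            - slice_grad Z (slice_sgd Z \<alpha> \<omega> m) \<theta>)))\<^sup>2) \<partial>\<mu>)"
        using True by (simp add: noise_Suc noise_upd slice_sgd_upd)
      also have "\<dots> \<le> ennreal ((norm (noise Z \<alpha> \<omega> m))\<^sup>2 + \<alpha>\<^sup>2 * D\<^sup>2)"
        by (rule nn_integral_step_le) (use Suc.prems True in auto)
      finally show ?thesis using True by (simp add: ennreal_plus)
    qed simp
  qed
  also have "\<dots> = (\<integral>\<^sup>+\<omega>. ?f m \<omega> \<partial>?P) + ennreal (\<alpha>\<^sup>2 * D\<^sup>2)"
    using PS.emeasure_space_1 by (subst nn_integral_add) auto
  also have "\<dots> \<le> ennreal (real m * (\<alpha>\<^sup>2 * D\<^sup>2)) + ennreal (\<alpha>\<^sup>2 * D\<^sup>2)"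
    using Suc by (intro add_right_mono) auto
  also have "\<dots> = ennreal (real (Suc m) * (\<alpha>\<^sup>2 * D\<^sup>2))"
    by (simp add: ennreal_plus[symmetric] algebra_simps del: ennreal_plus)
  finally show ?case .
qed

lemma prob_noise_ge_le:
  assumes \<nu>: "prob_space \<nu>" "sets \<nu> = sets borel" and K: "K \<in> sets borel"
    and D: "\<And>\<omega> t \<theta>. fst \<omega> \<in> K \<Longrightarrow> t < m \<Longrightarrow> norm (slice_grad Z (slice_sgd Z \<alpha> \<omega> t) \<theta>) \<le> D"
    and \<delta>: "\<delta> > 0"
  shows "measure (\<nu> \<Otimes>\<^sub>M directions) {\<omega> \<in> space (\<nu> \<Otimes>\<^sub>M directions). fst \<omega> \<in> K \<and> \<delta> \<le> norm (noise Z \<alpha> \<omega> m)}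
    \<le> real m * (\<alpha>\<^sup>2 * D\<^sup>2) / \<delta>\<^sup>2"
proof -
  interpret S: prob_space directions by (rule prob_space_directions)
  interpret \<nu>: prob_space \<nu> by (rule \<nu>)
  interpret PS: pair_prob_space \<nu> directions ..
  note [measurable_cong] = \<nu>(2) and [measurable] = K measurable_noise[OF \<nu>(2)]
  let ?P = "\<nu> \<Otimes>\<^sub>M directions"
  let ?A = "{\<omega> \<in> space ?P. fst \<omega> \<in> K \<and> \<delta> \<le> norm (noise Z \<alpha> \<omega> m)}"
  have "ennreal (\<delta>\<^sup>2) * emeasure ?P ?A = (\<integral>\<^sup>+\<omega>. ennreal (\<delta>\<^sup>2) * indicator ?A \<omega> \<partial>?P)"
    by (subst nn_integral_cmult_indicator) auto
  also have "\<dots> \<le> (\<integral>\<^sup>+\<omega>. ennreal ((norm (noise Z \<alpha> \<omega> m))\<^sup>2) * indicator K (fst \<omega>) \<partial>?P)"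
    using \<delta> by (intro nn_integral_mono) (auto simp: indicator_def intro!: ennreal_leI power_mono)
  also have "\<dots> \<le> ennreal (real m * (\<alpha>\<^sup>2 * D\<^sup>2))" by (rule nn_integral_noise_le[OF \<nu> K D])
  finally have "ennreal (\<delta>\<^sup>2 * measure ?P ?A) \<le> ennreal (real m * (\<alpha>\<^sup>2 * D\<^sup>2))"
    by (simp add: PS.emeasure_eq_measure ennreal_mult)
  then have "\<delta>\<^sup>2 * measure ?P ?A \<le> real m * (\<alpha>\<^sup>2 * D\<^sup>2)" by (subst (asm) ennreal_le_iff) auto
  then show ?thesis using \<delta> by (simp add: field_simps)
qed

lemma norm_slice_sgd_le:
  assumes "0 \<le> \<alpha>"
  shows "1 + norm (slice_sgd Z \<alpha> \<omega> t) \<le> exp (2 * (1 + norm Z) * (\<alpha> * real t)) * (1 + norm (fst \<omega>))"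
  using linear_growth_bound[of \<alpha> "2 * (1 + norm Z)" "slice_sgd Z \<alpha> \<omega>" t]
    norm_slice_sgd_step[OF assms, of Z \<omega>] assms by (simp del: slice_sgd.simps(2))

text \<open>The increments of the noise are at most \<open>2 * D * \<alpha>\<close>, so it changes
  by at most \<open>\<delta> / 2\<close> over a short time. Exceeding \<delta> anywhere before
  \<open>T\<close> then forces it to reach \<open>\<delta> / 2\<close> at one of finitely many grid
  times, whose number does not depend on \<alpha>. Each of these has probability of order \<alpha>,
  and a union bound replaces a maximal inequality.\<close>

proposition noise_tends_to_zero:
  fixes Z :: "real ^ 'd ^ 'n::{finite,linorder}"
  assumes \<nu>: "prob_space \<nu>" "sets \<nu> = sets borel" and K: "compact K"
    and T: "0 < T" and \<delta>: "0 < \<delta>" and \<eta>: "0 < \<eta>"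
  shows "\<exists>\<alpha>1>0. \<forall>\<alpha>. 0 < \<alpha> \<and> \<alpha> < \<alpha>1 \<longrightarrow>
    measure (\<nu> \<Otimes>\<^sub>M directions) {\<omega> \<in> space (\<nu> \<Otimes>\<^sub>M directions).
       fst \<omega> \<in> K \<and> (\<exists>m. \<alpha> * real m \<le> T \<and> \<delta> < norm (noise Z \<alpha> \<omega> m))} \<le> \<eta>"
proof -
  interpret S: prob_space directions by (rule prob_space_directions)
  interpret \<nu>: prob_space \<nu> by (rule \<nu>)
  interpret PS: pair_prob_space \<nu> directions ..
  have K': "K \<in> sets borel" using K by (simp add: compact_imp_closed)
  note [measurable_cong] = \<nu>(2) and [measurable] = K' measurable_noise[OF \<nu>(2)]
  let ?P = "\<nu> \<Otimes>\<^sub>M directions"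
  define B where "B = 2 * (1 + norm Z)"
  obtain RK where RK: "\<And>x. x \<in> K \<Longrightarrow> norm x \<le> RK"
    using compact_imp_bounded[OF K] bounded_iff by metis
  define D where "D = B * (exp (B * T) * (1 + \<bar>RK\<bar>))"
  have D: "D \<ge> 0" by (simp add: D_def B_def)
  have B0: "B \<ge> 0" by (simp add: B_def)
  have growth: "B * (1 + norm (slice_sgd Z \<alpha> \<omega> t)) \<le> D"
    if "fst \<omega> \<in> K" "0 < \<alpha>" "\<alpha> * real t \<le> T" for \<alpha> \<omega> t
  proof -
    have "1 + norm (slice_sgd Z \<alpha> \<omega> t) \<le> exp (B * (\<alpha> * real t)) * (1 + norm (fst \<omega>))"
      using norm_slice_sgd_le[of \<alpha> Z \<omega> t] that by (simp add: B_def)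
    also have "\<dots> \<le> exp (B * T) * (1 + \<bar>RK\<bar>)"
      using that RK[OF that(1)] B0 by (intro mult_mono) (auto intro!: mult_left_mono)
    finally show ?thesis unfolding D_def by (intro mult_left_mono B0)
  qed
  have gradD: "norm (slice_grad Z (slice_sgd Z \<alpha> \<omega> t) \<theta>) \<le> D"
    and meanD: "norm (mean_grad Z (slice_sgd Z \<alpha> \<omega> t)) \<le> D"
    if "fst \<omega> \<in> K" "0 < \<alpha>" "\<alpha> * real t \<le> T" for \<alpha> \<omega> t \<theta>
    using order_trans[OF norm_slice_grad_le growth[OF that, unfolded B_def]]
      order_trans[OF norm_mean_grad_le growth[OF that, unfolded B_def]] by auto
  have incr: "norm (noise Z \<alpha> \<omega> b - noise Z \<alpha> \<omega> a) \<le> 2 * D * (\<alpha> * real (b - a))"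
    if \<omega>: "fst \<omega> \<in> K" "0 < \<alpha>" and ab: "a \<le> b" "\<alpha> * real b \<le> T" for \<alpha> \<omega> a b
    using ab
  proof (induction b rule: dec_induct)
    case (step b)
    have b: "\<alpha> * real b \<le> T" using step.prems \<omega> by (simp add: algebra_simps)
    have "norm (noise Z \<alpha> \<omega> (Suc b) - noise Z \<alpha> \<omega> b) \<le> \<alpha> * (D + D)"
      unfolding noise_Suc using \<omega> gradD[OF \<omega> b, of "snd \<omega> (Suc b)"] meanD[OF \<omega> b]
        norm_triangle_ineq4[of "mean_grad Z (slice_sgd Z \<alpha> \<omega> b)" "slice_grad Z (slice_sgd Z \<alpha> \<omega> b) (snd \<omega> (Suc b))"]
      by simp
    moreover have "norm (noise Z \<alpha> \<omega> b - noise Z \<alpha> \<omega> a) \<le> 2 * D * (\<alpha> * real (b - a))" by (rule step.IH[OF b])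
    moreover have "norm (noise Z \<alpha> \<omega> (Suc b) - noise Z \<alpha> \<omega> a) \<le>
        norm (noise Z \<alpha> \<omega> (Suc b) - noise Z \<alpha> \<omega> b) + norm (noise Z \<alpha> \<omega> b - noise Z \<alpha> \<omega> a)"
      using norm_triangle_ineq[of "noise Z \<alpha> \<omega> (Suc b) - noise Z \<alpha> \<omega> b" "noise Z \<alpha> \<omega> b - noise Z \<alpha> \<omega> a"] by simp
    moreover have "2 * D * (\<alpha> * real (Suc b - a)) = 2 * D * (\<alpha> * real (b - a)) + \<alpha> * (D + D)"
      using step.hyps by (simp add: Suc_diff_le algebra_simps)
    ultimately show ?case by linarith
  qed simp
  \<comment> \<open>Rounding a time down to the grid loses at most \<open>h\<close>, and rounding
    the grid time down to an iterate loses at most \<alpha>, which is below \<open>h\<close>. The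
    choice gives \<open>4 * D * h \<le> \<delta> / 2\<close>; the \<open>+ 1\<close> guards against
    \<open>D = 0\<close>.\<close>
  define h where "h = \<delta> / (8 * (D + 1))"
  have h: "h > 0" "2 * D * (2 * h) \<le> \<delta> / 2"
    using D \<delta> by (auto simp: h_def field_simps)
  obtain J :: nat where J: "T / h < real J" using reals_Archimedean2 by blast
  \<comment> \<open>The index of the last iterate not later than the grid time
    \<open>j * h\<close>.\<close>
  define q where "q \<alpha> j = nat \<lfloor>(real j * h) / \<alpha>\<rfloor>" for \<alpha> :: real and j :: nat
  \<comment> \<open>Chebyshev at level \<open>\<delta> / 2\<close> with at most
    \<open>T / \<alpha>\<close> steps leaves one factor \<alpha>, multiplied by the second factor of
    \<open>c\<close>; there are \<open>J + 1\<close> grid times.\<close>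
  define c where "c = real (Suc J) * (4 * T * D\<^sup>2 / \<delta>\<^sup>2)"
  have c: "c \<ge> 0" using T by (simp add: c_def)
  define \<alpha>1 where "\<alpha>1 = min h (\<eta> / (c + 1))"
  have "\<alpha>1 > 0" using h \<eta> c by (auto simp: \<alpha>1_def intro!: divide_pos_pos)
  moreover have "measure ?P {\<omega> \<in> space ?P. fst \<omega> \<in> K \<and> (\<exists>m. \<alpha> * real m \<le> T \<and> \<delta> < norm (noise Z \<alpha> \<omega> m))} \<le> \<eta>"
    if \<alpha>: "0 < \<alpha>" "\<alpha> < \<alpha>1" for \<alpha>
  proof -
    define G where "G j = {\<omega> \<in> space ?P. fst \<omega> \<in> K \<and> \<alpha> * real (q \<alpha> j) \<le> T \<and> \<delta> / 2 \<le> norm (noise Z \<alpha> \<omega> (q \<alpha> j))}" for j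
    have G[measurable]: "G j \<in> sets ?P" for j unfolding G_def by measurable
    have "{\<omega> \<in> space ?P. fst \<omega> \<in> K \<and> (\<exists>m. \<alpha> * real m \<le> T \<and> \<delta> < norm (noise Z \<alpha> \<omega> m))} \<subseteq> (\<Union>j\<in>{..J}. G j)"
    proof safe
      fix x s m assume \<omega>: "(x, s) \<in> space ?P" "fst (x, s) \<in> K" and m: "\<alpha> * real m \<le> T" "\<delta> < norm (noise Z \<alpha> (x, s) m)"
      define j where "j = nat \<lfloor>(\<alpha> * real m) / h\<rfloor>"
      have j: "h * real j \<le> \<alpha> * real m" "\<alpha> * real m - h \<le> h * real j"
        unfolding j_def using \<alpha> by (intro nat_floor_cell(1)[OF h(1)], simp, intro nat_floor_cell(3)[OF h(1)], simp)
      have "T < h * real J" using J h by (simp add: field_simps)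
      then have "h * real j < h * real J" using j m by linarith
      then have "j \<le> J" using h by simp
      have q: "\<alpha> * real (q \<alpha> j) \<le> real j * h" "real j * h - \<alpha> \<le> \<alpha> * real (q \<alpha> j)"
        unfolding q_def using h
        by (intro nat_floor_cell(1)[OF \<alpha>(1)], simp, intro nat_floor_cell(3)[OF \<alpha>(1)], simp)
      have "\<alpha> * real (q \<alpha> j) \<le> \<alpha> * real m" using q j by (simp add: mult.commute)
      then have qm: "q \<alpha> j \<le> m" using \<alpha> by simp
      have "\<alpha> * real (m - q \<alpha> j) = \<alpha> * real m - \<alpha> * real (q \<alpha> j)" using qm by (simp add: of_nat_diff right_diff_distrib)
      also have "\<dots> \<le> 2 * h" using q j \<alpha> by (simp add: \<alpha>1_def mult.commute)
      finally have "2 * D * (\<alpha> * real (m - q \<alpha> j)) \<le> 2 * D * (2 * h)" using D by (intro mult_left_mono) auto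
      then have "norm (noise Z \<alpha> (x, s) m - noise Z \<alpha> (x, s) (q \<alpha> j)) \<le> \<delta> / 2"
        using incr[OF \<omega>(2) \<alpha>(1) qm m(1)] h(2) by linarith
      then have "\<delta> / 2 \<le> norm (noise Z \<alpha> (x, s) (q \<alpha> j))"
        using m(2) norm_triangle_sub[of "noise Z \<alpha> (x, s) m" "noise Z \<alpha> (x, s) (q \<alpha> j)"] by linarith
      moreover have "\<alpha> * real (q \<alpha> j) \<le> T" using \<open>\<alpha> * real (q \<alpha> j) \<le> \<alpha> * real m\<close> m by linarith
      ultimately show "(x, s) \<in> (\<Union>j\<in>{..J}. G j)" using \<omega> \<open>j \<le> J\<close> by (auto simp: G_def)
    qed
    then have "measure ?P {\<omega> \<in> space ?P. fst \<omega> \<in> K \<and> (\<exists>m. \<alpha> * real m \<le> T \<and> \<delta> < norm (noise Z \<alpha> \<omega> m))}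
        \<le> measure ?P (\<Union>j\<in>{..J}. G j)" by (intro PS.finite_measure_mono) auto
    also have "\<dots> \<le> (\<Sum>j\<in>{..J}. measure ?P (G j))"
      by (rule PS.finite_measure_subadditive_finite) auto
    also have "\<dots> \<le> (\<Sum>j\<in>{..J}. \<alpha> * (4 * T * D\<^sup>2 / \<delta>\<^sup>2))"
    proof (rule sum_mono)
      fix j
      show "measure ?P (G j) \<le> \<alpha> * (4 * T * D\<^sup>2 / \<delta>\<^sup>2)"
      proof (cases "\<alpha> * real (q \<alpha> j) \<le> T")
        case True
        have "measure ?P (G j) \<le> real (q \<alpha> j) * (\<alpha>\<^sup>2 * D\<^sup>2) / (\<delta> / 2)\<^sup>2"
        proof -
          have "G j = {\<omega> \<in> space ?P. fst \<omega> \<in> K \<and> \<delta> / 2 \<le> norm (noise Z \<alpha> \<omega> (q \<alpha> j))}" using True by (auto simp: G_def)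
          moreover have "norm (slice_grad Z (slice_sgd Z \<alpha> \<omega> t) \<theta>) \<le> D" if "fst \<omega> \<in> K" "t < q \<alpha> j" for \<omega> t \<theta>
          proof (rule gradD[OF that(1) \<alpha>(1)])
            have "\<alpha> * real t \<le> \<alpha> * real (q \<alpha> j)" using that \<alpha> by simp
            then show "\<alpha> * real t \<le> T" using True by linarith
          qed
          ultimately show ?thesis using prob_noise_ge_le[OF \<nu> K', of "q \<alpha> j" Z \<alpha> D "\<delta> / 2"] \<delta> by simp
        qed
        also have "\<dots> = (\<alpha> * real (q \<alpha> j)) * (\<alpha> * (4 * D\<^sup>2 / \<delta>\<^sup>2))" by (simp add: power2_eq_square)
        also have "\<dots> \<le> T * (\<alpha> * (4 * D\<^sup>2 / \<delta>\<^sup>2))" using True \<alpha> by (intro mult_right_mono) auto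
        finally show ?thesis by (simp add: mult.assoc mult.left_commute)
      next
        case False
        then show ?thesis using \<alpha> T by (simp add: G_def)
      qed
    qed
    also have "\<dots> = \<alpha> * c" by (simp add: c_def)
    also have "\<dots> \<le> \<alpha> * (c + 1)" using \<alpha> by simp
    also have "\<dots> \<le> \<eta>"
    proof -
      have "\<alpha> \<le> \<eta> / (c + 1)" using \<alpha> by (simp add: \<alpha>1_def)
      then show ?thesis using c by (simp add: field_simps)
    qed
    finally show ?thesis .
  qed
  ultimately show ?thesis by blast
qed

end

section \<open>Measurability of the deviation event\<close>

text \<open>Each interpolated value is a convex combination of two neighbouring iterates; near time
  \<open>T\<close> the second one can have an index one beyond the floor of
  \<open>T / \<alpha>\<close>.\<close>

lemma norm_interpolate_diff_le:
  fixes y y' :: "nat \<Rightarrow> 'a::real_normed_vector"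
  assumes \<alpha>: "\<alpha> > 0" and s: "0 \<le> s" "s \<le> T"
    and le: "\<And>t. t \<le> Suc (nat \<lfloor>T / \<alpha>\<rfloor>) \<Longrightarrow> norm (y t - y' t) \<le> \<delta>"
  shows "norm (interpolate \<alpha> y s - interpolate \<alpha> y' s) \<le> \<delta>"
proof -
  define t where "t = nat \<lfloor>s / \<alpha>\<rfloor>"
  have t: "t \<le> nat \<lfloor>T / \<alpha>\<rfloor>"
    unfolding t_def using s \<alpha> by (intro nat_mono floor_mono divide_right_mono) auto
  define r where "r = s / \<alpha> - real t"
  have "\<alpha> * real t \<le> s" "s \<le> \<alpha> * real (Suc t)"
    unfolding t_def by (rule nat_floor_cell[OF \<alpha> s(1)])+
  then have r: "0 \<le> r" "r \<le> 1" using \<alpha> by (auto simp: r_def field_simps)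
  have "interpolate \<alpha> y s - interpolate \<alpha> y' s = (1 - r) *\<^sub>R (y t - y' t) + r *\<^sub>R (y (Suc t) - y' (Suc t))"
    unfolding interpolate_def Let_def t_def[symmetric] r_def[symmetric] by (simp add: algebra_simps)
  also have "norm \<dots> \<le> (1 - r) * norm (y t - y' t) + r * norm (y (Suc t) - y' (Suc t))"
    using r by (intro norm_triangle_le) simp
  also have "\<dots> \<le> (1 - r) * \<delta> + r * \<delta>"
    using r t by (intro add_mono mult_left_mono le) auto
  finally show ?thesis by (simp add: algebra_simps)
qed

text \<open>As an infimum over an uncountable family of curves, the distance is not visibly
  measurable; semicontinuity helps instead. A curve of \<open>S\<close> witnessing a value below
  \<open>r\<close> still does so after a small change of finitely many iterates, because times after
  \<open>N\<close> contribute at most \<open>(1 / 2) ^ N\<close>.\<close>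

lemma open_d_c_set_interpolate_less:
  fixes S :: "(real \<Rightarrow> real ^ 'd ^ 'n) set"
  assumes \<alpha>: "\<alpha> > 0" and S: "S \<subseteq> C_abs"
  shows "open {y :: nat \<Rightarrow> real ^ 'd ^ 'n. d_c_set (interpolate \<alpha> y) S < r}"
proof (subst open_subopen, intro ballI)
  let ?U = "{y :: nat \<Rightarrow> real ^ 'd ^ 'n. d_c_set (interpolate \<alpha> y) S < r}"
  fix y assume "y \<in> ?U"
  then obtain Y' where Y': "Y' \<in> S" "ereal (d_c (interpolate \<alpha> y) Y') < r"
    by (auto simp: d_c_set_def INF_less_iff)
  then obtain r' where r': "d_c (interpolate \<alpha> y) Y' < r'" "ereal r' < r"
    using ereal_dense2 by fastforce
  define e where "e = r' - d_c (interpolate \<alpha> y) Y'"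
  have e: "e > 0" using r' by (simp add: e_def)
  obtain N where N: "(1 / 2 :: real) ^ N < e / 2"
    using real_arch_pow_inv[of "e / 2" "1 / 2"] e by auto
  define M where "M = Suc (nat \<lfloor>real N / \<alpha>\<rfloor>)"
  define W where "W = (\<Inter>t\<in>{..M}. {y' :: nat \<Rightarrow> real ^ 'd ^ 'n. dist (y' t) (y t) < e / 2})"
  have "open W" unfolding W_def
    by (intro open_INT ballI open_Collect_less continuous_intros) auto
  moreover have "y \<in> W" using e by (simp add: W_def)
  moreover have "W \<subseteq> ?U"
  proof
    fix y' assume y': "y' \<in> W"
    have "d_c (interpolate \<alpha> y') Y' \<le> d_c (interpolate \<alpha> y) Y' + e / 2 + (1 / 2) ^ N"
    proof (rule d_c_perturb)
      fix s assume s: "s \<in> {0..real N}"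
      show "norm (interpolate \<alpha> y' s - interpolate \<alpha> y s) \<le> e / 2"
        by (rule norm_interpolate_diff_le[OF \<alpha>, of s "real N"])
          (use s y' in \<open>auto simp: W_def M_def dist_norm intro: less_imp_le\<close>)
    qed (use e \<alpha> S Y' in \<open>auto intro: continuous_on_interpolate C_abs_continuous_on\<close>)
    then have "d_c (interpolate \<alpha> y') Y' < r'" using N e_def by linarith
    then have "ereal (d_c (interpolate \<alpha> y') Y') < r" using r'(2) by (metis ereal_less_eq(3) le_less_trans less_imp_le)
    then show "y' \<in> ?U" using Y'(1) by (auto simp: d_c_set_def INF_less_iff)
  qed
  ultimately show "\<exists>T. open T \<and> y \<in> T \<and> T \<subseteq> ?U" by blast
qed

lemma measurable_d_c_set_interpolate:
  fixes S :: "(real \<Rightarrow> real ^ 'd ^ 'n) set" and y :: "'a \<Rightarrow> nat \<Rightarrow> real ^ 'd ^ 'n"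
  assumes \<alpha>: "\<alpha> > 0" and S: "S \<subseteq> C_abs" and y: "\<And>t. (\<lambda>\<omega>. y \<omega> t) \<in> borel_measurable M"
  shows "(\<lambda>\<omega>. d_c_set (interpolate \<alpha> (y \<omega>)) S) \<in> borel_measurable M"
proof (rule borel_measurableI_less)
  fix r
  have "y \<in> borel_measurable M" by (rule measurable_coordinatewise_then_product[OF y])
  from measurable_sets[OF this borel_open[OF open_d_c_set_interpolate_less[OF \<alpha> S, of r]]]
  show "{\<omega> \<in> space M. d_c_set (interpolate \<alpha> (y \<omega>)) S < r} \<in> sets M"
    by (simp add: vimage_def Collect_conj_eq[symmetric] Int_def conj_commute)
qed

section \<open>Ties occur with probability zero\<close>

text \<open>For \<open>\<beta> \<noteq> 1\<close> the step is injective on each of the finitely many pieces, with affine inverse.\<close>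

lemma negligible_step_vimage:
  fixes N :: "(real ^ 'd ^ 'n) set"
  assumes \<theta>: "norm \<theta> = 1" and \<beta>: "\<beta> \<noteq> 1" and N: "negligible N"
  shows "negligible {Y. (\<chi> k. Y $ k - \<beta> *\<^sub>R ((\<theta> \<bullet> (Y $ k - z k)) *\<^sub>R \<theta>)) \<in> N}"
proof -
  \<comment> \<open>The step multiplies \<open>\<theta> \<bullet> (Y $ k - z k)\<close> by
    \<open>1 - \<beta>\<close> and changes nothing orthogonal to \<theta>; the coefficient
    \<open>\<beta> / (1 - \<beta>)\<close> restores what was removed.\<close>
  define B where "B W = (\<chi> k. W $ k + (\<beta> / (1 - \<beta>)) *\<^sub>R ((\<theta> \<bullet> (W $ k - z k)) *\<^sub>R \<theta>))" for W :: "real ^ 'd ^ 'n"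
  have "B differentiable_on N"
  proof -
    define L where "L W = (\<chi> k. W $ k + (\<beta> / (1 - \<beta>)) *\<^sub>R ((\<theta> \<bullet> W $ k) *\<^sub>R \<theta>))" for W :: "real ^ 'd ^ 'n"
    define b :: "real ^ 'd ^ 'n" where "b = (\<chi> k. - ((\<beta> / (1 - \<beta>)) *\<^sub>R ((\<theta> \<bullet> z k) *\<^sub>R \<theta>)))"
    have "linear L"
      by (rule linearI) (simp_all add: L_def vec_eq_iff inner_add_right algebra_simps)
    moreover have "B = (\<lambda>W. L W + b)"
      by (simp add: fun_eq_iff vec_eq_iff B_def L_def b_def inner_diff_right algebra_simps)
    ultimately show ?thesis by (simp add: linear_imp_differentiable_on)
  qed
  then have "negligible (B ` N)" by (intro negligible_differentiable_image_negligible N) auto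
  moreover have "{Y. (\<chi> k. Y $ k - \<beta> *\<^sub>R ((\<theta> \<bullet> (Y $ k - z k)) *\<^sub>R \<theta>)) \<in> N} \<subseteq> B ` N"
  proof
    fix Y assume Y: "Y \<in> {Y. (\<chi> k. Y $ k - \<beta> *\<^sub>R ((\<theta> \<bullet> (Y $ k - z k)) *\<^sub>R \<theta>)) \<in> N}"
    define W where "W = (\<chi> k. Y $ k - \<beta> *\<^sub>R ((\<theta> \<bullet> (Y $ k - z k)) *\<^sub>R \<theta>))"
    have "B W $ k = Y $ k" for k
    proof -
      have "\<theta> \<bullet> (W $ k - z k) = (1 - \<beta>) * (\<theta> \<bullet> (Y $ k - z k))"
        using \<theta> by (simp add: W_def inner_diff_right norm_eq_1 algebra_simps)
      then have "(\<beta> / (1 - \<beta>)) *\<^sub>R ((\<theta> \<bullet> (W $ k - z k)) *\<^sub>R \<theta>) = \<beta> *\<^sub>R ((\<theta> \<bullet> (Y $ k - z k)) *\<^sub>R \<theta>)"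
        using \<beta> by simp
      then show ?thesis by (simp add: B_def W_def)
    qed
    then have "Y = B W" by (simp add: vec_eq_iff)
    then show "Y \<in> B ` N" using Y by (auto simp: W_def)
  qed
  ultimately show ?thesis by (rule negligible_subset)
qed

context sphere_measure
begin

text \<open>Null sets are pulled back one step at a time. The preimage under a step is contained in
  the union, over all pairs of permutations, of the preimages under affine maps, regardless of which
  pair the step really uses; so the pieces on which the permutations are constant never have to be
  described.\<close>

lemma negligible_slice_sgd_vimage:
  fixes Z :: "real ^ 'd ^ 'n::{finite,linorder}"
  assumes \<alpha>: "0 < \<alpha>" "\<alpha> < real CARD('n) / 2" and \<theta>: "\<And>t. norm (s t) = 1" and N: "negligible N"
  shows "negligible {Y. slice_sgd Z \<alpha> (Y, s) t \<in> N}"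
  using N
proof (induction t arbitrary: N)
  case (Suc t)
  define \<beta> where "\<beta> = 2 * \<alpha> / real CARD('n)"
  define A where "A p q Y = (\<chi> k. Y $ k - \<beta> *\<^sub>R ((s (Suc t) \<bullet> (Y $ k - Z $ (q \<circ> inv p) k)) *\<^sub>R s (Suc t)))"
    for p q :: "'n \<Rightarrow> 'n" and Y :: "real ^ 'd ^ 'n::{finite,linorder}"
  define N' where "N' = \<Union> ((\<lambda>(p, q). {Y. A p q Y \<in> N}) ` UNIV)"
  have \<beta>: "\<beta> \<noteq> 1" using \<alpha> by (simp add: \<beta>_def field_simps)
  have "negligible {Y. A p q Y \<in> N}" for p q
    unfolding A_def by (rule negligible_step_vimage[OF \<theta> \<beta> Suc.prems])
  then have "negligible N'" unfolding N'_def by (intro negligible_Union) auto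
  moreover have "{Y. slice_sgd Z \<alpha> (Y, s) (Suc t) \<in> N} \<subseteq> {Y. slice_sgd Z \<alpha> (Y, s) t \<in> N'}"
  proof
    fix Y assume Y: "Y \<in> {Y. slice_sgd Z \<alpha> (Y, s) (Suc t) \<in> N}"
    let ?X = "slice_sgd Z \<alpha> (Y, s) t" and ?\<theta> = "s (Suc t)"
    have "slice_sgd Z \<alpha> (Y, s) (Suc t) = A (canonical_sort ?\<theta> ?X) (canonical_sort ?\<theta> Z) ?X"
      using \<theta> by (simp add: vec_eq_iff slice_grad_def sgd_grad_def A_def \<beta>_def)
    then have "A (canonical_sort ?\<theta> ?X) (canonical_sort ?\<theta> Z) ?X \<in> N" using Y by simp
    then show "Y \<in> {Y. slice_sgd Z \<alpha> (Y, s) t \<in> N'}" unfolding N'_def by blast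
  qed
  ultimately show ?case using Suc.IH negligible_subset by blast
qed simp

text \<open>The randomness of the initial point does the work, which is why discrete laws of
  directions are allowed: for fixed directions the initial points that lead to a tie form a
  Lebesgue-null set, to which \<nu> gives no mass. Fubini then exchanges the order of initial point
  and directions.\<close>

lemma AE_tie_free:
  fixes Z :: "real ^ 'd ^ 'n::{finite,linorder}"
  assumes \<alpha>: "0 < \<alpha>" "\<alpha> < real CARD('n) / 2"
    and \<nu>: "prob_space \<nu>" "sets \<nu> = sets borel" "absolutely_continuous lborel \<nu>"
  shows "AE \<omega> in \<nu> \<Otimes>\<^sub>M directions. \<forall>t. norm (snd \<omega> (Suc t)) = 1 \<and> tie_free (snd \<omega> (Suc t)) (slice_sgd Z \<alpha> \<omega> t)"
proof -
  interpret S: prob_space directions by (rule prob_space_directions)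
  interpret \<nu>: prob_space \<nu> by (rule \<nu>)
  interpret PS: pair_prob_space \<nu> directions ..
  note [measurable_cong] = \<nu>(2) and [measurable] = measurable_slice_sgd[OF \<nu>(2)]
  have [measurable]: "(\<lambda>\<omega>. snd \<omega> t) \<in> borel_measurable (\<nu> \<Otimes>\<^sub>M directions)" for t
    by measurable
  have norm1: "AE s in directions. \<forall>t. norm (s t) = 1"
    unfolding AE_all_countable
    using AE_PiM_component[of UNIV "\<lambda>_. \<mu>" _ "\<lambda>\<theta>. norm \<theta> = 1"] prob_space_axioms AE_norm by auto
  have sect: "AE s in directions. AE x in \<nu>. \<forall>t. norm (s (Suc t)) = 1 \<and> tie_free (s (Suc t)) (slice_sgd Z \<alpha> (x, s) t)"
    using norm1
  proof eventually_elim
    case (elim s)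
    have "AE x in \<nu>. tie_free (s (Suc t)) (slice_sgd Z \<alpha> (x, s) t)" for t
    proof -
      have "s (Suc t) \<noteq> 0" using elim[rule_format, of "Suc t"] by auto
      then have "negligible {Y. slice_sgd Z \<alpha> (Y, s) t \<in> {X. \<not> tie_free (s (Suc t)) X}}"
        using elim by (intro negligible_slice_sgd_vimage \<alpha> negligible_not_tie_free) auto
      then have "AE x in lebesgue. x \<notin> {Y. slice_sgd Z \<alpha> (Y, s) t \<in> {X. \<not> tie_free (s (Suc t)) X}}"
        unfolding negligible_iff_null_sets by (rule AE_not_in)
      then have "AE x in lborel. tie_free (s (Suc t)) (slice_sgd Z \<alpha> (x, s) t)"
        by (simp add: AE_completion_iff)
      then obtain N where N: "\<And>x. x \<in> space lborel - N \<Longrightarrow> tie_free (s (Suc t)) (slice_sgd Z \<alpha> (x, s) t)" "N \<in> null_sets lborel"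
        by (rule AE_E3) blast
      then have "N \<in> null_sets \<nu>" using \<nu>(3) by (auto simp: absolutely_continuous_def)
      then have "AE x in \<nu>. x \<notin> N" by (rule AE_not_in)
      then show ?thesis by eventually_elim (use N in auto)
    qed
    then show ?case using elim by (simp add: AE_all_countable)
  qed
  have "AE x in \<nu>. AE s in directions. \<forall>t. norm (s (Suc t)) = 1 \<and> tie_free (s (Suc t)) (slice_sgd Z \<alpha> (x, s) t)"
  proof (subst PS.AE_commute)
    show "{\<omega> \<in> space (\<nu> \<Otimes>\<^sub>M directions). \<forall>t. norm (snd \<omega> (Suc t)) = 1 \<and>
        tie_free (snd \<omega> (Suc t)) (slice_sgd Z \<alpha> (fst \<omega>, snd \<omega>) t)} \<in> sets (\<nu> \<Otimes>\<^sub>M directions)"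
      unfolding prod.collapse by measurable
  qed (rule sect)
  then have "AE x in \<nu>. AE s in directions. \<forall>t. norm (snd (x, s) (Suc t)) = 1 \<and>
        tie_free (snd (x, s) (Suc t)) (slice_sgd Z \<alpha> (x, s) t)" by simp
  then show ?thesis
    by (rule PS.AE_pair_measure[rotated]) measurable
qed

lemma sgd_eq_slice_sgd:
  assumes \<tau>: "\<And>\<theta> X. \<theta> \<in> sphere 0 1 \<Longrightarrow> sorts_along \<theta> X (\<tau> \<theta> X)"
    and "\<And>t. norm (snd \<omega> (Suc t)) = 1" "\<And>t. tie_free (snd \<omega> (Suc t)) (slice_sgd Z \<alpha> \<omega> t)"
  shows "sgd \<tau> Z \<alpha> \<omega> = slice_sgd Z \<alpha> \<omega>"
proof
  fix t show "sgd \<tau> Z \<alpha> \<omega> t = slice_sgd Z \<alpha> \<omega> t"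
  proof (induction t)
    case (Suc t)
    have "sgd_grad \<tau> Z (slice_sgd Z \<alpha> \<omega> t) (snd \<omega> (Suc t)) = slice_grad Z (slice_sgd Z \<alpha> \<omega> t) (snd \<omega> (Suc t))"
      unfolding slice_grad_def using assms(2,3)
      by (auto intro!: sgd_grad_cong \<tau> sorts_along_canonical_sort)
    then show ?case using Suc by simp
  qed simp
qed

end

section \<open>Convergence of the interpolated trajectories\<close>

lemma sphere_measure_uniform: "sphere_measure (sphere_uniform :: (real ^ 'd) measure)"
proof -
  have ball: "emeasure lborel (ball (0 :: real ^ 'd) 1) \<noteq> 0" "emeasure lborel (ball (0 :: real ^ 'd) 1) \<noteq> \<infinity>"
    using emeasure_lborel_ball_finite[of "0 :: real ^ 'd" 1] less_imp_neq[OF unit_ball_vol_pos[of "real CARD('d)"]]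
    by (simp_all add: emeasure_ball)
  interpret U: prob_space "uniform_measure lborel (ball (0 :: real ^ 'd) 1)"
    by (rule prob_space_uniform_measure[OF ball])
  have meas: "(\<lambda>x :: real ^ 'd. x /\<^sub>R norm x) \<in> uniform_measure lborel (ball 0 1) \<rightarrow>\<^sub>M borel" by measurable
  interpret prob_space "sphere_uniform :: (real ^ 'd) measure"
    unfolding sphere_uniform_def by (rule U.prob_space_distr[OF meas])
  show ?thesis
  proof
    show "sets (sphere_uniform :: (real ^ 'd) measure) = sets borel" by (simp add: sphere_uniform_def)
    have "AE x in uniform_measure lborel (ball (0 :: real ^ 'd) 1). x \<noteq> 0"
    proof (rule AE_uniform_measureI)
      show "AE x in lborel. x \<in> ball (0 :: real ^ 'd) 1 \<longrightarrow> x \<noteq> 0"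
        using AE_lborel_singleton[of "0 :: real ^ 'd"] by eventually_elim simp
    qed simp
    then have "AE x in uniform_measure lborel (ball (0 :: real ^ 'd) 1). norm (x /\<^sub>R norm x) = 1"
      by eventually_elim simp
    then show "AE \<theta> in (sphere_uniform :: (real ^ 'd) measure). norm \<theta> = 1"
      unfolding sphere_uniform_def by (subst AE_distr_iff[OF meas]) auto
  qed
qed

lemma sphere_measure_empirical:
  fixes p :: nat
  assumes "p \<ge> 1" "\<And>i. i \<in> {1..p} \<Longrightarrow> norm (\<theta>s i :: real ^ 'd) = 1"
  shows "sphere_measure (empirical_measure {1..p} \<theta>s)"
proof -
  interpret U: prob_space "uniform_count_measure {1..p}"
    using assms(1) by (intro prob_space_uniform_count_measure) auto
  have meas: "\<theta>s \<in> uniform_count_measure {1..p} \<rightarrow>\<^sub>M borel" by simp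
  interpret prob_space "empirical_measure {1..p} \<theta>s"
    unfolding empirical_measure_def by (rule U.prob_space_distr[OF meas])
  show ?thesis
  proof
    show "sets (empirical_measure {1..p} \<theta>s) = sets borel" by (simp add: empirical_measure_def)
    show "AE \<theta> in empirical_measure {1..p} \<theta>s. norm \<theta> = 1"
      unfolding empirical_measure_def
      by (subst AE_distr_iff[OF meas]) (auto intro!: AE_I2 assms(2) simp: space_uniform_count_measure)
  qed
qed

theorem (in sphere_measure) deviation_tends_to_zero:
  fixes Z :: "real ^ 'd ^ 'n::{finite,linorder}"
  defines "F \<equiv> \<lambda>Y. \<integral>\<theta>. w_slice Z \<theta> Y \<partial>\<mu>"
  assumes \<tau>: "\<And>\<theta> X. \<theta> \<in> sphere 0 1 \<Longrightarrow> sorts_along \<theta> X (\<tau> \<theta> X)"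
    and \<alpha>0: "\<alpha>\<^sub>0 < real CARD('n) / 2"
    and \<nu>: "prob_space \<nu>" "sets \<nu> = sets borel" "absolutely_continuous lborel \<nu>"
    and K: "compact K" and \<epsilon>: "\<epsilon> > 0"
  shows "\<forall>\<alpha>\<in>{0<..\<alpha>\<^sub>0}. deviation \<tau> Z F K \<epsilon> \<alpha> \<in> sets (sgd_prob \<nu> \<mu>)"
    and "((\<lambda>\<alpha>. measure (sgd_prob \<nu> \<mu>) (deviation \<tau> Z F K \<epsilon> \<alpha>)) \<longlongrightarrow> 0) (at 0 within {0<..\<alpha>\<^sub>0})"
proof -
  interpret S: prob_space directions by (rule prob_space_directions)
  interpret \<nu>: prob_space \<nu> by (rule \<nu>)
  interpret PS: pair_prob_space \<nu> directions ..
  have K': "K \<in> sets borel" using K by (simp add: compact_imp_closed)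
  note [measurable_cong] = \<nu>(2) and [measurable] = K' measurable_slice_sgd[OF \<nu>(2)] measurable_noise[OF \<nu>(2)]
  let ?P = "\<nu> \<Otimes>\<^sub>M directions"
  \<comment> \<open>The same event for the measurable recursion; it lies in the product
    \<sigma>-algebra before completion.\<close>
  define dev where "dev \<alpha> = {\<omega> \<in> space ?P. fst \<omega> \<in> K \<and>
    ereal \<epsilon> < d_c_set (interpolate \<alpha> (slice_sgd Z \<alpha> \<omega>)) (clarke_flow F K)}" for \<alpha>
  have dev_sets: "dev \<alpha> \<in> sets ?P" if "0 < \<alpha>" for \<alpha>
  proof -
    have [measurable]: "(\<lambda>\<omega>. d_c_set (interpolate \<alpha> (slice_sgd Z \<alpha> \<omega>)) (clarke_flow F K)) \<in> borel_measurable ?P"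
      by (rule measurable_d_c_set_interpolate[OF that]) (auto simp: clarke_flow_def)
    show ?thesis unfolding dev_def by measurable
  qed
  have "space \<nu> = UNIV" "space \<mu> = UNIV" using sets_eq_imp_space_eq[OF \<nu>(2)] sets_eq_imp_space_eq[OF sets_eq] by auto
  then have spP: "space ?P = UNIV" by (simp add: space_pair_measure space_PiM)
  \<comment> \<open>Outside a null set the two recursions coincide, so the two events differ by
    subsets of a null set, which the completion makes measurable and of measure zero.\<close>
  have eq: "deviation \<tau> Z F K \<epsilon> \<alpha> \<in> sets (completion ?P) \<and>
      measure (completion ?P) (deviation \<tau> Z F K \<epsilon> \<alpha>) = measure ?P (dev \<alpha>)" if \<alpha>: "\<alpha> \<in> {0<..\<alpha>\<^sub>0}" for \<alpha>
  proof -
    have "AE \<omega> in ?P. sgd \<tau> Z \<alpha> \<omega> = slice_sgd Z \<alpha> \<omega>"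
      using AE_tie_free[of \<alpha> \<nu> Z] \<alpha> \<alpha>0 \<nu> by (auto intro!: sgd_eq_slice_sgd \<tau> elim!: eventually_mono)
    then obtain N where N: "\<And>\<omega>. \<omega> \<in> space ?P - N \<Longrightarrow> sgd \<tau> Z \<alpha> \<omega> = slice_sgd Z \<alpha> \<omega>" "N \<in> null_sets ?P"
      by (rule AE_E3) blast
    let ?D = "deviation \<tau> Z F K \<epsilon> \<alpha>"
    have D: "\<omega> \<in> ?D \<longleftrightarrow> \<omega> \<in> dev \<alpha>" if "\<omega> \<notin> N" for \<omega>
      using N(1)[of \<omega>] that by (simp add: deviation_def dev_def spP)
    have Nc: "N \<in> null_sets (completion ?P)" using N(2) by (rule null_sets_completionI)
    have devc: "dev \<alpha> \<in> sets (completion ?P)" using dev_sets \<alpha> by (auto intro: sets_completionI_sets)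
    have "?D = (dev \<alpha> - N) \<union> (?D \<inter> N)" using D by blast
    moreover have "?D \<inter> N \<in> null_sets (completion ?P)"
      by (rule null_sets_completion_subset[OF _ Nc]) auto
    ultimately have "?D \<in> sets (completion ?P)"
      using devc Nc by (metis sets.Diff sets.Un null_setsD2)
    moreover have "measure (completion ?P) ?D = measure (completion ?P) (dev \<alpha>)"
    proof (rule measure_eq_AE[OF _ calculation devc])
      show "AE \<omega> in completion ?P. \<omega> \<in> ?D \<longleftrightarrow> \<omega> \<in> dev \<alpha>"
        using AE_not_in[OF Nc] by eventually_elim (rule D)
    qed
    ultimately show ?thesis using dev_sets[of \<alpha>] \<alpha> by (simp add: measure_completion)
  qed
  then show "\<forall>\<alpha>\<in>{0<..\<alpha>\<^sub>0}. deviation \<tau> Z F K \<epsilon> \<alpha> \<in> sets (sgd_prob \<nu> \<mu>)"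
    by (simp add: sgd_prob_def)
  show "((\<lambda>\<alpha>. measure (sgd_prob \<nu> \<mu>) (deviation \<tau> Z F K \<epsilon> \<alpha>)) \<longlongrightarrow> 0) (at 0 within {0<..\<alpha>\<^sub>0})"
  proof (rule tendstoI)
    fix \<eta> :: real assume "0 < \<eta>"
    then have \<eta>: "0 < \<eta> / 2" by simp
    have "0 \<le> 2 * (1 + norm Z)" by simp
    from clarke_flow_stability[OF semiconcave_energy[of Z, folded F_def] isCont_mean_grad_dense K this \<epsilon>]
    obtain T \<delta> \<alpha>1 where T: "0 < T" "0 < \<delta>" "0 < \<alpha>1" and stab:
      "\<And>\<alpha> y. 0 < \<alpha> \<Longrightarrow> \<alpha> < \<alpha>1 \<Longrightarrow> y 0 \<in> K \<Longrightarrow>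
        (\<And>t. norm (y (Suc t) - y t) \<le> \<alpha> * (2 * (1 + norm Z) * (1 + norm (y t)))) \<Longrightarrow>
        (\<And>m. \<alpha> * real m \<le> T \<Longrightarrow> norm (y m - y 0 + \<alpha> *\<^sub>R (\<Sum>t<m. mean_grad Z (y t))) \<le> \<delta>) \<Longrightarrow>
        d_c_set (interpolate \<alpha> y) (clarke_flow F K) \<le> ereal \<epsilon>"
      by metis
    let ?bad = "\<lambda>\<alpha>. {\<omega> \<in> space ?P. fst \<omega> \<in> K \<and> (\<exists>m. \<alpha> * real m \<le> T \<and> \<delta> < norm (noise Z \<alpha> \<omega> m))}"
    obtain \<alpha>2 where \<alpha>2: "0 < \<alpha>2" "\<And>\<alpha>. 0 < \<alpha> \<Longrightarrow> \<alpha> < \<alpha>2 \<Longrightarrow> measure ?P (?bad \<alpha>) \<le> \<eta> / 2"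
      using noise_tends_to_zero[OF \<nu>(1,2) K T(1,2) \<eta>, of Z] by blast
    show "\<forall>\<^sub>F \<alpha> in at 0 within {0<..\<alpha>\<^sub>0}. dist (measure (sgd_prob \<nu> \<mu>) (deviation \<tau> Z F K \<epsilon> \<alpha>)) 0 < \<eta>"
      unfolding eventually_at
    proof (intro exI[of _ "min \<alpha>1 \<alpha>2"] conjI ballI impI)
      fix \<alpha> assume \<alpha>: "\<alpha> \<in> {0<..\<alpha>\<^sub>0}" "\<alpha> \<noteq> 0 \<and> dist \<alpha> 0 < min \<alpha>1 \<alpha>2"
      then have \<alpha>': "0 < \<alpha>" "\<alpha> < \<alpha>1" "\<alpha> < \<alpha>2" by auto
      \<comment> \<open>The contrapositive of stability, applied to each outcome separately: with
        small noise up to time \<open>T\<close>, a trajectory started in \<open>K\<close> is within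
        \<epsilon> of the flow.\<close>
      have "dev \<alpha> \<subseteq> ?bad \<alpha>"
      proof (rule subsetI, rule ccontr)
        fix \<omega> assume \<omega>: "\<omega> \<in> dev \<alpha>" "\<omega> \<notin> ?bad \<alpha>"
        have "d_c_set (interpolate \<alpha> (slice_sgd Z \<alpha> \<omega>)) (clarke_flow F K) \<le> ereal \<epsilon>"
        proof (rule stab[OF \<alpha>'(1,2)])
          show "slice_sgd Z \<alpha> \<omega> 0 \<in> K" using \<omega>(1) by (simp add: dev_def)
          show "norm (slice_sgd Z \<alpha> \<omega> (Suc t) - slice_sgd Z \<alpha> \<omega> t)
              \<le> \<alpha> * (2 * (1 + norm Z) * (1 + norm (slice_sgd Z \<alpha> \<omega> t)))" for t
            using \<alpha>' by (intro norm_slice_sgd_step) simp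
          show "norm (slice_sgd Z \<alpha> \<omega> m - slice_sgd Z \<alpha> \<omega> 0 + \<alpha> *\<^sub>R (\<Sum>t<m. mean_grad Z (slice_sgd Z \<alpha> \<omega> t))) \<le> \<delta>"
            if "\<alpha> * real m \<le> T" for m
            using \<omega> that unfolding noise_def[symmetric] by (auto simp: dev_def not_less)
        qed
        with \<omega>(1) show False unfolding dev_def using leD by blast
      qed
      then have "measure ?P (dev \<alpha>) \<le> measure ?P (?bad \<alpha>)"
        by (intro PS.finite_measure_mono) measurable
      also have "\<dots> \<le> \<eta> / 2" by (rule \<alpha>2(2)[OF \<alpha>'(1,3)])
      finally have "measure ?P (dev \<alpha>) < \<eta>" using \<eta> by simp
      then show "dist (measure (sgd_prob \<nu> \<mu>) (deviation \<tau> Z F K \<epsilon> \<alpha>)) 0 < \<eta>"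
        using eq[OF \<alpha>(1)] by (simp add: sgd_prob_def)
    qed (use T \<alpha>2 in simp)
  qed
qed

theorem theorem4p1:
  fixes Z :: "real ^ 'd ^ 'n::{finite,linorder}"
    and F :: "real ^ 'd ^ 'n::{finite,linorder} \<Rightarrow> real"
    and \<mu> :: "(real ^ 'd) measure"
    and \<tau> :: "real ^ 'd \<Rightarrow> real ^ 'd ^ 'n::{finite,linorder} \<Rightarrow> 'n \<Rightarrow> 'n"
    and \<alpha>\<^sub>0 :: real
    and \<nu> :: "(real ^ 'd ^ 'n::{finite,linorder}) measure"
    and K :: "(real ^ 'd ^ 'n::{finite,linorder}) set"
    and \<epsilon> :: real
  assumes "(F, \<mu>) = (sliced_energy Z, sphere_uniform) \<or>
      (\<exists>p \<theta>s. p \<ge> 1 \<and> (\<forall>i\<in>{1..p}. \<theta>s i \<in> sphere 0 1) \<and> span (\<theta>s ` {1..p}) = UNIV \<and>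
         (F, \<mu>) = (sliced_energy_p p \<theta>s Z, empirical_measure {1..p} \<theta>s))"
    and "\<And>\<theta> X. \<theta> \<in> sphere 0 1 \<Longrightarrow> sorts_along \<theta> X (\<tau> \<theta> X)"
    and "0 < \<alpha>\<^sub>0" and "\<alpha>\<^sub>0 < real CARD('n) / 2"
    and "prob_space \<nu>" and "sets \<nu> = sets borel" and "absolutely_continuous lborel \<nu>"
    and "compact K" and "\<epsilon> > 0"
  shows "(\<forall>\<alpha>\<in>{0<..\<alpha>\<^sub>0}. deviation \<tau> Z F K \<epsilon> \<alpha> \<in> sets (sgd_prob \<nu> \<mu>)) \<and>
         ((\<lambda>\<alpha>. measure (sgd_prob \<nu> \<mu>) (deviation \<tau> Z F K \<epsilon> \<alpha>)) \<longlongrightarrow> 0)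
           (at 0 within {0<..\<alpha>\<^sub>0})"
proof -
  have \<mu>F: "sphere_measure \<mu> \<and> F = (\<lambda>Y. \<integral>\<theta>. w_slice Z \<theta> Y \<partial>\<mu>)"
    using assms(1)
  proof
    assume "(F, \<mu>) = (sliced_energy Z, sphere_uniform)"
    then show ?thesis by (simp add: sphere_measure_uniform fun_eq_iff sliced_energy_def)
  next
    assume "\<exists>p \<theta>s. p \<ge> 1 \<and> (\<forall>i\<in>{1..p}. \<theta>s i \<in> sphere 0 1) \<and> span (\<theta>s ` {1..p}) = UNIV \<and>
         (F, \<mu>) = (sliced_energy_p p \<theta>s Z, empirical_measure {1..p} \<theta>s)"
    then obtain p \<theta>s where p: "p \<ge> 1" "\<forall>i\<in>{1..p}. \<theta>s i \<in> sphere 0 1"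
      and eq: "F = sliced_energy_p p \<theta>s Z" "\<mu> = empirical_measure {1..p} \<theta>s" by blast
    have "sphere_measure (empirical_measure {1..p} \<theta>s)" by (rule sphere_measure_empirical) (use p in auto)
    then show ?thesis by (simp add: eq fun_eq_iff sliced_energy_p_def)
  qed
  then interpret sphere_measure \<mu> by simp
  show ?thesis
    unfolding conjunct2[OF \<mu>F] using assms(2-) by (intro conjI deviation_tends_to_zero) auto
qed

end
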